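(* For the inhomogeneous six-vertex model on the kagome lattice on a torus described in the context, the statistical sum $S(u,w)$ is invariant, for all $u,w$, under the evolution of the (reduced) $2+1$-dimensional model. Moreover, with $s(x,y)=S(u,w)$ and $f(x,y)=I(u,w)$ regarded as functions of the monomials $x,y$ attached to two basis cycles of the torus, where $I(u,w)=\det\Bigl(\mathbf 1-\mathcal A\,\mathrm{diag}(u^{-1}\mathbf 1,\,u^{-1}w^{-1}\mathbf 1,\,w^{-1}\mathbf 1)\Bigr)$, $$s(x,y)=\tfrac12\bigl(-f(x,y)+f(-x,y)+f(x,-y)+f(-x,-y)\bigr),$$ $$f(x,y)=\tfrac12\bigl(-s(x,y)+s(-x,y)+s(x,-y)+s(-x,-y)\bigr).$$
   Context: Torus and triangular lattice: let $\Lambda\subset\mathbb Z^2$ be a sublattice of rank 2; vertices are $p\in\mathbb Z^2/\Lambda$. Each vertex $p$ has three incoming edges: horizontal (from $p-(1,0)$), oblique (from $p-(1,1)$), vertical (from $p-(0,1)$), and three outgoing edges: horizontal to $p+(1,0)$, oblique to $p+(1,1)$, vertical to $p+(0,1)$. Let $X_p,Y_p,Z_p$ be coordinates corresponding to the horizontal, oblique, vertical incoming edges of $p$. Kagome lattice: each vertex $p$ is replaced by three vertices $p_1$ (crossing of a horizontal and an oblique line), $p_2$ (horizontal and vertical), $p_3$ (oblique and vertical). The oriented edges are: horizontal $p_2\to p_1$ and $p_1\to(p+(1,0))_2$; oblique $p_3\to p_1$ and $p_1\to (p+(1,1))_3$; vertical $p_3\to p_2$ and $p_2\to (p+(0,1))_3$.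 So every kagome vertex has two incoming and two outgoing edges, lying on two lines. To $p_k$ is attached a complex $2\times2$ matrix $\begin{pmatrix}a_k&b_k\\c_k&d_k\end{pmatrix}(p)$ whose rows correspond to outgoing and columns to incoming edges; the order of lines is (horizontal, oblique) for $k=1$, (horizontal, vertical) for $k=2$, (oblique, vertical) for $k=3$. Put $$M_1=\begin{pmatrix}a_1&b_1&0\\c_1&d_1&0\\0&0&1\end{pmatrix},\quad M_2=\begin{pmatrix}a_2&0&b_2\\0&1&0\\c_2&0&d_2\end{pmatrix},\quad M_3=\begin{pmatrix}1&0&0\\0&a_3&b_3\\0&c_3&d_3\end{pmatrix}$$ (all depending on $p$). The operator $\mathcal A$ acts on vectors $(X,Y,Z)$ by: the components of $\mathcal A(X,Y,Z)^{\mathrm T}$ at the edges outgoing from $p$, i.e. the components number $X_{p+(1,0)},Y_{p+(1,1)},Z_{p+(0,1)}$, form the column $M_1(p)M_2(p)M_3(p)(X_p,Y_p,Z_p)^{\mathrm T}$. Six-vertex model: each kagome edge either carries an arrow (along its orientation) or not. Vertex weights: $1$ if no edge at the vertex carries an arrow; if exactly one incoming and exactly one outgoing edge carry arrows, the corresponding matrix element; if both incoming and both outgoing edges carry arrows, (product of the two off-diagonal elements) $-$ (product of the two diagonal elements), i.e. $b_kc_k-a_kd_k$; otherwise $0$. Edge weights: $1$ for an edge without arrow; $u^{-1/2}$, $w^{-1/2}$, $u^{-1/2}w^{-1/2}$ for a horizontal, vertical, oblique edge with an arrow. $S(u,w)$ is the sum over all arrow configurations of the product of all vertex and edge weights (only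 integer powers of $u,w$ occur). Variables $x,y$: a cycle $(p,q)\in\Lambda=H_1(\text{torus})$ has attached monomial $u^{-p}w^{-q}$; $x$ and $y$ are the monomials attached to two basis elements of $\Lambda$. They are algebraically independent, and $S,I$ are Laurent polynomials in $x,y$. Evolution: one step replaces the family $(M_1,M_2,M_3)$ by a family $(M_1',M_2',M_3')$ of matrices of the same respective forms such that for every $p$ $$M_1'(p)M_2'(p)M_3'(p)=M_3\bigl(p+(1,1)\bigr)\,M_2\bigl(p+(1,0)\bigr)\,M_1(p)$$ (for generic matrices such a factorization exists and is unique up to gauge transformations). Invariance of $S$ means that $S$ computed from $(M_k')$ equals $S$ computed from $(M_k)$. *)

theory Defs
  imports "HOL-Analysis.Analysis" "HOL-Combinatorics.Permutations"
begin

definition int_comb :: "int \<times> int \<Rightarrow> int \<times> int \<Rightarrow> int \<times> int \<Rightarrow> int \<times> int" where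
  "int_comb \<alpha> \<beta> = (\<lambda>(m, n). (m * fst \<alpha> + n * fst \<beta>, m * snd \<alpha> + n * snd \<beta>))"

text \<open>Every element of \<open>\<Lambda>\<close> is an integer combination of \<open>\<alpha>\<close> and \<open>\<beta>\<close> in exactly one way.\<close>

definition lattice_basis :: "(int \<times> int) set \<Rightarrow> int \<times> int \<Rightarrow> int \<times> int \<Rightarrow> bool" where
  "lattice_basis \<Lambda> \<alpha> \<beta> \<longleftrightarrow> bij_betw (int_comb \<alpha> \<beta>) UNIV \<Lambda>"

definition rank2_sublattice :: "(int \<times> int) set \<Rightarrow> bool" where
  "rank2_sublattice \<Lambda> \<longleftrightarrow> (\<exists>\<alpha> \<beta>. lattice_basis \<Lambda> \<alpha> \<beta>)"

type_synonym vertex = "(int \<times> int) set"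

definition vertices :: "(int \<times> int) set \<Rightarrow> vertex set" where
  "vertices \<Lambda> = UNIV // {(p, q). q - p \<in> \<Lambda>}"

definition shift :: "int \<times> int \<Rightarrow> vertex \<Rightarrow> vertex" where
  "shift v P = (+) v ` P"

datatype line = Hor | Obl | Ver

fun dir :: "line \<Rightarrow> int \<times> int" where
  "dir Hor = (1, 0)"
| "dir Obl = (1, 1)"
| "dir Ver = (0, 1)"

text \<open>
  The vertices \<open>p\<^sub>1\<close>, \<open>p\<^sub>2\<close>, \<open>p\<^sub>3\<close> that replace \<open>p\<close> are \<open>(HO, p)\<close>, \<open>(HV, p)\<close>, \<open>(OV, p)\<close>,
  named after the two lines crossing there.
\<close>

datatype crossing = HO | HV | OV

fun crossing_lines :: "crossing \<Rightarrow> line \<times> line" where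
  "crossing_lines HO = (Hor, Obl)"
| "crossing_lines HV = (Hor, Ver)"
| "crossing_lines OV = (Obl, Ver)"

text \<open>
  On each line, the edge \<open>Inner\<close> at \<open>p\<close> joins two of the three vertices replacing \<open>p\<close>, and the
  edge \<open>Outer\<close> at \<open>p\<close> leads from there to the vertices replacing the next point of the line.
\<close>

datatype half = Inner | Outer

type_synonym edge = "line \<times> half \<times> vertex"

fun source :: "edge \<Rightarrow> crossing \<times> vertex" where
  "source (Hor, Inner, p) = (HV, p)"
| "source (Hor, Outer, p) = (HO, p)"
| "source (Obl, Inner, p) = (OV, p)"
| "source (Obl, Outer, p) = (HO, p)"
| "source (Ver, Inner, p) = (OV, p)"
| "source (Ver, Outer, p) = (HV, p)"

fun target :: "edge \<Rightarrow> crossing \<times> vertex" where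
  "target (Hor, Inner, p) = (HO, p)"
| "target (Hor, Outer, p) = (HV, shift (dir Hor) p)"
| "target (Obl, Inner, p) = (HO, p)"
| "target (Obl, Outer, p) = (OV, shift (dir Obl) p)"
| "target (Ver, Inner, p) = (HV, p)"
| "target (Ver, Outer, p) = (OV, shift (dir Ver) p)"

definition edges :: "(int \<times> int) set \<Rightarrow> edge set" where
  "edges \<Lambda> = UNIV \<times> UNIV \<times> vertices \<Lambda>"

text \<open>
  Rows of the matrix \<open>W c p\<close> correspond to outgoing and columns to incoming edges at \<open>(c, p)\<close>,
  both ordered as in \<open>crossing_lines c\<close>.  Only the values at \<open>p \<in> vertices \<Lambda>\<close> matter.
\<close>

type_synonym matrix_family = "crossing \<Rightarrow> vertex \<Rightarrow> complex^2^2"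

fun embed :: "crossing \<Rightarrow> complex^2^2 \<Rightarrow> complex^3^3" where
  "embed HO A = vector [vector [A$1$1, A$1$2, 0],
                        vector [A$2$1, A$2$2, 0],
                        vector [0,     0,     1]]"
| "embed HV A = vector [vector [A$1$1, 0, A$1$2],
                        vector [0,     1, 0    ],
                        vector [A$2$1, 0, A$2$2]]"
| "embed OV A = vector [vector [1, 0,     0    ],
                        vector [0, A$1$1, A$1$2],
                        vector [0, A$2$1, A$2$2]]"

definition evolution_step :: "(int \<times> int) set \<Rightarrow> matrix_family \<Rightarrow> matrix_family \<Rightarrow> bool" where
  "evolution_step \<Lambda> W W' \<longleftrightarrow> (\<forall>p\<in>vertices \<Lambda>.
     embed HO (W' HO p) ** embed HV (W' HV p) ** embed OV (W' OV p) =
     embed OV (W OV (shift (1, 1) p)) ** embed HV (W HV (shift (1, 0) p)) ** embed HO (W HO p))"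

text \<open>
  The Leibniz formula, as for \<^const>\<open>det\<close>, but over a finite index set instead of a finite
  index type.
\<close>

definition det_on :: "'i set \<Rightarrow> ('i \<Rightarrow> 'i \<Rightarrow> complex) \<Rightarrow> complex" where
  "det_on J A = (\<Sum>\<sigma> | \<sigma> permutes J. of_int (sign \<sigma>) * (\<Prod>i\<in>J. A i (\<sigma> i)))"

text \<open>The coordinates \<open>X\<^sub>p\<close>, \<open>Y\<^sub>p\<close>, \<open>Z\<^sub>p\<close> have the indices \<open>(Hor, p)\<close>, \<open>(Obl, p)\<close>, \<open>(Ver, p)\<close>.\<close>

fun component :: "line \<Rightarrow> 3" where
  "component Hor = 1"
| "component Obl = 2"
| "component Ver = 3"

definition op_A :: "matrix_family \<Rightarrow> line \<times> vertex \<Rightarrow> line \<times> vertex \<Rightarrow> complex" where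
  "op_A W = (\<lambda>(l, q) (l', p).
     if q = shift (dir l) p
     then (embed HO (W HO p) ** embed HV (W HV p) ** embed OV (W OV p)) $ component l $ component l'
     else 0)"

fun diag_entry :: "complex \<Rightarrow> complex \<Rightarrow> line \<times> vertex \<Rightarrow> complex" where
  "diag_entry u w (Hor, p) = inverse u"
| "diag_entry u w (Obl, p) = inverse u * inverse w"
| "diag_entry u w (Ver, p) = inverse w"

definition I_det :: "(int \<times> int) set \<Rightarrow> matrix_family \<Rightarrow> complex \<Rightarrow> complex \<Rightarrow> complex" where
  "I_det \<Lambda> W u w = det_on (UNIV \<times> vertices \<Lambda>)
     (\<lambda>i j. (if i = j then 1 else 0) - op_A W i j * diag_entry u w j)"

text \<open>
  The arguments after the matrix tell which of the two incoming and which of the two outgoing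
  edges carry an arrow.
\<close>

fun vertex_weight :: "complex^2^2 \<Rightarrow> bool \<times> bool \<Rightarrow> bool \<times> bool \<Rightarrow> complex" where
  "vertex_weight A (False, False) (False, False) = 1"
| "vertex_weight A (True, False) (True, False) = A$1$1"
| "vertex_weight A (False, True) (True, False) = A$1$2"
| "vertex_weight A (True, False) (False, True) = A$2$1"
| "vertex_weight A (False, True) (False, True) = A$2$2"
| "vertex_weight A (True, True) (True, True) = A$1$2 * A$2$1 - A$1$1 * A$2$2"
| "vertex_weight A _ _ = 0"

text \<open>
  \<^const>\<open>powr\<close> takes the principal branch.  The choice does not affect \<open>S_sum\<close>, in which only
  integer powers of \<open>u\<close> and \<open>w\<close> occur.
\<close>

fun arrow_weight :: "complex \<Rightarrow> complex \<Rightarrow> edge \<Rightarrow> complex" where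
  "arrow_weight u w (Hor, _) = u powr (-1/2)"
| "arrow_weight u w (Ver, _) = w powr (-1/2)"
| "arrow_weight u w (Obl, _) = u powr (-1/2) * w powr (-1/2)"

text \<open>An arrow configuration is the set \<open>C\<close> of the edges that carry an arrow.\<close>

definition arrow_in :: "edge set \<Rightarrow> crossing \<times> vertex \<Rightarrow> line \<Rightarrow> bool" where
  "arrow_in C v l \<longleftrightarrow> (\<exists>e\<in>C. target e = v \<and> fst e = l)"

definition arrow_out :: "edge set \<Rightarrow> crossing \<times> vertex \<Rightarrow> line \<Rightarrow> bool" where
  "arrow_out C v l \<longleftrightarrow> (\<exists>e\<in>C. source e = v \<and> fst e = l)"

definition S_sum :: "(int \<times> int) set \<Rightarrow> matrix_family \<Rightarrow> complex \<Rightarrow> complex \<Rightarrow> complex" where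
  "S_sum \<Lambda> W u w = (\<Sum>C\<in>Pow (edges \<Lambda>).
     (\<Prod>(c, p)\<in>UNIV \<times> vertices \<Lambda>.
        vertex_weight (W c p)
          (map_prod (arrow_in C (c, p)) (arrow_in C (c, p)) (crossing_lines c))
          (map_prod (arrow_out C (c, p)) (arrow_out C (c, p)) (crossing_lines c))) *
     (\<Prod>e\<in>edges \<Lambda>. if e \<in> C then arrow_weight u w e else 1))"

definition cycle_monomial :: "int \<times> int \<Rightarrow> complex \<Rightarrow> complex \<Rightarrow> complex" where
  "cycle_monomial \<gamma> u w = u powi (- fst \<gamma>) * w powi (- snd \<gamma>)"

definition laurent_polynomial :: "(complex \<Rightarrow> complex \<Rightarrow> complex) \<Rightarrow> bool" where
  "laurent_polynomial g \<longleftrightarrow> (\<exists>K c. finite K \<and>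
     (\<forall>x y. x \<noteq> 0 \<longrightarrow> y \<noteq> 0 \<longrightarrow> g x y = (\<Sum>(m, n)\<in>K. c (m, n) * x powi m * y powi n)))"

text \<open>
  \<open>g(x, y)\<close> is \<open>F(u, w)\<close> regarded as a function of the monomials \<open>x\<close>, \<open>y\<close> attached to the basis
  \<open>\<alpha>\<close>, \<open>\<beta>\<close>.  For nonzero \<open>x\<close>, \<open>y\<close> this determines \<open>g\<close>, because all such pairs \<open>(x, y)\<close> arise.
\<close>

definition in_cycle_variables ::
    "int \<times> int \<Rightarrow> int \<times> int \<Rightarrow> (complex \<Rightarrow> complex \<Rightarrow> complex) \<Rightarrow>
     (complex \<Rightarrow> complex \<Rightarrow> complex) \<Rightarrow> bool" where
  "in_cycle_variables \<alpha> \<beta> F g \<longleftrightarrow> laurent_polynomial g \<and>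
     (\<forall>u w. u \<noteq> 0 \<longrightarrow> w \<noteq> 0 \<longrightarrow> F u w = g (cycle_monomial \<alpha> u w) (cycle_monomial \<beta> u w))"

end

theory Submission
  imports Defs "Jordan_Normal_Form.Determinant"
begin

text \<open>
  Both quantities are sums over the balanced arrow configurations \<open>C\<close> on the kagome lattice, those with as
  many arrows entering as leaving every vertex.  Eliminating the \<open>Inner\<close> edges from
  \<open>det (1 - T)\<close>, where \<open>T\<close> is the transfer matrix on kagome edges, leaves \<open>I(u, w)\<close>; eliminating
  the \<open>Outer\<close> edges instead leaves the determinant for the evolved matrices, so \<open>I\<close> is invariant.
  Expanding \<open>det (1 - T)\<close> into principal minors gives the terms of \<open>S(u, w)\<close>, each multiplied by
  \<open>(-1)\<close> to the number of closed paths into which \<open>C\<close> decomposes when paths turn at double vertices.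
  Such paths do not cross, hence this sign is \<open>1\<close> exactly if the homology class of \<open>C\<close> lies in
  \<open>2\<Lambda>\<close>; it is obtained by counting modulo 2 the inversions between the order of the edges by
  source and the order by target.  The formulas relating \<open>s\<close> and \<open>f\<close> follow termwise from the parity of the
  exponents of \<open>x\<close> and \<open>y\<close>, and the invariance of \<open>S\<close> follows from that of \<open>I\<close>.
\<close>

section \<open>Determinants over finite index sets\<close>

text \<open>Why the sign depends on homology only: closed paths on the torus that do not cross and
  all run right or upward are parallel, so C has the class of n copies of one primitive class, where
  n is their number, and n is even exactly if this class lies in 2 \<Lambda>. The proof never
  invokes this topology. With k and m the windings in a Hermite basis of \<Lambda>, the sign is
  computed as -1 to the power k + (k + 1) * m, an exponent that is even exactly if k and m both are.
  Counting inversions requires linear orders of the edges by source and by target for which passing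
  from an edge to its predecessor is increasing; this is why the torus is cut open into columns and
  heights. The turn at a double vertex has a second purpose: it exchanges the columns of the 2 x 2
  block, whose determinant then is b c - a d, the six-vertex weight. The two sums also distribute
  weights differently: I(u, w) puts the full weight on one half of the edges, S(u, w) a square root
  on every edge. Over a balanced configuration both products agree.\<close>

lemma det_on_cong:
  assumes "\<And>i j. i \<in> J \<Longrightarrow> j \<in> J \<Longrightarrow> A i j = B i j"
  shows "det_on J A = det_on J B"
  unfolding det_on_def
proof (intro sum.cong refl arg_cong2[where f="(*)"] prod.cong)
  fix \<sigma> i assume "\<sigma> \<in> {\<sigma>. \<sigma> permutes J}" "i \<in> J"
  then show "A i (\<sigma> i) = B i (\<sigma> i)"
    using assms permutes_in_image[of \<sigma> J i] by simp
qed

lemma det_on_empty [simp]: "det_on {} A = 1"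
  by (simp add: det_on_def)

lemma det_on_reindex:
  assumes "finite I" "bij_betw f I J"
  shows "det_on J A = det_on I (\<lambda>i j. A (f i) (f j))"
proof -
  have inj: "inj_on f I" and J: "J = f ` I" using assms(2) by (auto simp: bij_betw_def)
  have bij: "bij_betw (map_permutation I f) {\<pi>. \<pi> permutes I} {\<pi>. \<pi> permutes J}"
    using bij_betw_permutations[OF assms(2)] unfolding map_permutation_def
    by (rule bij_betw_cong[THEN iffD1, rotated]) 
      (auto simp: restrict_id_def fun_eq_iff J inj inv_into_into)
  show ?thesis
    unfolding det_on_def
  proof (subst sum.reindex_bij_betw[OF bij, symmetric], intro sum.cong refl)
    fix \<sigma> assume "\<sigma> \<in> {\<sigma>. \<sigma> permutes I}"
    then have \<sigma>: "\<sigma> permutes I" by simp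
    have "(\<Prod>i\<in>J. A i (map_permutation I f \<sigma> i)) = (\<Prod>i\<in>I. A (f i) (f (\<sigma> i)))"
      unfolding J
      by (subst prod.reindex[OF inj], intro prod.cong refl)
        (simp add: map_permutation_apply inj)
    then show "of_int (sign (map_permutation I f \<sigma>)) * (\<Prod>i\<in>J. A i (map_permutation I f \<sigma> i)) =
        of_int (sign \<sigma>) * (\<Prod>i\<in>I. A (f i) (f (\<sigma> i)))"
      by (simp add: sign_map_permutation[OF inj \<sigma> assms(1)])
  qed
qed

text \<open>Bridge to matrices with index set \<open>{0..<n}\<close>, from which multiplicativity
  and the block formula are imported.\<close>

lemma det_on_eq_det:
  assumes "bij_betw f {0..<n} J"
  shows "det_on J A = det (mat n n (\<lambda>(i, j). A (f i) (f j)))"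
proof -
  have "det (mat n n (\<lambda>(i, j). A (f i) (f j))) = det_on {0..<n} (\<lambda>i j. A (f i) (f j))"
    unfolding det_on_def
    by (subst det_def'[of _ n], simp, intro sum.cong refl arg_cong2[where f="(*)"] prod.cong)
      (auto simp: sign_def dest: permutes_in_image)
  then show ?thesis
    using det_on_reindex[OF _ assms, of A] by simp
qed

lemma det_on_mult:
  assumes "finite J"
  shows "det_on J (\<lambda>i k. \<Sum>j\<in>J. A i j * B j k) = det_on J A * det_on J B"
proof -
  obtain f where f: "bij_betw f {0..<card J} J"
    using ex_bij_betw_nat_finite[OF assms] by auto
  let ?n = "card J"
  let ?m = "\<lambda>A. mat ?n ?n (\<lambda>(i, j). A (f i) (f j)) :: complex mat"
  have "?m (\<lambda>i k. \<Sum>j\<in>J. A i j * B j k) = ?m A * ?m B"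
    by (rule eq_matI)
      (simp_all add: scalar_prod_def sum.reindex_bij_betw[OF f, symmetric])
  then show ?thesis
    by (simp add: det_on_eq_det[OF f] det_mult[of _ ?n])
qed

lemma det_on_block:
  assumes fin: "finite P" "finite Q" and disj: "P \<inter> Q = {}"
    and zero: "\<And>i j. i \<in> P \<Longrightarrow> j \<in> Q \<Longrightarrow> K i j = 0"
  shows "det_on (P \<union> Q) K = det_on P K * det_on Q K"
proof -
  let ?n = "card P" and ?m = "card Q"
  obtain f g where f: "bij_betw f {0..<?n} P" and g: "bij_betw g {0..<?m} Q"
    using ex_bij_betw_nat_finite[OF fin(1)] ex_bij_betw_nat_finite[OF fin(2)] by auto
  \<comment> \<open>\<open>P\<close> is listed before \<open>Q\<close>, so that the vanishing
    entries form the upper right block.\<close>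
  define h where "h i = (if i < ?n then f i else g (i - ?n))" for i
  have "bij_betw h {0..<?n} P"
    using f by (rule bij_betw_cong[THEN iffD1, rotated]) (simp add: h_def)
  moreover have "bij_betw h {?n..<?n + ?m} Q"
  proof -
    have "bij_betw (\<lambda>i. i - ?n) {?n..<?n + ?m} {0..<?m}"
      by (rule bij_betwI[where g="\<lambda>i. i + ?n"]) auto
    from bij_betw_trans[OF this g] show ?thesis
      by (rule bij_betw_cong[THEN iffD1, rotated]) (simp add: h_def)
  qed
  ultimately have "bij_betw h ({0..<?n} \<union> {?n..<?n + ?m}) (P \<union> Q)"
    by (rule bij_betw_combine) (rule disj)
  also have "{0..<?n} \<union> {?n..<?n + ?m} = {0..<?n + ?m}" by auto
  finally have h: "bij_betw h {0..<?n + ?m} (P \<union> Q)" .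
  have fP: "f i \<in> P" if "i < ?n" for i using f that by (auto simp: bij_betw_def)
  have gQ: "g i \<in> Q" if "i < ?m" for i using g that by (auto simp: bij_betw_def)
  have "mat (?n + ?m) (?n + ?m) (\<lambda>(i, j). K (h i) (h j)) =
      four_block_mat (mat ?n ?n (\<lambda>(i, j). K (f i) (f j))) (0\<^sub>m ?n ?m)
        (mat ?m ?n (\<lambda>(i, j). K (g i) (f j))) (mat ?m ?m (\<lambda>(i, j). K (g i) (g j)))"
    by (rule eq_matI) (auto simp: h_def fP gQ zero)
  then show ?thesis
    by (simp add: det_on_eq_det[OF h] det_on_eq_det[OF f] det_on_eq_det[OF g]
        det_four_block_mat_upper_right_zero[of _ ?n _ ?m])
qed

lemma det_on_Union:
  assumes "finite V" "\<And>v. v \<in> V \<Longrightarrow> finite (B v)"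
    and "\<And>v w. v \<in> V \<Longrightarrow> w \<in> V \<Longrightarrow> v \<noteq> w \<Longrightarrow> B v \<inter> B w = {}"
    and "\<And>v w i j. v \<in> V \<Longrightarrow> w \<in> V \<Longrightarrow> v \<noteq> w \<Longrightarrow> i \<in> B v \<Longrightarrow> j \<in> B w \<Longrightarrow> K i j = 0"
  shows "det_on (\<Union>v\<in>V. B v) K = (\<Prod>v\<in>V. det_on (B v) K)"
  using assms
proof (induction V)
  case (insert v V)
  have "det_on (B v \<union> (\<Union>v\<in>V. B v)) K = det_on (B v) K * det_on (\<Union>v\<in>V. B v) K"
  proof (rule det_on_block)
    show "B v \<inter> (\<Union>v\<in>V. B v) = {}"
      using insert.hyps insert.prems(2) by blast
    show "K i j = 0" if "i \<in> B v" "j \<in> (\<Union>v\<in>V. B v)" for i j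
      using that insert.hyps insert.prems(3) by blast
  qed (use insert in auto)
  moreover have "det_on (\<Union>v\<in>V. B v) K = (\<Prod>v\<in>V. det_on (B v) K)"
    by (rule insert.IH) (use insert.prems in \<open>simp_all, blast?\<close>)
  ultimately show ?case using insert.hyps by simp
qed simp

lemma det_on_permute_cols:
  assumes "finite J" "\<tau> permutes J"
  shows "det_on J A = of_int (sign \<tau>) * det_on J (\<lambda>i j. A i (\<tau> j))"
proof -
  have "det_on J A = (\<Sum>\<sigma> | \<sigma> permutes J. of_int (sign (\<tau> \<circ> \<sigma>)) * (\<Prod>i\<in>J. A i ((\<tau> \<circ> \<sigma>) i)))"
    unfolding det_on_def by (rule setum_permutations_compose_left) fact
  also have "\<dots> = (\<Sum>\<sigma> | \<sigma> permutes J. of_int (sign \<tau>) * (of_int (sign \<sigma>) * (\<Prod>i\<in>J. A i (\<tau> (\<sigma> i)))))"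
    using assms
    by (intro sum.cong refl)
      (auto simp: sign_compose permutes_imp_permutation)
  finally show ?thesis
    by (simp add: det_on_def sum_distrib_left)
qed

text \<open>Multiply out the Leibniz product: \<open>C\<close> collects the rows in which
  \<open>- M\<close> is chosen, and the Kronecker deltas of the other rows kill every permutation
  that moves a point outside \<open>C\<close>.\<close>

lemma det_on_id_minus:
  assumes "finite J"
  shows "det_on J (\<lambda>i j. (if i = j then 1 else 0) - M i j) =
    (\<Sum>C\<in>Pow J. (-1) ^ card C * det_on C M)"
proof -
  have "det_on J (\<lambda>i j. (if i = j then 1 else 0) - M i j) =
      (\<Sum>\<sigma> | \<sigma> permutes J. \<Sum>C\<in>Pow J. of_int (sign \<sigma>) *
        ((\<Prod>i\<in>C. - M i (\<sigma> i)) * (\<Prod>i\<in>J - C. if i = \<sigma> i then 1 else 0)))"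
    unfolding det_on_def sum_distrib_left[symmetric] prod_add[OF assms, symmetric]
    by (simp add: add.commute)
  also have "\<dots> = (\<Sum>C\<in>Pow J. \<Sum>\<sigma> | \<sigma> permutes J. of_int (sign \<sigma>) *
        ((\<Prod>i\<in>C. - M i (\<sigma> i)) * (\<Prod>i\<in>J - C. if i = \<sigma> i then 1 else 0)))"
    by (rule sum.swap)
  also have "\<dots> = (\<Sum>C\<in>Pow J. (-1) ^ card C * det_on C M)"
  proof (intro sum.cong refl)
    fix C assume "C \<in> Pow J"
    then have C: "C \<subseteq> J" by simp
    have fin: "finite (J - C)" using assms by simp
    have "(\<Sum>\<sigma> | \<sigma> permutes J. of_int (sign \<sigma>) *
        ((\<Prod>i\<in>C. - M i (\<sigma> i)) * (\<Prod>i\<in>J - C. if i = \<sigma> i then 1 else 0))) =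
        (\<Sum>\<sigma> | \<sigma> permutes C. of_int (sign \<sigma>) *
        ((\<Prod>i\<in>C. - M i (\<sigma> i)) * (\<Prod>i\<in>J - C. if i = \<sigma> i then 1 else 0)))"
    proof (intro sum.mono_neutral_right ballI)
      show "finite {\<sigma>. \<sigma> permutes J}" by (rule finite_permutations) fact
      show "{\<sigma>. \<sigma> permutes C} \<subseteq> {\<sigma>. \<sigma> permutes J}"
        using permutes_subset[OF _ C] by auto
      fix \<sigma> assume "\<sigma> \<in> {\<sigma>. \<sigma> permutes J} - {\<sigma>. \<sigma> permutes C}"
      then have "\<sigma> permutes J" "\<not> \<sigma> permutes C" by auto
      then have "\<exists>i\<in>J - C. \<sigma> i \<noteq> i"
        using permutes_superset[of \<sigma> J C] by blast
      then have "(\<Prod>i\<in>J - C. if i = \<sigma> i then 1 else 0 :: complex) = 0"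
        using fin by (intro prod_zero) (auto, metis DiffI)
      then show "of_int (sign \<sigma>) *
        ((\<Prod>i\<in>C. - M i (\<sigma> i)) * (\<Prod>i\<in>J - C. if i = \<sigma> i then 1 else 0)) = 0" by simp
    qed
    also have "\<dots> = (\<Sum>\<sigma> | \<sigma> permutes C. (-1) ^ card C * (of_int (sign \<sigma>) * (\<Prod>i\<in>C. M i (\<sigma> i))))"
    proof (intro sum.cong refl)
      fix \<sigma> assume "\<sigma> \<in> {\<sigma>. \<sigma> permutes C}"
      then have "(\<Prod>i\<in>J - C. if i = \<sigma> i then 1 else 0 :: complex) = 1"
        by (intro prod.neutral) (auto simp: permutes_not_in)
      then show "of_int (sign \<sigma>) *
        ((\<Prod>i\<in>C. - M i (\<sigma> i)) * (\<Prod>i\<in>J - C. if i = \<sigma> i then 1 else 0)) =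
        (-1) ^ card C * (of_int (sign \<sigma>) * (\<Prod>i\<in>C. M i (\<sigma> i)))"
        using prod.distrib[of "\<lambda>_. -1" "\<lambda>i. M i (\<sigma> i)" C] by simp
    qed
    finally show "(\<Sum>\<sigma> | \<sigma> permutes J. of_int (sign \<sigma>) *
        ((\<Prod>i\<in>C. - M i (\<sigma> i)) * (\<Prod>i\<in>J - C. if i = \<sigma> i then 1 else 0))) =
        (-1) ^ card C * det_on C M"
      by (simp add: det_on_def sum_distrib_left)
  qed
  finally show ?thesis .
qed

text \<open>A nonzero term of a minor needs nonzero entries along the cycles of a permutation, but
  two consecutive entries are never both nonzero, even at a fixed point. Only the empty minor
  survives.\<close>

lemma det_on_id_minus_nilpotent:
  assumes "finite J"
    and nil: "\<And>i j k. i \<in> J \<Longrightarrow> j \<in> J \<Longrightarrow> k \<in> J \<Longrightarrow> M i j * M j k = 0"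
  shows "det_on J (\<lambda>i j. (if i = j then 1 else 0) - M i j) = 1"
proof -
  have "det_on C M = 0" if C: "C \<subseteq> J" "C \<noteq> {}" for C
    unfolding det_on_def
  proof (intro sum.neutral ballI)
    fix \<sigma> assume "\<sigma> \<in> {\<sigma>. \<sigma> permutes C}"
    then have \<sigma>: "\<sigma> permutes C" by simp
    obtain i where i: "i \<in> C" using C by auto
    have *: "\<sigma> i \<in> C" "\<sigma> (\<sigma> i) \<in> C" using \<sigma> i by (auto simp: permutes_in_image)
    then have "M i (\<sigma> i) * M (\<sigma> i) (\<sigma> (\<sigma> i)) = 0" using i C by (intro nil) auto
    then have "\<exists>i\<in>C. M i (\<sigma> i) = 0" using i * by auto
    then have "(\<Prod>i\<in>C. M i (\<sigma> i)) = 0"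
      using C finite_subset[OF _ assms(1)] by (intro prod_zero) auto
    then show "of_int (sign \<sigma>) * (\<Prod>i\<in>C. M i (\<sigma> i)) = 0" by simp
  qed
  then have "(\<Sum>C\<in>Pow J. (-1) ^ card C * det_on C M) = (\<Sum>C\<in>{{}}. (-1) ^ card C * det_on C M)"
    using assms(1) by (intro sum.mono_neutral_right) auto
  then show ?thesis by (simp add: det_on_id_minus[OF assms(1)])
qed

text \<open>Schur complement. By \<open>nil\<close> the block of \<open>M\<close> on
  \<open>U\<close> has square zero, so 1 minus this block has the inverse 1 plus this block; the
  nested sum is the weight of all passages through \<open>U\<close> with one or two stops
  there.\<close>

lemma det_on_eliminate:
  assumes fin: "finite U" "finite P" and disj: "U \<inter> P = {}"
    and nil: "\<And>i j k. i \<in> U \<Longrightarrow> j \<in> U \<Longrightarrow> k \<in> U \<Longrightarrow> M i j * M j k = 0"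
  shows "det_on (U \<union> P) (\<lambda>i j. (if i = j then 1 else 0) - M i j) =
    det_on P (\<lambda>i j. (if i = j then 1 else 0) -
      (M i j + (\<Sum>a\<in>U. M i a * (M a j + (\<Sum>b\<in>U. M a b * M b j)))))"
    (is "det_on _ ?K = det_on P ?R")
proof -
  \<comment> \<open>Multiplication by the unitriangular \<open>L\<close> adds columns of
    \<open>U\<close> with coefficients \<open>N\<close> to those of \<open>P\<close>; as
    \<open>N\<close> is (1 + M) M on the rows in \<open>U\<close>, this clears the block
    \<open>U\<close> x \<open>P\<close>.\<close>
  define N where "N i j = M i j + (\<Sum>b\<in>U. M i b * M b j)" for i j
  define L :: "'a \<Rightarrow> 'a \<Rightarrow> complex"
    where "L i j = (if i = j then 1 else 0) + (if i \<in> U \<and> j \<in> P then N i j else 0)" for i j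
  define Q where "Q i k = (\<Sum>j\<in>U \<union> P. ?K i j * L j k)" for i k
  have id: "det_on J (\<lambda>i j. if i = j then 1 else 0) = 1" if "finite J" for J :: "'a set"
    using det_on_id_minus_nilpotent[OF that, of "\<lambda>_ _. 0"] by simp
  have "det_on (U \<union> P) L = det_on (P \<union> U) L" by (simp add: Un_commute)
  also have "\<dots> = det_on P L * det_on U L"
    using fin disj by (intro det_on_block) (auto simp: L_def)
  also have "det_on P L = det_on P (\<lambda>i j. if i = j then 1 else 0)"
    using disj by (intro det_on_cong) (auto simp: L_def)
  also have "det_on U L = det_on U (\<lambda>i j. if i = j then 1 else 0)"
    using disj by (intro det_on_cong) (auto simp: L_def)
  finally have "det_on (U \<union> P) L = 1" by (simp add: id fin)
  then have KQ: "det_on (U \<union> P) ?K = det_on (U \<union> P) Q"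
    unfolding Q_def using fin by (subst det_on_mult) auto
  have QU: "Q i k = ?K i k" if "i \<in> U \<union> P" "k \<in> U" for i k
  proof -
    have "Q i k = (\<Sum>j\<in>U \<union> P. if j = k then ?K i j else 0)"
      unfolding Q_def using that disj by (intro sum.cong) (auto simp: L_def)
    then show ?thesis using that fin by simp
  qed
  have QP: "Q i k = ?K i k + (\<Sum>j\<in>U. ?K i j * N j k)" if "i \<in> U \<union> P" "k \<in> P" for i k
  proof -
    have "Q i k = (\<Sum>j\<in>U \<union> P. (if j = k then ?K i j else 0) + (if j \<in> U then ?K i j * N j k else 0))"
      unfolding Q_def using that disj by (intro sum.cong) (auto simp: L_def algebra_simps)
    also have "\<dots> = ?K i k + (\<Sum>j\<in>U \<union> P. if j \<in> U then ?K i j * N j k else 0)"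
      using that fin by (simp add: sum.distrib)
    also have "(\<Sum>j\<in>U \<union> P. if j \<in> U then ?K i j * N j k else 0) = (\<Sum>j\<in>U. ?K i j * N j k)"
      using fin by (intro sum.mono_neutral_cong_right) auto
    finally show ?thesis .
  qed
  have zero: "Q i k = 0" if "i \<in> U" "k \<in> P" for i k
  proof -
    have "(\<Sum>j\<in>U. ?K i j * N j k) = (\<Sum>j\<in>U. (if j = i then N j k else 0) - M i j * N j k)"
      by (intro sum.cong) (auto simp: algebra_simps)
    also have "\<dots> = N i k - (\<Sum>j\<in>U. M i j * N j k)"
      using that fin by (simp add: sum_subtractf)
    also have "(\<Sum>j\<in>U. M i j * N j k) = (\<Sum>j\<in>U. M i j * M j k)"
    proof (intro sum.cong refl)
      fix j assume j: "j \<in> U"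
      have "M i j * (\<Sum>b\<in>U. M j b * M b k) = (\<Sum>b\<in>U. (M i j * M j b) * M b k)"
        by (simp add: sum_distrib_left mult.assoc)
      also have "\<dots> = 0" using nil that j by (intro sum.neutral) auto
      finally show "M i j * N j k = M i j * M j k" by (simp add: N_def algebra_simps)
    qed
    finally show ?thesis
      using that disj QP[of i k] by (auto simp: N_def)
  qed
  note KQ
  also have "det_on (U \<union> P) Q = det_on U Q * det_on P Q"
    using fin disj zero by (intro det_on_block) auto
  also have "det_on U Q = det_on U ?K"
    using QU by (intro det_on_cong) auto
  also have "\<dots> = 1" using fin nil by (intro det_on_id_minus_nilpotent) auto
  also have "det_on P Q = det_on P ?R"
  proof (intro det_on_cong)
    fix i j assume "i \<in> P" "j \<in> P"
    moreover have "(\<Sum>a\<in>U. ?K i a * N a j) = - (\<Sum>a\<in>U. M i a * N a j)"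
      using disj \<open>i \<in> P\<close> unfolding sum_negf[symmetric] by (intro sum.cong) auto
    ultimately show "Q i j = ?R i j" by (simp add: QP N_def)
  qed
  finally show ?thesis by simp
qed

section \<open>Signs of permutations\<close>

text \<open>For tournaments \<open>a\<close> and \<open>b\<close>, each unordered pair on which they
  disagree is listed once, oriented by \<open>a\<close>.\<close>

definition discordant :: "('a \<Rightarrow> 'a \<Rightarrow> bool) \<Rightarrow> ('a \<Rightarrow> 'a \<Rightarrow> bool) \<Rightarrow> 'a set \<Rightarrow> ('a \<times> 'a) set" where
  "discordant a b C = {(e, e') \<in> C \<times> C. a e e' \<and> b e' e}"

text \<open>Parity counts look at single pairs only, so an order is encoded as an orientation of
  every pair; such orientations can be pulled back along permutations.\<close>

definition tournament :: "'a set \<Rightarrow> ('a \<Rightarrow> 'a \<Rightarrow> bool) \<Rightarrow> bool" where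
  "tournament C a \<longleftrightarrow> (\<forall>e\<in>C. \<forall>e'\<in>C. (e \<noteq> e' \<longrightarrow> (a e e' \<longleftrightarrow> \<not> a e' e)) \<and> \<not> a e e)"

lemma tournamentD:
  assumes "tournament C a" "x \<in> C" "y \<in> C" "x \<noteq> y"
  shows "a x y \<longleftrightarrow> \<not> a y x"
  using assms unfolding tournament_def by blast

lemma tournament_irrefl: "tournament C a \<Longrightarrow> x \<in> C \<Longrightarrow> \<not> a x x"
  unfolding tournament_def by blast

lemma tournamentI:
  assumes "\<And>x y. x \<in> C \<Longrightarrow> y \<in> C \<Longrightarrow> x \<noteq> y \<Longrightarrow> a x y \<longleftrightarrow> \<not> a y x"
    and "\<And>x. x \<in> C \<Longrightarrow> \<not> a x x"
  shows "tournament C a"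
  using assms unfolding tournament_def by blast

lemma discordant_subset: "discordant a b C \<subseteq> C \<times> C"
  by (auto simp: discordant_def)

lemma card_discordant_swap: "card (discordant a b C) = card (discordant b a C)"
proof -
  have "discordant b a C = prod.swap ` discordant a b C"
    by (auto simp: discordant_def image_iff)
  then show ?thesis by (simp add: card_image)
qed

lemma card_discordant_reindex:
  assumes "bij_betw f A B"
  shows "card (discordant (\<lambda>x y. a (f x) (f y)) (\<lambda>x y. b (f x) (f y)) A) = card (discordant a b B)"
proof -
  have "B = f ` A" using assms by (simp add: bij_betw_def)
  then have "discordant a b B = map_prod f f ` discordant (\<lambda>x y. a (f x) (f y)) (\<lambda>x y. b (f x) (f y)) A"
    by (fastforce simp: discordant_def)
  moreover have "inj_on (map_prod f f) (A \<times> A)"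
    using assms by (simp add: bij_betw_def map_prod_inj_on)
  ultimately show ?thesis
    by (simp add: card_image inj_on_subset[OF _ discordant_subset])
qed

text \<open>Of three orientations of one pair, either none or two of the three pairs of orientations differ.\<close>

lemma even_discordant_cocycle:
  assumes "finite C" "tournament C a" "tournament C b" "tournament C c"
  shows "even (card (discordant a b C) + card (discordant b c C) + card (discordant a c C))"
proof -
  let ?ab = "discordant a b C" and ?bc = "discordant b c C" and ?ac = "discordant a c C"
  let ?P = "{(e, e') \<in> C \<times> C. a e e' \<and> b e' e \<and> c e' e}"
  let ?Q = "{(e, e') \<in> C \<times> C. a e e' \<and> b e' e \<and> c e e'}"
  let ?R = "{(e, e') \<in> C \<times> C. a e e' \<and> b e e' \<and> c e' e}"
  have fin: "finite ?P" "finite ?Q" "finite ?R"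
    by (rule finite_subset[of _ "C \<times> C"]; use assms(1) in auto)+
  have asym: "s e e' \<Longrightarrow> s e' e \<Longrightarrow> False"
    and total: "e \<noteq> e' \<Longrightarrow> \<not> s e e' \<Longrightarrow> s e' e"
    and irrefl: "\<not> s e e"
    if "tournament C s" "e \<in> C" "e' \<in> C" for s e e'
    using that unfolding tournament_def by metis+
  have tot: "a e e' \<Longrightarrow> c e e' \<or> c e' e" "a e e' \<Longrightarrow> b e e' \<or> b e' e" "b e e' \<Longrightarrow> a e e' \<or> a e' e"
    if "e \<in> C" "e' \<in> C" for e e'
    using that assms(2-4) irrefl total by metis+
  have "?ab = ?P \<union> ?Q"
    by (auto simp: discordant_def dest: tot(1))
  moreover have "?P \<inter> ?Q = {}"
    by (auto dest: asym[OF assms(4)])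
  ultimately have "card ?ab = card ?P + card ?Q"
    using fin by (simp only: card_Un_disjoint)
  moreover have "?ac = ?P \<union> ?R"
    by (auto simp: discordant_def dest: tot(2))
  moreover have "?P \<inter> ?R = {}"
    by (auto dest: asym[OF assms(3)])
  ultimately have "card ?ac = card ?P + card ?R"
    using fin by (simp only: card_Un_disjoint)
  moreover have "?bc = prod.swap ` ?Q \<union> ?R"
    by (auto simp: discordant_def image_iff dest: tot(3))
  moreover have "prod.swap ` ?Q \<inter> ?R = {}"
    by (auto dest: asym[OF assms(2)])
  ultimately have "card ?bc = card ?Q + card ?R"
    using fin by (simp add: card_Un_disjoint card_image)
  with \<open>card ?ab = _\<close> \<open>card ?ac = _\<close> show ?thesis by (auto simp only: even_add)
qed

text \<open>By the cocycle property, the parity of the number of reversed pairs is a homomorphism on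
  permutations and independent of \<open>r\<close>. It remains to see that it is odd for
  transpositions, where \<open>r\<close> can be exchanged for a convenient order.\<close>

lemma sign_eq_discordant_tournament:
  assumes fin: "finite C" and p: "p permutes C" and r: "tournament C r"
  shows "sign p = (-1) ^ card (discordant r (\<lambda>x y. r (p x) (p y)) C)"
  using p fin
proof (induction rule: permutes_induct)
  case id
  have "discordant r (\<lambda>x y. r (id x) (id y)) C = {}"
    using r by (auto simp: discordant_def tournament_def)
  then show ?case by simp
next
  case (swap a b p)
  let ?t = "Transposition.transpose a b"
  define d where "d s q = card (discordant s (\<lambda>x y. s (q x) (q y)) C)" for s and q :: "'a \<Rightarrow> 'a"
  have t: "?t permutes C" using swap by (simp add: permutes_swap_id)
  have tour: "tournament C (\<lambda>x y. s (q x) (q y))" if "tournament C s" "q permutes C" for s q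
  proof (rule tournamentI)
    fix x y assume "x \<in> C" "y \<in> C" "x \<noteq> y"
    then show "s (q x) (q y) \<longleftrightarrow> \<not> s (q y) (q x)"
      using that permutes_in_image[OF that(2)] inj_eq[OF permutes_inj[OF that(2)]]
      by (intro tournamentD[where a=s and C=C]) simp_all
  qed (use that permutes_in_image[OF that(2)] in \<open>simp add: tournament_irrefl\<close>)
  have reindex: "card (discordant (\<lambda>x y. s (q x) (q y)) (\<lambda>x y. s' (q x) (q y)) C) = card (discordant s s' C)"
    if "q permutes C" for s s' q
    by (rule card_discordant_reindex[OF permutes_imp_bij[OF that]])
  \<comment> \<open>In the order by \<open>g\<close> the elements \<open>a\<close> and
    \<open>b\<close> come first and are adjacent, so their transposition reverses this pair
    only.\<close>
  obtain g :: "'a \<Rightarrow> nat" where g: "inj_on g C" "g a = 0" "g b = 1"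
  proof -
    from finite_imp_inj_to_nat_seg[OF fin] obtain f :: "'a \<Rightarrow> nat" where f: "inj_on f C" by auto
    let ?g = "\<lambda>x. if x = a then 0 else if x = b then 1 else f x + 2"
    have "inj_on ?g C" using f by (auto simp: inj_on_def)
    then show thesis using that[of ?g] swap by auto
  qed
  let ?s = "\<lambda>x y. g x < g y"
  have s: "tournament C ?s" using g(1) by (auto simp: tournament_def inj_on_def not_less dest: le_neq_implies_less)
  have ab: "x = a \<and> y = b" if "(x, y) \<in> discordant ?s (\<lambda>x y. ?s (?t x) (?t y)) C" for x y
  proof -
    from that have xy: "x \<in> C" "y \<in> C" "g x < g y" "g (?t y) < g (?t x)" by (auto simp: discordant_def)
    have g2: "g z \<ge> 2" if "z \<in> C" "z \<noteq> a" "z \<noteq> b" for z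
    proof -
      have "g z \<noteq> g a" "g z \<noteq> g b" using inj_on_eq_iff[OF g(1)] that swap by simp_all
      then show ?thesis using g by simp
    qed
    show ?thesis
      using xy g(2,3) g2[of x] g2[of y]
      by (cases "x = a"; cases "x = b"; cases "y = a"; cases "y = b") (auto simp: transpose_def)
  qed
  have "(a, b) \<in> discordant ?s (\<lambda>x y. ?s (?t x) (?t y)) C"
    using swap g by (auto simp: discordant_def)
  then have "discordant ?s (\<lambda>x y. ?s (?t x) (?t y)) C = {(a, b)}"
    by (intro equalityI subrelI) (drule ab, simp, blast)
  then have d1: "d ?s ?t = 1" by (simp add: d_def)
  \<comment> \<open>Apply the cocycle property to \<open>r\<close>, \<open>?s\<close> and their
    pullbacks along \<open>?t\<close>: the discordance of \<open>r\<close> and \<open>?s\<close>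
    equals that of the two pullbacks and drops out.\<close>
  have "even (d r ?t + d ?s ?t)"
  proof -
    note e1 = even_discordant_cocycle[OF fin r s tour[OF s t]]
    note e2 = even_discordant_cocycle[OF fin r tour[OF r t] tour[OF s t]]
    from e1 e2 show ?thesis
      unfolding d_def reindex[OF t, of r ?s] even_add by blast
  qed
  then have odd: "odd (d r ?t)" using d1 by simp
  \<comment> \<open>Reindexing by \<open>p\<close> identifies the discordance of \<open>r\<close>
    with its pullback along \<open>?t\<close> with that between the pullbacks along \<open>p\<close>
    and \<open>?t \<circ> p\<close>.\<close>
  have "even (d r p + d r ?t + d r (?t \<circ> p))"
  proof -
    have "tournament C (\<lambda>x y. r ((?t \<circ> p) x) ((?t \<circ> p) y))"
      using tour[OF tour[OF r t] \<open>p permutes C\<close>] by simp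
    from even_discordant_cocycle[OF fin r tour[OF r \<open>p permutes C\<close>] this]
      reindex[OF \<open>p permutes C\<close>, of r "\<lambda>x y. r (?t x) (?t y)"]
    show ?thesis by (simp only: d_def o_apply)
  qed
  with odd have "even (d r (?t \<circ> p)) \<longleftrightarrow> odd (d r p)" by (auto simp only: even_add)
  moreover have "sign (?t \<circ> p) = - sign p"
    using swap fin by (subst sign_compose) (auto simp: sign_swap_id permutation_swap_id permutes_imp_permutation)
  moreover have "sign p = (-1) ^ d r p" using swap.IH by (simp add: d_def)
  ultimately have "sign (?t \<circ> p) = (-1) ^ d r (?t \<circ> p)"
    by (auto simp: uminus_power_if)
  then show ?case by (simp only: d_def)
qed

text \<open>Since \<open>p\<close> carries \<open>a\<close> to \<open>b\<close>, the pairs that it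
  reverses with respect to \<open>b\<close> are those on which \<open>a\<close> and \<open>b\<close>
  disagree. The sign can thus be read off from two orders without following the cycles of
  \<open>p\<close>.\<close>

lemma sign_eq_discordant:
  assumes fin: "finite C" and p: "p permutes C" and b: "tournament C b"
    and mono: "\<And>x y. x \<in> C \<Longrightarrow> y \<in> C \<Longrightarrow> a x y \<Longrightarrow> b (p x) (p y)"
    and a: "tournament C a"
  shows "sign p = (-1) ^ card (discordant a b C)"
proof -
  have ab: "a x y \<longleftrightarrow> b (p x) (p y)" if "x \<in> C" "y \<in> C" for x y
  proof (cases "x = y")
    case True
    then show ?thesis using that a b permutes_in_image[OF p] by (simp add: tournament_irrefl)
  next
    case False
    then have "p x \<noteq> p y" using inj_eq[OF permutes_inj[OF p]] by simp
    then have "b (p x) (p y) \<longleftrightarrow> \<not> b (p y) (p x)" "a x y \<longleftrightarrow> \<not> a y x"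
      using False that permutes_in_image[OF p] tournamentD[OF b] tournamentD[OF a] by blast+
    then show ?thesis using mono[of x y] mono[of y x] that by auto
  qed
  have "discordant b (\<lambda>x y. b (p x) (p y)) C = discordant b a C"
    using ab by (auto simp: discordant_def)
  then show ?thesis
    using sign_eq_discordant_tournament[OF fin p b] card_discordant_swap[of a b] by simp
qed

section \<open>Strands on the torus\<close>

lemma card_eq_sum_of_bool: "finite S \<Longrightarrow> card {x \<in> S. P x} = (\<Sum>x\<in>S. of_bool (P x))"
  unfolding card_eq_sum of_bool_def by (rule sum.inter_filter)

lemma card_prefix_Suc:
  assumes "finite (S :: nat set)"
  shows "card {x \<in> S. x \<le> Suc y} = card {x \<in> S. x \<le> y} + of_bool (Suc y \<in> S)"
proof (cases "Suc y \<in> S")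
  case True
  then have "{x \<in> S. x \<le> Suc y} = insert (Suc y) {x \<in> S. x \<le> y}" by auto
  then show ?thesis using assms True by simp
next
  case False
  then have "{x \<in> S. x \<le> Suc y} = {x \<in> S. x \<le> y}" by (auto simp: le_Suc_eq)
  then show ?thesis using False by simp
qed

text \<open>A shift modulo \<open>L\<close> reverses a pair exactly if its upper element wraps
  around and its lower one does not. With \<open>w\<close> wrapping elements these are w (card S -
  w) pairs, congruent to (card S + 1) w modulo 2 because w and its square have the same
  parity.\<close>

lemma layer_discordant_even:
  fixes L c :: nat
  assumes S: "S \<subseteq> {..<L}" and c: "c < L"
  shows "even ((\<Sum>x\<in>S. \<Sum>y\<in>S. of_bool (y < x \<and> (x + c) mod L < (y + c) mod L)) +
    (card S + 1) * (\<Sum>x\<in>S. (x + c) div L) :: nat)"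
proof -
  have fin: "finite S" using S finite_subset by blast
  define w where "w = card {x \<in> S. L \<le> x + c}"
  have dv: "(x + c) div L = of_bool (L \<le> x + c)" if "x \<in> S" for x
  proof (cases "L \<le> x + c")
    case True
    moreover have "x + c < 2 * L" using that S c by auto
    ultimately show ?thesis by (simp add: div_nat_eqI)
  qed simp
  have md: "(x + c) mod L = (if L \<le> x + c then x + c - L else x + c)" if "x \<in> S" for x
  proof -
    have "x + c < 2 * L" using that S c by auto
    then show ?thesis by (simp add: mod_if)
  qed
  have div_sum: "(\<Sum>x\<in>S. (x + c) div L) = w"
    unfolding w_def using fin by (simp add: dv card_eq_sum_of_bool)
  have split: "card {y \<in> S. \<not> L \<le> y + c} = card S - w"
  proof -
    have "{y \<in> S. \<not> L \<le> y + c} = S - {y \<in> S. L \<le> y + c}" by auto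
    then show ?thesis unfolding w_def using fin by (simp add: card_Diff_subset)
  qed
  have "(\<Sum>x\<in>S. \<Sum>y\<in>S. of_bool (y < x \<and> (x + c) mod L < (y + c) mod L)) =
      (\<Sum>x\<in>S. \<Sum>y\<in>S. of_bool (L \<le> x + c) * of_bool (\<not> L \<le> y + c) :: nat)"
  proof (intro sum.cong refl)
    fix x y assume "x \<in> S" "y \<in> S"
    moreover from this have "x < L" "y < L" using S by auto
    ultimately show "of_bool (y < x \<and> (x + c) mod L < (y + c) mod L) =
        (of_bool (L \<le> x + c) * of_bool (\<not> L \<le> y + c) :: nat)"
      by (auto simp: md split: if_splits)
  qed
  also have "\<dots> = w * (card S - w)"
    unfolding sum_product[symmetric] card_eq_sum_of_bool[OF fin, symmetric]
    using split by (simp add: w_def)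
  finally have *: "(\<Sum>x\<in>S. \<Sum>y\<in>S. of_bool (y < x \<and> (x + c) mod L < (y + c) mod L)) = w * (card S - w)" .
  have "w \<le> card S" unfolding w_def using fin by (intro card_mono) auto
  then show ?thesis unfolding * div_sum by auto
qed

text \<open>\<open>V\<close>, \<open>I\<close> and \<open>P\<close> are the heights of the vertical
  edges of an even column, of the edges leaving it and of those entering it. Adding up the flow
  condition from the bottom shows that, for a vertical edge below the top one, the number of
  elements of \<open>I\<close> up to its start plus that of \<open>P\<close> from its end on is the
  same for all such edges; so the heights drop out.\<close>

lemma column_discordant_even:
  fixes L :: nat
  assumes sub: "V \<subseteq> {..<L}" "I \<subseteq> {..<L}" "P \<subseteq> {..<L}"
    and flow: "\<And>y. y < L \<Longrightarrow>
      of_bool (y \<in> I) + of_bool (y \<in> V) = (of_bool ((y + L - 1) mod L \<in> V) + of_bool (y \<in> P) :: nat)"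
    and card: "card I = card P"
  shows "even ((\<Sum>v\<in>V. \<Sum>v'\<in>V. of_bool (Suc v mod L < Suc v' mod L \<and> v' < v)) +
    (\<Sum>v\<in>V. \<Sum>q\<in>I. of_bool (q \<le> v)) + (\<Sum>v\<in>V. \<Sum>p\<in>P. of_bool (Suc v mod L \<le> p)) +
    (card P + 1) * card (V - {L - 1}) :: nat)"
proof -
  have fin: "finite V" "finite I" "finite P" using sub finite_subset by blast+
  define g :: nat where "g = of_bool (L - 1 \<in> V)"
  define k where "k = card P"
  define f :: "nat \<Rightarrow> nat" where "f v = (\<Sum>q\<in>I. of_bool (q \<le> v)) + (\<Sum>p\<in>P. of_bool (Suc v mod L \<le> p))" for v
  let ?V = "V - {L - 1}"
  \<comment> \<open>The flow condition added up over the heights from 0 to \<open>y\<close>;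
    \<open>g\<close> is what comes in through the seam between height \<open>L - 1\<close> and
    height 0.\<close>
  have prefix: "y < L \<Longrightarrow> card {q \<in> I. q \<le> y} + of_bool (y \<in> V) = g + card {p \<in> P. p \<le> y}" for y
  proof (induction y)
    case 0
    have "card {q \<in> I. q \<le> 0} = of_bool (0 \<in> I)" "card {p \<in> P. p \<le> 0} = of_bool (0 \<in> P)"
      by (auto simp: Collect_conv_if conj_commute cong: conj_cong)
    then show ?case using flow[of 0] 0 by (simp add: g_def)
  next
    case (Suc y)
    then have "(Suc y + L - 1) mod L = y" by simp
    then show ?case
      using Suc flow[of "Suc y"] fin by (simp add: card_prefix_Suc)
  qed
  have rows: "f v + 1 = k + g"
    if v: "v \<in> ?V" for v
  proof -
    have vL: "v < L" "Suc v < L" using v sub by (auto simp: subset_iff)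
    have "{p \<in> P. Suc v \<le> p} = P - {p \<in> P. p \<le> v}" by auto
    then have "card {p \<in> P. Suc v \<le> p} + card {p \<in> P. p \<le> v} = k"
      using fin card_mono[of P "{p \<in> P. p \<le> v}"] by (simp add: card_Diff_subset k_def)
    then show ?thesis
      using prefix[OF vL(1)] v vL(2) fin by (simp add: card_eq_sum_of_bool f_def)
  qed
  \<comment> \<open>The edge across the seam starts at the top and ends at height 0, so all of
    \<open>I\<close> and all of \<open>P\<close> count.\<close>
  have top: "f (L - 1) = 2 * k" if "L > 0"
  proof -
    have "(\<Sum>q\<in>I. of_bool (q \<le> L - 1)) = (\<Sum>q\<in>I. 1 :: nat)"
      using sub(2) by (intro sum.cong) (auto simp: subset_iff)
    then show ?thesis using that card by (simp add: k_def f_def)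
  qed
  \<comment> \<open>Among vertical edges only the one across the seam changes its place, from last
    by source to first by target.\<close>
  have pairs: "(\<Sum>v'\<in>V. of_bool (Suc v mod L < Suc v' mod L \<and> v' < v)) =
      (if v = L - 1 then card ?V else 0)" if v: "v \<in> V" for v
  proof -
    have *: "Suc v mod L < Suc v' mod L \<and> v' < v \<longleftrightarrow> v = L - 1 \<and> v' \<noteq> L - 1" if "v' \<in> V" for v'
    proof -
      have "v < L" "v' < L" using that v sub by auto
      then show ?thesis by (auto simp: mod_Suc)
    qed
    have "?V = {x \<in> V. x \<noteq> L - 1}" by auto
    then show ?thesis using * fin by (simp add: card_eq_sum_of_bool)
  qed
  have "(\<Sum>v\<in>V. \<Sum>v'\<in>V. of_bool (Suc v mod L < Suc v' mod L \<and> v' < v)) =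
      (\<Sum>v\<in>V. if v = L - 1 then card ?V else 0)"
    by (rule sum.cong[OF refl pairs])
  also have "\<dots> = g * card ?V"
    using fin by (simp add: g_def)
  finally have "(\<Sum>v\<in>V. \<Sum>v'\<in>V. of_bool (Suc v mod L < Suc v' mod L \<and> v' < v)) = g * card ?V" .
  moreover have "(\<Sum>v\<in>V. f v) + card ?V = card ?V * (k + g) + g * (2 * k)"
  proof -
    have "(\<Sum>v\<in>?V. f v) + card ?V = (\<Sum>v\<in>?V. f v + 1)"
      by (simp only: sum.distrib card_eq_sum)
    also have "\<dots> = (\<Sum>v\<in>?V. k + g)"
      by (rule sum.cong[OF refl rows])
    also have "\<dots> = card ?V * (k + g)" by simp
    finally have "(\<Sum>v\<in>?V. f v) + card ?V = card ?V * (k + g)" .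
    moreover have "L - 1 \<in> V \<Longrightarrow> L > 0" using sub by auto
    ultimately show ?thesis
      using top fin sum.remove[of V "L - 1" f] by (cases "L - 1 \<in> V") (simp_all add: g_def)
  qed
  ultimately have "(\<Sum>v\<in>V. \<Sum>v'\<in>V. of_bool (Suc v mod L < Suc v' mod L \<and> v' < v)) +
    ((\<Sum>v\<in>V. \<Sum>q\<in>I. of_bool (q \<le> v)) + (\<Sum>v\<in>V. \<Sum>p\<in>P. of_bool (Suc v mod L \<le> p))) +
    card ?V = g * card ?V + (card ?V * (k + g) + g * (2 * k))"
    by (simp only: sum.distrib f_def)
  then have "even ((\<Sum>v\<in>V. \<Sum>v'\<in>V. of_bool (Suc v mod L < Suc v' mod L \<and> v' < v)) +
    ((\<Sum>v\<in>V. \<Sum>q\<in>I. of_bool (q \<le> v)) + (\<Sum>v\<in>V. \<Sum>p\<in>P. of_bool (Suc v mod L \<le> p))) +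
    card ?V) \<longleftrightarrow> even (g * card ?V + (card ?V * (k + g) + g * (2 * k)))"
    by simp
  then show ?thesis
    unfolding k_def[symmetric] by (auto simp only: even_add even_mult_iff even_numeral odd_one simp_thms)
qed

text \<open>
  The kagome edges in coordinates.  Column \<open>2 * i\<close> carries the vertical line through the points
  \<open>(i, _)\<close> with the vertices \<open>OV\<close> and \<open>HV\<close> alternating, column \<open>2 * i + 1\<close> the vertices \<open>HO\<close>.
  \<open>Vert i y\<close> is the vertical edge from height \<open>y\<close> to height \<open>y + 1\<close> in column \<open>2 * i\<close>; \<open>Inn i y\<close> leads from
  height \<open>y\<close> of that column to column \<open>2 * i + 1\<close>, and \<open>Out i y\<close> from there to the next even column.
  Heights are taken modulo \<open>L\<close>; the edges leaving the last column are shifted by \<open>c\<close> instead of \<open>1\<close>.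
\<close>

datatype strand = Vert nat nat | Inn nat nat | Out nat nat

definition strands :: "nat \<Rightarrow> nat \<Rightarrow> strand set" where
  "strands X L = (\<Union>i<X. \<Union>y<L. {Vert i y, Inn i y, Out i y})"

definition out_pos :: "nat \<Rightarrow> nat \<Rightarrow> nat \<Rightarrow> nat \<Rightarrow> nat \<Rightarrow> nat" where
  "out_pos X L c i y = y + (if Suc i < X then 1 else c)"

text \<open>
  The second components refine the heights so that at every vertex the order of the outgoing
  edges corresponds to that of the incoming edges from which paths turn into them.
\<close>

fun strand_source :: "strand \<Rightarrow> nat \<times> nat" where
  "strand_source (Vert i y) = (2 * i, 2 * y + 1)"
| "strand_source (Inn i y) = (2 * i, 2 * y)"
| "strand_source (Out i y) = (2 * i + 1, y)"

fun strand_target :: "nat \<Rightarrow> nat \<Rightarrow> nat \<Rightarrow> strand \<Rightarrow> nat \<times> nat" where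
  "strand_target X L c (Vert i y) = (2 * i, 2 * (Suc y mod L))"
| "strand_target X L c (Inn i y) = (2 * i + 1, y)"
| "strand_target X L c (Out i y) = (if Suc i < X then 2 * i + 2 else 0, 2 * (out_pos X L c i y mod L) + 1)"

definition lex_less :: "nat \<times> nat \<Rightarrow> nat \<times> nat \<Rightarrow> bool" where
  "lex_less p q \<longleftrightarrow> fst p < fst q \<or> fst p = fst q \<and> snd p < snd q"

section \<open>Inversions on the whole torus\<close>

lemma sum_strands:
  fixes f :: "strand \<Rightarrow> nat"
  assumes "D \<subseteq> strands X L"
  shows "(\<Sum>e\<in>D. f e) = (\<Sum>i<X. (\<Sum>y | Vert i y \<in> D. f (Vert i y)) +
    (\<Sum>y | Inn i y \<in> D. f (Inn i y)) + (\<Sum>y | Out i y \<in> D. f (Out i y)))"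
proof -
  let ?B = "\<lambda>i. Vert i ` {y. Vert i y \<in> D} \<union> (Inn i ` {y. Inn i y \<in> D} \<union> Out i ` {y. Out i y \<in> D})"
  have mem: "Vert i y \<in> strands X L \<longleftrightarrow> i < X \<and> y < L" "Inn i y \<in> strands X L \<longleftrightarrow> i < X \<and> y < L"
    "Out i y \<in> strands X L \<longleftrightarrow> i < X \<and> y < L" for i y
    by (auto simp: strands_def)
  have sub: "{y. Vert i y \<in> D} \<subseteq> {..<L}" "{y. Inn i y \<in> D} \<subseteq> {..<L}" "{y. Out i y \<in> D} \<subseteq> {..<L}" for i
    by (auto dest!: subsetD[OF assms] simp: mem)
  have fin: "finite {y. Vert i y \<in> D}" "finite {y. Inn i y \<in> D}" "finite {y. Out i y \<in> D}" for i
    by (rule finite_subset[OF sub(1)] finite_subset[OF sub(2)] finite_subset[OF sub(3)]; simp)+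
  have "D \<subseteq> (\<Union>i<X. ?B i)"
  proof
    fix e assume "e \<in> D"
    then show "e \<in> (\<Union>i<X. ?B i)"
      using subsetD[OF assms \<open>e \<in> D\<close>] by (cases e) (auto simp: mem)
  qed
  then have "D = (\<Union>i<X. ?B i)" by auto
  then have "(\<Sum>e\<in>D. f e) = (\<Sum>e\<in>(\<Union>i<X. ?B i). f e)" by simp
  also have "\<dots> = (\<Sum>i<X. \<Sum>e\<in>?B i. f e)"
    using fin by (intro sum.UNION_disjoint) auto
  also have "\<dots> = (\<Sum>i<X. (\<Sum>y | Vert i y \<in> D. f (Vert i y)) +
    (\<Sum>y | Inn i y \<in> D. f (Inn i y)) + (\<Sum>y | Out i y \<in> D. f (Out i y)))"
    using fin
    by (intro sum.cong refl) (subst sum.union_disjoint; (subst sum.union_disjoint)?; auto simp: sum.reindex inj_on_def)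
  finally show ?thesis .
qed

lemma double_simps:
  "Suc (2 * i) \<noteq> 2 * j" "2 * i \<noteq> Suc (2 * j)" "2 * i < Suc (2 * j) \<longleftrightarrow> i \<le> j" "Suc (2 * i) < 2 * j \<longleftrightarrow> i < j"
  "Suc (Suc (2 * i)) < 2 * j \<longleftrightarrow> Suc i < j" "Suc (Suc (2 * i)) = 2 * j \<longleftrightarrow> Suc i = j"
  "2 * j = Suc (Suc (2 * i)) \<longleftrightarrow> Suc i = j" "Suc (Suc (2 * i)) \<noteq> Suc (2 * j)"
  "2 * i < Suc (Suc (2 * j)) \<longleftrightarrow> i \<le> j"
  for i j :: nat
  by presburger+

lemma add_mod_inj:
  fixes x y a L :: nat
  assumes "(x + a) mod L = (y + a) mod L" "x < L" "y < L"
  shows "x = y"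
  using assms
proof (induction x y rule: linorder_wlog)
  case (le x y)
  then have "L dvd (y + a) - (x + a)"
    by (subst mod_eq_dvd_iff_nat[symmetric]) auto
  then show ?case using le by (auto dest: dvd_imp_le)
qed simp

text \<open>
  Let \<open>k\<close> be the number of edges that close up horizontally.  They are discordant with all other
  edges, except that concordant and discordant pairs are exchanged in column \<open>0\<close>.  Modulo 2, every
  other contribution is a multiple of \<open>k + 1\<close>, because flow conservation in the even columns
  removes the dependence on the heights.
\<close>

lemma strands_discordant_even:
  assumes D: "D \<subseteq> strands X L" and X: "X > 0" and L: "L > 1" and c: "c < L"
    and even_col: "\<And>i y. i < X \<Longrightarrow> y < L \<Longrightarrow>
      of_bool (Inn i y \<in> D) + of_bool (Vert i y \<in> D) =
      (of_bool (Vert i ((y + L - 1) mod L) \<in> D) +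
       of_bool (\<exists>z. Out (if i = 0 then X - 1 else i - 1) z \<in> D \<and>
         out_pos X L c (if i = 0 then X - 1 else i - 1) z mod L = y) :: nat)"
    and odd_col: "\<And>i. i < X \<Longrightarrow> card {y. Inn i y \<in> D} = card {y. Out i y \<in> D}"
  defines "k \<equiv> card {y. Out (X - 1) y \<in> D}"
  shows "even (card (discordant (\<lambda>e e'. lex_less (strand_target X L c e) (strand_target X L c e'))
      (\<lambda>e e'. lex_less (strand_source e) (strand_source e')) D) + card D + k +
    (k + 1) * (\<Sum>i<X. of_bool (Vert i (L - 1) \<in> D) + (\<Sum>y | Out i y \<in> D. out_pos X L c i y div L)))"
proof -
  define V I P where "V i = {y. Vert i y \<in> D}" and "I i = {y. Inn i y \<in> D}"
    and "P i = {y. Out i y \<in> D}" for i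
  \<comment> \<open>\<open>tp\<close> is the height at which an \<open>Out\<close> edge arrives;
    \<open>pr i\<close> is the cyclic predecessor of \<open>i\<close>, from which edges enter column
    \<open>2 * i\<close>.\<close>
  define tp where "tp i y = out_pos X L c i y mod L" for i y
  define pr where "pr i = (if i = 0 then X - 1 else i - 1)" for i
  have sub: "V i \<subseteq> {..<L}" "I i \<subseteq> {..<L}" "P i \<subseteq> {..<L}" for i
    using D by (auto simp: V_def I_def P_def strands_def)
  have fin: "finite (V i)" "finite (I i)" "finite (P i)" for i
    by (rule finite_subset[OF sub(1)] finite_subset[OF sub(2)] finite_subset[OF sub(3)]; simp)+
  have finD: "finite D" using D by (rule finite_subset) (simp add: strands_def)
  note sum_D = sum_strands[OF D, folded V_def I_def P_def]
  have pr: "pr i < X" if "i < X" for i using that by (auto simp: pr_def)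
  have inj: "inj_on (tp i) (P i)" for i
  proof (rule inj_onI)
    fix x y assume xy: "x \<in> P i" "y \<in> P i" "tp i x = tp i y"
    then have "x < L" "y < L" using sub(3)[of i] by auto
    then show "x = y"
      by (rule add_mod_inj[OF xy(3)[unfolded tp_def out_pos_def]])
  qed
  have tp_less: "tp i y < L" for i y using L by (simp add: tp_def)
  have flow: "of_bool (y \<in> I i) + of_bool (y \<in> V i) =
      (of_bool ((y + L - 1) mod L \<in> V i) + of_bool (y \<in> tp (pr i) ` P (pr i)) :: nat)"
    if "i < X" "y < L" for i y
  proof -
    have "(\<exists>z. Out (pr i) z \<in> D \<and> out_pos X L c (pr i) z mod L = y) \<longleftrightarrow> y \<in> tp (pr i) ` P (pr i)"
      by (auto simp: tp_def P_def)
    then show ?thesis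
      using even_col[OF that] unfolding pr_def[symmetric] by (simp add: V_def I_def)
  qed
  \<comment> \<open>Summed over all heights, the vertical terms of the flow condition
    cancel.\<close>
  have cardIP: "card (I i) = card (P (pr i))" if i: "i < X" for i
  proof -
    have cnt: "(\<Sum>y<L. of_bool (y \<in> S)) = card S" if "S \<subseteq> {..<L}" for S
      using that by (simp add: Int_absorb1 flip: Collect_mem_eq)
    have "bij_betw (\<lambda>y. (y + L - 1) mod L) {..<L} {..<L}"
    proof (rule bij_betwI[where g="\<lambda>y. Suc y mod L"])
      show "Suc ((y + L - 1) mod L) mod L = y" if "y \<in> {..<L}" for y
        using that L by (cases y) (simp_all add: mod_Suc)
      show "(Suc y mod L + L - 1) mod L = y" if "y \<in> {..<L}" for y
        using that L by (auto simp: mod_Suc)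
    qed (use L in auto)
    then have "(\<Sum>y<L. of_bool ((y + L - 1) mod L \<in> V i)) = (\<Sum>y<L. of_bool (y \<in> V i) :: nat)"
      by (rule sum.reindex_bij_betw)
    moreover have "(\<Sum>y<L. of_bool (y \<in> I i) + of_bool (y \<in> V i)) =
        (\<Sum>y<L. of_bool ((y + L - 1) mod L \<in> V i) + of_bool (y \<in> tp (pr i) ` P (pr i)) :: nat)"
      using flow[OF i] by (intro sum.cong) auto
    ultimately have "(\<Sum>y<L. of_bool (y \<in> I i)) = (\<Sum>y<L. of_bool (y \<in> tp (pr i) ` P (pr i)) :: nat)"
      by (simp only: sum.distrib)
    then show ?thesis
      using sub tp_less by (subst (asm) (1 2) cnt) (auto simp: card_image inj)
  qed
  \<comment> \<open>Hence every layer carries as many edges as the last one, from which the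
    induction runs downwards.\<close>
  have cardP: "card (P i) = k" if "i < X" for i
    using that
  proof (induction "X - 1 - i" arbitrary: i)
    case 0
    then have "i = X - 1" by simp
    then show ?case by (simp add: k_def P_def)
  next
    case (Suc n)
    then have "card (P (Suc i)) = k" by (intro Suc.hyps) auto
    moreover have "Suc i < X" using Suc by simp
    ultimately show ?case
      using cardIP[of "Suc i"] odd_col[of "Suc i"] by (simp add: I_def P_def pr_def)
  qed
  have cardI: "card (I i) = k" if "i < X" for i
    using odd_col[OF that] cardP[OF that] by (simp add: I_def P_def)
  \<comment> \<open>Discordances at one column: \<open>Z\<close> among vertical edges,
    \<open>B\<close> of vertical with leaving edges, \<open>A\<close> of vertical with arriving
    edges, \<open>Y\<close> among \<open>Out\<close> edges. \<open>G\<close> and \<open>M\<close>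
    count crossings of the height seam. In column 0 the pairs counted by \<open>A\<close> are the
    concordant ones, since the arriving edges have the largest sources.\<close>
  define A B Z Y G where "A i = (\<Sum>v\<in>V i. \<Sum>p\<in>P (pr i). of_bool (Suc v mod L \<le> tp (pr i) p) :: nat)"
    and "B i = (\<Sum>v\<in>V i. \<Sum>q\<in>I i. of_bool (q \<le> v) :: nat)"
    and "Z i = (\<Sum>v\<in>V i. \<Sum>v'\<in>V i. of_bool (Suc v mod L < Suc v' mod L \<and> v' < v) :: nat)"
    and "Y i = (\<Sum>p\<in>P i. \<Sum>p'\<in>P i. of_bool (p' < p \<and> tp i p < tp i p') :: nat)"
    and "G i = (of_bool (L - 1 \<in> V i) :: nat)" for i
  define M where "M i = (\<Sum>y\<in>P i. out_pos X L c i y div L)" for i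
  have column: "even (Z i + B i + A i + (k + 1) * card (V i - {L - 1}))" if i: "i < X" for i
  proof -
    have "card (I i) = card (tp (pr i) ` P (pr i))"
      using cardIP[OF i] by (simp add: card_image inj)
    from column_discordant_even[of "V i" L "I i" "tp (pr i) ` P (pr i)", OF sub(1,2) _ _ this] flow[OF i]
    show ?thesis
      using tp_less cardP[OF pr[OF i]]
      by (simp add: Z_def B_def A_def sum.reindex[OF inj] card_image[OF inj] image_subset_iff del: sum_of_bool_eq)
  qed
  have layer: "even (Y i + (k + 1) * M i)" if i: "i < X" for i
    using layer_discordant_even[OF sub(3), of "if Suc i < X then 1 else c" i] cardP[OF i] L c
    by (simp add: Y_def M_def tp_def out_pos_def)
  define disc where "disc e e' = (of_bool (lex_less (strand_target X L c e) (strand_target X L c e') \<and>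
    lex_less (strand_source e') (strand_source e)) :: nat)" for e e'
  have "card (discordant (\<lambda>e e'. lex_less (strand_target X L c e) (strand_target X L c e'))
      (\<lambda>e e'. lex_less (strand_source e) (strand_source e')) D) = (\<Sum>e\<in>D. \<Sum>e'\<in>D. disc e e')"
  proof -
    have "discordant (\<lambda>e e'. lex_less (strand_target X L c e) (strand_target X L c e'))
      (\<lambda>e e'. lex_less (strand_source e) (strand_source e')) D =
      {z \<in> D \<times> D. lex_less (strand_target X L c (fst z)) (strand_target X L c (snd z)) \<and>
        lex_less (strand_source (snd z)) (strand_source (fst z))}"
      by (auto simp: discordant_def)
    then show ?thesis
      using finD by (simp only: card_eq_sum_of_bool finite_cartesian_product disc_def sum.cartesian_product)
        (simp only: case_prod_unfold)
  qed
  also have "(\<Sum>e\<in>D. \<Sum>e'\<in>D. disc e e') =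
     (\<Sum>i<X. (\<Sum>v\<in>V i. \<Sum>e'\<in>D. disc (Vert i v) e') + (\<Sum>q\<in>I i. \<Sum>e'\<in>D. disc (Inn i q) e') +
       (\<Sum>p\<in>P i. \<Sum>e'\<in>D. disc (Out i p) e'))"
    by (rule sum_D)
  \<comment> \<open>The last summand belongs to the edges closing up horizontally. Starting last and
    ending in column 0, they are discordant with every edge that neither ends in column 0 nor closes
    up itself.\<close>
  also have "\<dots> = (\<Sum>i<X. Z i + B i + (if i = 0 then 0 else A i) + Y i +
      (if Suc i < X then 0 else (\<Sum>p\<in>P i. (\<Sum>v\<in>V 0. of_bool (tp i p < Suc v mod L)) +
        (\<Sum>j<X. (if j = 0 then 0 else card (V j)) + k + (if Suc j < X then k else 0)))))"
  proof (intro sum.cong refl)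
    fix i assume "i \<in> {..<X}"
    then have i: "i < X" by simp
    have "(\<Sum>e'\<in>D. disc (Vert i v) e') = (\<Sum>v'\<in>V i. of_bool (Suc v mod L < Suc v' mod L \<and> v' < v)) +
       (\<Sum>q\<in>I i. of_bool (q \<le> v)) +
       (if i = 0 then 0 else (\<Sum>p\<in>P (pr i). of_bool (Suc v mod L \<le> tp (pr i) p)))"
      (is "_ = ?a + ?b + ?d") for v
    proof -
      have "(\<Sum>e'\<in>D. disc (Vert i v) e') = (\<Sum>j<X. (if j = i then ?a + ?b else 0) +
          (if Suc j = i then ?d else 0))"
        unfolding sum_D
      proof (intro sum.cong refl)
        fix j assume "j \<in> {..<X}"
        have "(\<Sum>y\<in>V j. disc (Vert i v) (Vert j y)) = (if j = i then ?a else 0)"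
          by (auto simp: disc_def lex_less_def intro!: sum.cong)
        moreover have "(\<Sum>y\<in>I j. disc (Vert i v) (Inn j y)) = (if j = i then ?b else 0)"
          by (auto simp: disc_def lex_less_def double_simps less_Suc_eq_le intro!: sum.cong)
        moreover have "(\<Sum>y\<in>P j. disc (Vert i v) (Out j y)) = (if Suc j = i then ?d else 0)"
          using i by (auto simp: disc_def lex_less_def double_simps pr_def tp_def intro!: sum.cong)
        ultimately show "(\<Sum>y\<in>V j. disc (Vert i v) (Vert j y)) + (\<Sum>y\<in>I j. disc (Vert i v) (Inn j y)) +
          (\<Sum>y\<in>P j. disc (Vert i v) (Out j y)) = (if j = i then ?a + ?b else 0) +
          (if Suc j = i then ?d else 0)" by simp
      qed
      also have "\<dots> = ?a + ?b + ?d"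
        using i by (cases i) (simp_all add: sum.distrib)
      finally show ?thesis .
    qed
    then have 1: "(\<Sum>v\<in>V i. \<Sum>e'\<in>D. disc (Vert i v) e') = Z i + B i + (if i = 0 then 0 else A i)"
      by (simp add: sum.distrib Z_def B_def A_def del: sum_of_bool_eq)
    \<comment> \<open>\<open>disc\<close> lists a pair under the edge with the smaller target; no
      edge starting before an \<open>Inn\<close> edge ends after it.\<close>
    have "(\<Sum>e'\<in>D. disc (Inn i q) e') = 0" for q
      unfolding sum_D
      by (auto simp: disc_def lex_less_def double_simps del: sum_of_bool_eq intro!: sum.neutral split: if_splits)
    then have 2: "(\<Sum>q\<in>I i. \<Sum>e'\<in>D. disc (Inn i q) e') = 0" by simp
    have "(\<Sum>e'\<in>D. disc (Out i p) e') = (\<Sum>p'\<in>P i. of_bool (p' < p \<and> tp i p < tp i p')) +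
       (if Suc i < X then 0 else (\<Sum>v\<in>V 0. of_bool (tp i p < Suc v mod L)) +
        (\<Sum>j<X. (if j = 0 then 0 else card (V j)) + k + (if Suc j < X then k else 0)))"
      (is "_ = ?a + ?b") for p
    proof (cases "Suc i < X")
      case True
      have "(\<Sum>e'\<in>D. disc (Out i p) e') = (\<Sum>j<X. if j = i then ?a else 0)"
        unfolding sum_D
      proof (intro sum.cong refl)
        fix j assume "j \<in> {..<X}"
        have "(\<Sum>y\<in>V j. disc (Out i p) (Vert j y)) = 0"
          using True by (auto simp: disc_def lex_less_def double_simps intro!: sum.neutral)
        moreover have "(\<Sum>y\<in>I j. disc (Out i p) (Inn j y)) = 0"
          using True by (auto simp: disc_def lex_less_def double_simps intro!: sum.neutral)
        moreover have "(\<Sum>y\<in>P j. disc (Out i p) (Out j y)) = (if j = i then ?a else 0)"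
          using True by (auto simp: disc_def lex_less_def double_simps tp_def intro!: sum.cong)
        ultimately show "(\<Sum>y\<in>V j. disc (Out i p) (Vert j y)) + (\<Sum>y\<in>I j. disc (Out i p) (Inn j y)) +
          (\<Sum>y\<in>P j. disc (Out i p) (Out j y)) = (if j = i then ?a else 0)" by simp
      qed
      then show ?thesis using True i by simp
    next
      case False
      then have iX: "X = Suc i" using i by simp
      have "(\<Sum>e'\<in>D. disc (Out i p) e') = (\<Sum>j<X. (if j = i then ?a else 0) +
          (if j = 0 then \<Sum>v\<in>V 0. of_bool (tp i p < Suc v mod L) else 0) +
          ((if j = 0 then 0 else card (V j)) + k + (if Suc j < X then k else 0)))"
        unfolding sum_D
      proof (intro sum.cong refl)
        fix j assume "j \<in> {..<X}"
        then have j: "j < X" by simp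
        have "(\<Sum>y\<in>V j. disc (Out i p) (Vert j y)) =
          (if j = 0 then \<Sum>v\<in>V 0. of_bool (tp i p < Suc v mod L) else 0) + (if j = 0 then 0 else card (V j))"
          using iX j by (auto simp: disc_def lex_less_def double_simps tp_def intro!: sum.cong)
        moreover have "(\<Sum>y\<in>I j. disc (Out i p) (Inn j y)) = k"
          using iX j cardI[OF j] by (auto simp: disc_def lex_less_def double_simps intro!: sum.neutral)
        moreover have "(\<Sum>y\<in>P j. disc (Out i p) (Out j y)) =
            (if j = i then ?a else 0) + (if Suc j < X then k else 0)"
          using iX j cardP[OF j] by (cases "j = i") (auto simp: disc_def lex_less_def double_simps tp_def intro!: sum.cong)
        ultimately show "(\<Sum>y\<in>V j. disc (Out i p) (Vert j y)) + (\<Sum>y\<in>I j. disc (Out i p) (Inn j y)) +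
          (\<Sum>y\<in>P j. disc (Out i p) (Out j y)) = (if j = i then ?a else 0) +
          (if j = 0 then \<Sum>v\<in>V 0. of_bool (tp i p < Suc v mod L) else 0) +
          ((if j = 0 then 0 else card (V j)) + k + (if Suc j < X then k else 0))" by simp
      qed
      also have "\<dots> = (\<Sum>j<X. (if j = i then ?a else 0)) +
          (\<Sum>j<X. if j = 0 then \<Sum>v\<in>V 0. of_bool (tp i p < Suc v mod L) else 0) +
          (\<Sum>j<X. (if j = 0 then 0 else card (V j)) + k + (if Suc j < X then k else 0))"
        by (simp only: sum.distrib)
      also have "\<dots> = ?a + ?b"
        using False i X by (simp del: sum_of_bool_eq)
      finally show ?thesis .
    qed
    then have 3: "(\<Sum>p\<in>P i. \<Sum>e'\<in>D. disc (Out i p) e') = Y i +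
      (if Suc i < X then 0 else (\<Sum>p\<in>P i. (\<Sum>v\<in>V 0. of_bool (tp i p < Suc v mod L)) +
        (\<Sum>j<X. (if j = 0 then 0 else card (V j)) + k + (if Suc j < X then k else 0))))"
      by (cases "Suc i < X") (simp_all only: Y_def sum.distrib if_True if_False sum.neutral_const add_0_right)
    show "(\<Sum>v\<in>V i. \<Sum>e'\<in>D. disc (Vert i v) e') + (\<Sum>q\<in>I i. \<Sum>e'\<in>D. disc (Inn i q) e') +
       (\<Sum>p\<in>P i. \<Sum>e'\<in>D. disc (Out i p) e') =
      Z i + B i + (if i = 0 then 0 else A i) + Y i +
      (if Suc i < X then 0 else (\<Sum>p\<in>P i. (\<Sum>v\<in>V 0. of_bool (tp i p < Suc v mod L)) +
        (\<Sum>j<X. (if j = 0 then 0 else card (V j)) + k + (if Suc j < X then k else 0))))"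
      unfolding 1 2 3 by simp
  qed
  finally have disc: "card (discordant (\<lambda>e e'. lex_less (strand_target X L c e) (strand_target X L c e'))
      (\<lambda>e e'. lex_less (strand_source e) (strand_source e')) D) = \<dots>" .
  also have "\<dots> = (\<Sum>i<X. Z i + B i) + (\<Sum>i<X. if i = 0 then 0 else A i) + (\<Sum>i<X. Y i) +
      ((\<Sum>p\<in>P (X - 1). \<Sum>v\<in>V 0. of_bool (tp (X - 1) p < Suc v mod L)) +
       k * ((\<Sum>j<X. if j = 0 then 0 else card (V j)) + X * k + (X - 1) * k))"
  proof -
    have "{..<X} \<inter> {j. Suc j < X} = {..<X - 1}" by auto
    then have "(\<Sum>j<X. if Suc j < X then k else 0) = (X - 1) * k"
      by (simp add: sum.If_cases)
    moreover have "{..<X} \<inter> - {i. Suc i < X} = {X - 1}" using X by auto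
    then have "(\<Sum>i<X. if Suc i < X then 0 else F i) = F (X - 1)" for F :: "nat \<Rightarrow> nat"
      by (simp add: sum.If_cases)
    moreover have "card (P (X - 1)) = k" using X by (intro cardP) simp
    ultimately show ?thesis
      by (simp only: sum.distrib sum_constant card_lessThan) (simp add: distrib_left)
  qed
  finally have disc: "card (discordant (\<lambda>e e'. lex_less (strand_target X L c e) (strand_target X L c e'))
      (\<lambda>e e'. lex_less (strand_source e) (strand_source e')) D) = \<dots>" .
  \<comment> \<open>In column 0 the discordant pairs and the concordant ones in \<open>A 0\<close>
    make up all pairs of a vertical with an arriving edge.\<close>
  have wrap: "(\<Sum>p\<in>P (X - 1). \<Sum>v\<in>V 0. of_bool (tp (X - 1) p < Suc v mod L)) + A 0 = k * card (V 0)"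
  proof -
    have "(\<Sum>p\<in>P (X - 1). \<Sum>v\<in>V 0. of_bool (tp (X - 1) p < Suc v mod L)) + A 0 =
        (\<Sum>v\<in>V 0. \<Sum>p\<in>P (X - 1). of_bool (tp (X - 1) p < Suc v mod L) + of_bool (Suc v mod L \<le> tp (X - 1) p))"
      by (subst sum.swap) (simp only: A_def pr_def sum.distrib simp_thms if_True)
    also have "\<dots> = (\<Sum>v\<in>V 0. \<Sum>p\<in>P (X - 1). 1)"
      by (intro sum.cong refl) (simp add: not_le)
    finally show ?thesis using cardP[of "X - 1"] X by (simp add: mult.commute)
  qed
  have split0: "(\<Sum>i<X. F i) = F 0 + (\<Sum>i<X. if i = 0 then 0 else F i)" for F :: "nat \<Rightarrow> nat"
    using X by (simp add: sum.remove[of _ 0])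
  have cardV: "card (V i) = card (V i - {L - 1}) + G i" for i
    using fin card_Suc_Diff1[of "V i" "L - 1"] by (auto simp: G_def simp del: card_Diff_insert)
  have cardD: "card D = (\<Sum>i<X. card (V i)) + X * k + X * k"
  proof -
    have "card D = (\<Sum>e\<in>D. 1)" by simp
    also have "\<dots> = (\<Sum>i<X. card (V i) + k + k)"
      unfolding sum_D using cardI cardP by (intro sum.cong) auto
    finally show ?thesis by (simp add: sum.distrib)
  qed
  define U SV where "U = (\<Sum>i<X. card (V i - {L - 1}))" and "SV = (\<Sum>i<X. card (V i))"
  have SV: "SV = U + (\<Sum>i<X. G i)"
    unfolding SV_def U_def by (subst cardV) (rule sum.distrib)
  have columns: "even ((\<Sum>i<X. Z i + B i) + (\<Sum>i<X. A i) + (k + 1) * U)"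
  proof -
    have "(\<Sum>i<X. Z i + B i) + (\<Sum>i<X. A i) + (k + 1) * U = (\<Sum>i<X. Z i + B i + A i + (k + 1) * card (V i - {L - 1}))"
      by (simp only: U_def sum.distrib sum_distrib_left)
    then show ?thesis using column by (simp only:) (intro dvd_sum, simp)
  qed
  have layers: "even ((\<Sum>i<X. Y i) + (k + 1) * (\<Sum>i<X. M i))"
  proof -
    have "(\<Sum>i<X. Y i) + (k + 1) * (\<Sum>i<X. M i) = (\<Sum>i<X. Y i + (k + 1) * M i)"
      by (simp only: sum.distrib sum_distrib_left)
    then show ?thesis using layer by (simp only:) (intro dvd_sum, simp)
  qed
  have X1: "X * k + (X - 1) * k + k = 2 * (X * k)" using X by (cases X) simp_all
  let ?K = "card (discordant (\<lambda>e e'. lex_less (strand_target X L c e) (strand_target X L c e'))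
      (\<lambda>e e'. lex_less (strand_source e) (strand_source e')) D)"
  \<comment> \<open>Adding \<open>2 * A 0\<close> replaces the exceptional term of column 0 by
    \<open>A 0\<close>; adding \<open>k * k\<close> makes the contribution of closing edges paired
    with \<open>Inn\<close> and \<open>Out\<close> edges even.\<close>
  have "?K + 2 * A 0 + k * k = (\<Sum>i<X. Z i + B i) + (\<Sum>i<X. A i) + (\<Sum>i<X. Y i) + k * SV + 2 * (k * (X * k))"
  proof -
    have "k * (\<Sum>j<X. if j = 0 then 0 else card (V j)) + k * card (V 0) = k * SV"
      unfolding SV_def by (simp add: split0[of "\<lambda>i. card (V i)"] algebra_simps)
    moreover have "k * (X * k) + k * ((X - 1) * k) + k * k = 2 * (k * (X * k))"
      using arg_cong[OF X1, of "\<lambda>z. k * z"] by (simp add: algebra_simps)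
    ultimately show ?thesis
      using disc wrap split0[of A] unfolding distrib_left by linarith
  qed
  then have "even ?K \<longleftrightarrow> even ((\<Sum>i<X. Z i + B i) + (\<Sum>i<X. A i) + (\<Sum>i<X. Y i) + k * SV + k)"
    by (metis (no_types, lifting) even_add even_mult_iff even_numeral)
  moreover have "(\<Sum>i<X. of_bool (Vert i (L - 1) \<in> D) + (\<Sum>y | Out i y \<in> D. out_pos X L c i y div L)) =
      (\<Sum>i<X. G i) + (\<Sum>i<X. M i)"
    by (simp only: G_def M_def V_def P_def mem_Collect_eq sum.distrib)
  \<comment> \<open>Modulo 2 the terms collect to k + 1 times the sum of \<open>U\<close>,
    \<open>SV\<close> and all \<open>M i\<close>; as \<open>SV\<close> is \<open>U\<close> plus all
    \<open>G i\<close>, the height-dependent \<open>U\<close> cancels.\<close>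
  ultimately show ?thesis
    using columns layers unfolding cardD SV_def[symmetric] SV
    by (simp only: even_add even_mult_iff even_numeral odd_one simp_thms) blast
qed

section \<open>Sublattices of rank 2\<close>

lemma int_subgroup_generator:
  fixes H :: "int set"
  assumes diff: "\<And>x y. x \<in> H \<Longrightarrow> y \<in> H \<Longrightarrow> x - y \<in> H" and a: "a \<in> H" "a \<noteq> 0"
  obtains d where "d > 0" "\<And>x. x \<in> H \<longleftrightarrow> d dvd x"
proof -
  have 0: "0 \<in> H" using diff[OF a(1) a(1)] by simp
  have neg: "- x \<in> H" if "x \<in> H" for x using diff[OF 0 that] by simp
  have mult: "x * int n \<in> H" if x: "x \<in> H" for x n
  proof (induction n)
    case (Suc n)
    then show ?case using diff[OF Suc neg[OF x]] by (simp add: algebra_simps)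
  qed (simp add: 0)
  have multi: "x * n \<in> H" if "x \<in> H" for x n
    using mult[OF that, of "nat n"] neg[OF mult[OF that, of "nat (- n)"]] by (cases "n \<ge> 0") auto
  have "\<exists>n. n > 0 \<and> int n \<in> H"
    using a multi[OF a(1), of "-1"] by (intro exI[of _ "nat \<bar>a\<bar>"]) (auto simp: abs_if)
  define d where "d = (LEAST n. n > 0 \<and> int n \<in> H)"
  have d: "d > 0" "int d \<in> H"
    using LeastI_ex[OF \<open>\<exists>n. n > 0 \<and> int n \<in> H\<close>] by (simp_all add: d_def)
  have "int d dvd x" if x: "x \<in> H" for x
  proof -
    have "x mod int d \<in> H"
      using diff[OF x multi[OF d(2), of "x div int d"]] by (simp add: minus_mult_div_eq_mod)
    moreover have "x mod int d < int d" "x mod int d \<ge> 0" using d by simp_all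
    ultimately have "\<not> x mod int d > 0"
      using not_less_Least[of "nat (x mod int d)" "\<lambda>n. n > 0 \<and> int n \<in> H"]
      unfolding d_def[symmetric] by auto
    then have "x mod int d = 0" using \<open>x mod int d \<ge> 0\<close> by linarith
    then show ?thesis by (rule dvd_eq_mod_eq_0[THEN iffD2])
  qed
  moreover have "x \<in> H" if "int d dvd x" for x
    using that multi[OF d(2)] by auto
  ultimately show thesis using that[of "int d"] d by auto
qed

lemma lattice_basis_det_nonzero:
  assumes "lattice_basis \<Lambda> \<alpha> \<beta>"
  shows "fst \<alpha> * snd \<beta> - snd \<alpha> * fst \<beta> \<noteq> 0"
proof
  have inj: "int_comb \<alpha> \<beta> x = int_comb \<alpha> \<beta> y \<Longrightarrow> x = y" for x y
    using assms unfolding lattice_basis_def bij_betw_def by (simp add: inj_eq)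
  assume "fst \<alpha> * snd \<beta> - snd \<alpha> * fst \<beta> = 0"
  \<comment> \<open>With cofactors as coefficients the combinations are (d, 0) and (0, -d), where d
    is the determinant.\<close>
  then have "int_comb \<alpha> \<beta> (snd \<beta>, - snd \<alpha>) = int_comb \<alpha> \<beta> (0, 0)"
    "int_comb \<alpha> \<beta> (fst \<beta>, - fst \<alpha>) = int_comb \<alpha> \<beta> (0, 0)"
    by (simp_all add: int_comb_def algebra_simps)
  then have "\<alpha> = (0, 0)"
    using inj[of "(snd \<beta>, - snd \<alpha>)" "(0, 0)"] inj[of "(fst \<beta>, - fst \<alpha>)" "(0, 0)"]
    by (simp add: prod_eq_iff)
  then have "int_comb \<alpha> \<beta> (1, 0) = int_comb \<alpha> \<beta> (0, 0)" by (simp add: int_comb_def)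
  then show False using inj[of "(1, 0)" "(0, 0)"] by simp
qed

locale sublattice =
  fixes \<Lambda> :: "(int \<times> int) set"
  assumes rank2: "rank2_sublattice \<Lambda>"
begin

lemma zero_mem: "0 \<in> \<Lambda>" and diff_mem: "a \<in> \<Lambda> \<Longrightarrow> b \<in> \<Lambda> \<Longrightarrow> a - b \<in> \<Lambda>"
proof -
  obtain \<alpha> \<beta> where "bij_betw (int_comb \<alpha> \<beta>) UNIV \<Lambda>"
    using rank2 by (auto simp: rank2_sublattice_def lattice_basis_def)
  then have \<Lambda>: "\<Lambda> = range (int_comb \<alpha> \<beta>)" by (auto simp: bij_betw_def)
  show "0 \<in> \<Lambda>" unfolding \<Lambda> by (rule image_eqI[of _ _ "(0, 0)"]) (auto simp: int_comb_def zero_prod_def)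
  assume "a \<in> \<Lambda>" "b \<in> \<Lambda>"
  then obtain m n m' n' where "a = int_comb \<alpha> \<beta> (m, n)" "b = int_comb \<alpha> \<beta> (m', n')"
    unfolding \<Lambda> by (metis rangeE surj_pair)
  then have "a - b = int_comb \<alpha> \<beta> (m - m', n - n')"
    by (simp add: int_comb_def algebra_simps)
  then show "a - b \<in> \<Lambda>" unfolding \<Lambda> by simp
qed

lemma add_mem: "a \<in> \<Lambda> \<Longrightarrow> b \<in> \<Lambda> \<Longrightarrow> a + b \<in> \<Lambda>"
  using diff_mem[of a "- b"] diff_mem[OF zero_mem, of b] by simp

definition coset :: "int \<times> int \<Rightarrow> vertex" where
  "coset p = {q. q - p \<in> \<Lambda>}"

lemma vertices_eq: "vertices \<Lambda> = range coset"
  by (auto simp: vertices_def quotient_def coset_def)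

lemma coset_eq_iff: "coset p = coset q \<longleftrightarrow> p - q \<in> \<Lambda>"
proof
  assume "coset p = coset q"
  moreover have "p \<in> coset p" using zero_mem by (simp add: coset_def zero_prod_def)
  ultimately show "p - q \<in> \<Lambda>" by (simp add: coset_def)
next
  assume pq: "p - q \<in> \<Lambda>"
  have "r - p \<in> \<Lambda> \<longleftrightarrow> r - q \<in> \<Lambda>" for r
    using add_mem[of "r - p", OF _ pq] diff_mem[of "r - q", OF _ pq] by auto
  then show "coset p = coset q" by (simp add: coset_def)
qed

lemma shift_coset: "shift v (coset p) = coset (v + p)"
proof -
  have "r \<in> (+) v ` coset p" if "r - (v + p) \<in> \<Lambda>" for r
    using that by (intro image_eqI[of _ _ "r - v"]) (auto simp: coset_def algebra_simps)
  then show ?thesis by (auto simp: shift_def coset_def)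
qed

lemma shift_mem [simp]: "p \<in> vertices \<Lambda> \<Longrightarrow> shift v p \<in> vertices \<Lambda>"
  by (auto simp: vertices_eq shift_coset)

end

lemma shift_shift: "shift v (shift w p) = shift (v + w) p"
  by (simp add: shift_def image_image add.assoc)

lemma shift_zero: "shift 0 p = p" "shift (0, 0) p = p"
  by (auto simp: shift_def image_iff plus_prod_def)

lemma shift_eq_iff: "shift v p = q \<longleftrightarrow> p = shift (- v) q"
proof
  assume "shift v p = q"
  then show "p = shift (- v) q" by (auto simp: shift_shift shift_zero)
qed (simp add: shift_shift shift_zero)

text \<open>Hermite normal form: \<Lambda> is generated by (X, -\<rho>) and (0, Y). The sign makes
  (X, b) and (0, b + \<rho>) the same vertex, so passing from the last column to the first raises
  the height by \<rho>.\<close>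

locale hermite = sublattice +
  fixes X Y \<rho> :: nat
  assumes XY: "X > 0" "Y > 0" "\<rho> < Y"
    and mem_iff: "(a, b) \<in> \<Lambda> \<longleftrightarrow> (\<exists>m n. a = int X * m \<and> b = int Y * n - int \<rho> * m)"
begin

lemma coset_shift_row: "coset (a, b) = coset (a, b mod int Y)"
proof -
  have "(a, b) - (a, b mod int Y) \<in> \<Lambda>"
    unfolding diff_Pair mem_iff
    by (rule exI[of _ 0], rule exI[of _ "b div int Y"]) (simp add: minus_mod_eq_mult_div)
  then show ?thesis by (simp add: coset_eq_iff)
qed

lemma coset_surj:
  assumes "p \<in> vertices \<Lambda>"
  obtains i j where "i < X" "j < Y" "p = coset (int i, int j)"
proof -
  obtain a b where p: "p = coset (a, b)" using assms by (auto simp: vertices_eq)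
  let ?m = "a div int X" and ?q = "(a mod int X, b + int \<rho> * (a div int X))"
  have "(a, b) - ?q \<in> \<Lambda>"
    unfolding diff_Pair mem_iff
    by (rule exI[of _ ?m], rule exI[of _ 0]) (simp add: minus_mod_eq_mult_div)
  then have "p = coset ?q" by (simp add: p coset_eq_iff)
  also have "\<dots> = coset (a mod int X, (b + int \<rho> * ?m) mod int Y)" by (rule coset_shift_row)
  finally show thesis
    using that[of "nat (a mod int X)" "nat ((b + int \<rho> * ?m) mod int Y)"] XY
    by (simp add: nat_less_iff)
qed

end

context sublattice
begin

text \<open>\<open>Y\<close> generates the part of \<Lambda> on the vertical axis, \<open>X\<close>
  its projection to the first coordinate. Neither group is zero, since \<Lambda> contains (0, d) and
  (d, 0) for the determinant \<open>d\<close> of a basis.\<close>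

lemma obtain_hermite:
  obtains X Y \<rho> where "hermite \<Lambda> X Y \<rho>"
proof -
  obtain \<alpha> \<beta> where basis: "lattice_basis \<Lambda> \<alpha> \<beta>"
    using rank2 by (auto simp: rank2_sublattice_def)
  then have bij: "bij_betw (int_comb \<alpha> \<beta>) UNIV \<Lambda>" by (simp add: lattice_basis_def)
  have mem: "int_comb \<alpha> \<beta> x \<in> \<Lambda>" for x using bij by (auto simp: bij_betw_def)
  define d where "d = fst \<alpha> * snd \<beta> - snd \<alpha> * fst \<beta>"
  have "d \<noteq> 0" unfolding d_def by (rule lattice_basis_det_nonzero[OF basis])
  have "int_comb \<alpha> \<beta> (- fst \<beta>, fst \<alpha>) = (0, d)" "int_comb \<alpha> \<beta> (snd \<beta>, - snd \<alpha>) = (d, 0)"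
    by (simp_all add: int_comb_def d_def algebra_simps)
  then have d_mem: "(0, d) \<in> \<Lambda>" "(d, 0) \<in> \<Lambda>"
    using mem[of "(- fst \<beta>, fst \<alpha>)"] mem[of "(snd \<beta>, - snd \<alpha>)"] by simp_all
  have diff: "(a, b) \<in> \<Lambda> \<Longrightarrow> (a', b') \<in> \<Lambda> \<Longrightarrow> (a - a', b - b') \<in> \<Lambda>" for a b a' b'
    using diff_mem[of "(a, b)" "(a', b')"] by simp
  obtain Y where Y: "Y > 0" "\<And>y. (0, y) \<in> \<Lambda> \<longleftrightarrow> Y dvd y"
    by (rule int_subgroup_generator[of "{y. (0, y) \<in> \<Lambda>}" d]) (use diff[of 0 _ 0] d_mem \<open>d \<noteq> 0\<close> in auto)
  obtain X where X: "X > 0" "\<And>x. (\<exists>y. (x, y) \<in> \<Lambda>) \<longleftrightarrow> X dvd x"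
    by (rule int_subgroup_generator[of "{x. \<exists>y. (x, y) \<in> \<Lambda>}" d]) (use diff d_mem \<open>d \<noteq> 0\<close> in \<open>auto, blast\<close>)
  obtain r where r: "(X, r) \<in> \<Lambda>" using X(2)[of X] by auto
  have mult: "(X * m, r * m) \<in> \<Lambda>" for m
  proof -
    obtain m' n' where "int_comb \<alpha> \<beta> (m', n') = (X, r)"
      using r bij by (metis bij_betw_imp_surj_on rangeE surj_pair)
    then have "(X * m, r * m) = int_comb \<alpha> \<beta> (m' * m, n' * m)"
      by (auto simp: int_comb_def algebra_simps)
    then show ?thesis using mem by metis
  qed
  define \<rho> where "\<rho> = (- r) mod Y"
  have \<rho>: "0 \<le> \<rho>" "\<rho> < Y" using Y by (simp_all add: \<rho>_def)
  define q where "q = - ((- r) div Y)"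
  have q: "r = Y * q - \<rho>"
    using mult_div_mod_eq[of Y "- r"] unfolding q_def \<rho>_def by (simp only: mult_minus_right)
  have "(a, b) \<in> \<Lambda> \<longleftrightarrow> (\<exists>m n. a = X * m \<and> b = Y * n - \<rho> * m)" for a b
  proof
    assume ab: "(a, b) \<in> \<Lambda>"
    then obtain m where m: "a = X * m" using X(2)[of a] by auto
    have "(0, b - r * m) \<in> \<Lambda>" using diff[OF ab mult[of m]] m by simp
    then obtain n where "b - r * m = Y * n" using Y(2) by auto
    then have "b = Y * (n + q * m) - \<rho> * m" by (simp add: q algebra_simps)
    then show "\<exists>m n. a = X * m \<and> b = Y * n - \<rho> * m" using m by blast
  next
    assume "\<exists>m n. a = X * m \<and> b = Y * n - \<rho> * m"
    then obtain m n where mn: "a = X * m" "b = Y * n - \<rho> * m" by blast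
    have "(0, - (Y * (n - q * m))) \<in> \<Lambda>" using Y(2) by simp
    from diff[OF mult[of m] this] show "(a, b) \<in> \<Lambda>"
      by (simp add: mn q algebra_simps)
  qed
  then have "hermite \<Lambda> (nat X) (nat Y) (nat \<rho>)"
    using X(1) Y(1) \<rho> by unfold_locales simp_all
  then show thesis by (rule that)
qed

lemma finite_vertices: "finite (vertices \<Lambda>)"
proof -
  obtain X Y \<rho> where "hermite \<Lambda> X Y \<rho>" by (rule obtain_hermite)
  then interpret hermite \<Lambda> X Y \<rho> .
  have "vertices \<Lambda> \<subseteq> (\<lambda>(i, j). coset (int i, int j)) ` ({..<X} \<times> {..<Y})"
    by (auto elim: coset_surj)
  then show ?thesis by (rule finite_subset) simp
qed

end

section \<open>Arrow configurations and the transfer matrix\<close>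

fun in_edges :: "crossing \<times> vertex \<Rightarrow> edge \<times> edge" where
  "in_edges (HO, p) = ((Hor, Inner, p), (Obl, Inner, p))"
| "in_edges (HV, p) = ((Hor, Outer, shift (-1, 0) p), (Ver, Inner, p))"
| "in_edges (OV, p) = ((Obl, Outer, shift (-1, -1) p), (Ver, Outer, shift (0, -1) p))"

fun out_edges :: "crossing \<times> vertex \<Rightarrow> edge \<times> edge" where
  "out_edges (HO, p) = ((Hor, Outer, p), (Obl, Outer, p))"
| "out_edges (HV, p) = ((Hor, Inner, p), (Ver, Outer, p))"
| "out_edges (OV, p) = ((Obl, Inner, p), (Ver, Inner, p))"

abbreviation "in1 v \<equiv> fst (in_edges v)"
abbreviation "in2 v \<equiv> snd (in_edges v)"
abbreviation "out1 v \<equiv> fst (out_edges v)"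
abbreviation "out2 v \<equiv> snd (out_edges v)"

lemma target_eq_iff: "target e = v \<longleftrightarrow> e = in1 v \<or> e = in2 v"
  by (cases e rule: target.cases; cases v rule: in_edges.cases) (auto simp: shift_eq_iff)

lemma source_eq_iff: "source e = v \<longleftrightarrow> e = out1 v \<or> e = out2 v"
  by (cases e rule: source.cases; cases v rule: out_edges.cases) auto

lemma in_edges_neq: "in1 v \<noteq> in2 v" and out_edges_neq: "out1 v \<noteq> out2 v"
  by (cases v rule: in_edges.cases; simp)+

lemma target_in_edges [simp]: "target (in1 v) = v" "target (in2 v) = v"
  and source_out_edges [simp]: "source (out1 v) = v" "source (out2 v) = v"
  using target_eq_iff source_eq_iff by blast+

definition slot :: "crossing \<Rightarrow> line \<Rightarrow> 2" where
  "slot c l = (if l = fst (crossing_lines c) then 1 else 2)"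

lemma slot_edges [simp]:
  "slot (fst v) (fst (in1 v)) = 1" "slot (fst v) (fst (in2 v)) = 2"
  "slot (fst v) (fst (out1 v)) = 1" "slot (fst v) (fst (out2 v)) = 2"
  by (cases v rule: in_edges.cases; simp add: slot_def)+

lemma line_edges:
  "fst (in1 v) = fst (crossing_lines (fst v))" "fst (in2 v) = snd (crossing_lines (fst v))"
  "fst (out1 v) = fst (crossing_lines (fst v))" "fst (out2 v) = snd (crossing_lines (fst v))"
  by (cases v rule: in_edges.cases; simp)+

lemma crossing_lines_neq: "fst (crossing_lines c) \<noteq> snd (crossing_lines c)"
  by (cases c) auto

lemma arrow_in_iff:
  "arrow_in C v (fst (crossing_lines (fst v))) \<longleftrightarrow> in1 v \<in> C"
  "arrow_in C v (snd (crossing_lines (fst v))) \<longleftrightarrow> in2 v \<in> C"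
  using crossing_lines_neq[of "fst v"] line_edges[of v]
  unfolding arrow_in_def target_eq_iff by auto

lemma arrow_out_iff:
  "arrow_out C v (fst (crossing_lines (fst v))) \<longleftrightarrow> out1 v \<in> C"
  "arrow_out C v (snd (crossing_lines (fst v))) \<longleftrightarrow> out2 v \<in> C"
  using crossing_lines_neq[of "fst v"] line_edges[of v]
  unfolding arrow_out_def source_eq_iff by auto

definition transfer :: "matrix_family \<Rightarrow> edge \<Rightarrow> edge \<Rightarrow> complex" where
  "transfer W i j = (if source i = target j
     then vec_nth (vec_nth (W (fst (target j)) (snd (target j))) (slot (fst (target j)) (fst i)))
       (slot (fst (target j)) (fst j))
     else 0)"

definition balanced_at :: "edge set \<Rightarrow> crossing \<times> vertex \<Rightarrow> bool" where
  "balanced_at C v \<longleftrightarrow> (of_bool (in1 v \<in> C) + of_bool (in2 v \<in> C) =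
    (of_bool (out1 v \<in> C) + of_bool (out2 v \<in> C) :: nat))"

text \<open>Inspecting the endpoints of \<open>C\<close> keeps \<Lambda> out of the definition; at
  any other vertex none of the four edges is in \<open>C\<close>.\<close>

definition balanced :: "edge set \<Rightarrow> bool" where
  "balanced C \<longleftrightarrow> (\<forall>v\<in>source ` C \<union> target ` C. balanced_at C v)"

definition config_weight :: "edge set \<Rightarrow> matrix_family \<Rightarrow> crossing \<times> vertex \<Rightarrow> complex" where
  "config_weight C W v = vertex_weight (W (fst v) (snd v)) (in1 v \<in> C, in2 v \<in> C) (out1 v \<in> C, out2 v \<in> C)"

lemma config_weight_eq:
  "config_weight C W (c, p) = vertex_weight (W c p)
     (map_prod (arrow_in C (c, p)) (arrow_in C (c, p)) (crossing_lines c))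
     (map_prod (arrow_out C (c, p)) (arrow_out C (c, p)) (crossing_lines c))"
  using arrow_in_iff[of C "(c, p)"] arrow_out_iff[of C "(c, p)"]
  by (simp add: config_weight_def map_prod_def case_prod_unfold)

lemma config_weight_unbalanced: "\<not> balanced_at C v \<Longrightarrow> config_weight C W v = 0"
  by (cases "in1 v \<in> C"; cases "in2 v \<in> C"; cases "out1 v \<in> C"; cases "out2 v \<in> C")
    (simp_all add: balanced_at_def config_weight_def)

text \<open>Where two paths meet, they touch without crossing: each of them changes its line.\<close>

definition prev_edge :: "edge set \<Rightarrow> edge \<Rightarrow> edge" where
  "prev_edge C e = (let v = source e in
     if e \<notin> C then e
     else if out1 v \<in> C \<and> out2 v \<in> C then (if e = out1 v then in2 v else in1 v)
     else if in1 v \<in> C then in1 v else in2 v)"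

lemma target_prev_edge: "e \<in> C \<Longrightarrow> target (prev_edge C e) = source e"
  by (simp add: prev_edge_def Let_def)

lemma prev_edge_mem:
  assumes "balanced C" "e \<in> C"
  shows "prev_edge C e \<in> C"
proof -
  have "balanced_at C (source e)" using assms by (simp add: balanced_def)
  moreover have "e = out1 (source e) \<or> e = out2 (source e)"
    using source_eq_iff[of e "source e"] by simp
  ultimately show ?thesis
    using assms(2) unfolding prev_edge_def Let_def balanced_at_def
    by (auto split: if_splits simp: of_bool_def)
qed

lemma prev_edge_inj:
  assumes "balanced C"
  shows "inj_on (prev_edge C) C"
proof (rule inj_onI)
  fix e e' assume e: "e \<in> C" "e' \<in> C" "prev_edge C e = prev_edge C e'"
  then have src: "source e' = source e" using target_prev_edge[of e C] target_prev_edge[of e' C] by simp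
  let ?v = "source e"
  have "e = out1 ?v \<or> e = out2 ?v" "e' = out1 ?v \<or> e' = out2 ?v"
    using source_eq_iff[of e ?v] source_eq_iff[of e' ?v] src by simp_all
  then show "e = e'"
    using e src in_edges_neq[of ?v] by (auto simp: prev_edge_def Let_def split: if_splits)
qed

lemma prev_edge_permutes:
  assumes "finite C" "balanced C"
  shows "prev_edge C permutes C"
proof (rule bij_imp_permutes)
  have "prev_edge C ` C = C"
    using assms prev_edge_mem prev_edge_inj by (intro endo_inj_surj) auto
  then show "bij_betw (prev_edge C) C C" using prev_edge_inj[OF assms(2)] by (simp add: bij_betw_def)
qed (simp add: prev_edge_def)

text \<open>Flow conservation: \<open>prev_edge\<close> permutes \<open>C\<close>, and the
  predecessor of an edge ends where the edge starts, so vertex functions telescope along the closed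
  paths.\<close>

lemma balanced_sum:
  fixes F :: "crossing \<times> vertex \<Rightarrow> 'b :: comm_monoid_add"
  assumes "finite C" "balanced C"
  shows "(\<Sum>e\<in>C. F (target e)) = (\<Sum>e\<in>C. F (source e))"
proof -
  have "(\<Sum>e\<in>C. F (target e)) = (\<Sum>e\<in>C. F (target (prev_edge C e)))"
    using sum.permute[OF prev_edge_permutes[OF assms], of "\<lambda>e. F (target e)"] by simp
  then show ?thesis by (simp add: target_prev_edge cong: sum.cong)
qed

lemma balanced_prod:
  fixes F :: "crossing \<times> vertex \<Rightarrow> 'b :: comm_monoid_mult"
  assumes "finite C" "balanced C"
  shows "(\<Prod>e\<in>C. F (target e)) = (\<Prod>e\<in>C. F (source e))"
proof -
  have "(\<Prod>e\<in>C. F (target e)) = (\<Prod>e\<in>C. F (target (prev_edge C e)))"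
    using prod.permute[OF prev_edge_permutes[OF assms], of "\<lambda>e. F (target e)"] by simp
  then show ?thesis by (simp add: target_prev_edge cong: prod.cong)
qed

lemma det_on_singleton: "det_on {a} K = K a a"
  by (simp add: det_on_def)

lemma det_on_pair:
  assumes "a \<noteq> b"
  shows "det_on {a, b} K = K a a * K b b - K a b * K b a"
proof -
  have "{\<sigma>. \<sigma> permutes {a, b}} = {id, Transposition.transpose a b}"
    by (auto simp: permutes_doubleton_iff)
  moreover have "id \<noteq> Transposition.transpose a b"
    using assms by (metis id_apply transpose_apply_first)
  ultimately show ?thesis
    using assms by (simp add: det_on_def sign_swap_id)
qed

lemma transfer_edges:
  "transfer W (out1 v) (in1 v) = vec_nth (vec_nth (W (fst v) (snd v)) 1) 1"
  "transfer W (out1 v) (in2 v) = vec_nth (vec_nth (W (fst v) (snd v)) 1) 2"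
  "transfer W (out2 v) (in1 v) = vec_nth (vec_nth (W (fst v) (snd v)) 2) 1"
  "transfer W (out2 v) (in2 v) = vec_nth (vec_nth (W (fst v) (snd v)) 2) 2"
  by (simp_all add: transfer_def)

text \<open>At a double vertex \<open>prev_edge\<close> interchanges the two incoming edges, which
  reverses the sign of the 2 x 2 determinant and yields b c - a d.\<close>

lemma det_on_out_edges:
  assumes "balanced_at C v"
  shows "det_on {e \<in> C. source e = v} (\<lambda>i j. transfer W i (prev_edge C j)) = config_weight C W v"
proof -
  have set: "{e \<in> C. source e = v} =
      (if out1 v \<in> C then {out1 v} else {}) \<union> (if out2 v \<in> C then {out2 v} else {})"
    unfolding source_eq_iff by auto
  show ?thesis
    using assms in_edges_neq[of v] out_edges_neq[of v] out_edges_neq[of v, symmetric]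
    unfolding set balanced_at_def
    by (cases "in1 v \<in> C"; cases "in2 v \<in> C"; cases "out1 v \<in> C"; cases "out2 v \<in> C")
      (simp_all add: det_on_singleton det_on_pair prev_edge_def config_weight_def transfer_edges)
qed

lemma det_on_scale_cols:
  assumes "finite J"
  shows "det_on J (\<lambda>i j. A i j * w j) = det_on J A * (\<Prod>j\<in>J. w j)"
proof -
  have "(\<Prod>i\<in>J. A i (\<sigma> i) * w (\<sigma> i)) = (\<Prod>i\<in>J. A i (\<sigma> i)) * (\<Prod>j\<in>J. w j)" if "\<sigma> permutes J" for \<sigma>
    using prod.permute[OF that, of w] by (simp add: prod.distrib)
  then show ?thesis
    unfolding det_on_def sum_distrib_right by (intro sum.cong) auto
qed

text \<open>Permuting the columns by \<open>prev_edge\<close> makes the matrix block diagonal, with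
  one block for each vertex. Without balance every Leibniz term vanishes, and so does some vertex
  weight.\<close>

lemma det_on_transfer:
  assumes "finite C" and V: "finite V" "source ` C \<subseteq> V" "target ` C \<subseteq> V"
  shows "det_on C (transfer W) = of_int (sign (prev_edge C)) * (\<Prod>v\<in>V. config_weight C W v)"
proof (cases "balanced C")
  case True
  have "det_on C (transfer W) = of_int (sign (prev_edge C)) * det_on C (\<lambda>i j. transfer W i (prev_edge C j))"
    by (rule det_on_permute_cols) (use assms True prev_edge_permutes in auto)
  also have "det_on C (\<lambda>i j. transfer W i (prev_edge C j)) =
      det_on (\<Union>v\<in>V. {e \<in> C. source e = v}) (\<lambda>i j. transfer W i (prev_edge C j))"
    using V(2) by (intro arg_cong2[of _ _ _ _ det_on]) auto
  also have "\<dots> = (\<Prod>v\<in>V. det_on {e \<in> C. source e = v} (\<lambda>i j. transfer W i (prev_edge C j)))"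
    by (rule det_on_Union) (use assms in \<open>auto simp: transfer_def target_prev_edge\<close>)
  also have "\<dots> = (\<Prod>v\<in>V. config_weight C W v)"
  proof (intro prod.cong refl det_on_out_edges)
    fix v assume "v \<in> V"
    show "balanced_at C v"
    proof (cases "v \<in> source ` C \<union> target ` C")
      case True
      then show ?thesis using \<open>balanced C\<close> by (simp add: balanced_def)
    next
      case False
      then have "in1 v \<notin> C" "in2 v \<notin> C" "out1 v \<notin> C" "out2 v \<notin> C"
        using target_in_edges[of v] source_out_edges[of v] by (force simp del: target_in_edges source_out_edges)+
      then show ?thesis by (simp add: balanced_at_def)
    qed
  qed
  finally show ?thesis .
next
  case False
  then obtain v where v: "v \<in> V" "\<not> balanced_at C v"
    using V unfolding balanced_def by blast
  then have "(\<Prod>v\<in>V. config_weight C W v) = 0"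
    using V(1) by (auto intro!: prod_zero config_weight_unbalanced)
  moreover have "det_on C (transfer W) = 0"
    unfolding det_on_def
  proof (intro sum.neutral ballI)
    fix \<sigma> assume "\<sigma> \<in> {\<sigma>. \<sigma> permutes C}"
    then have \<sigma>: "\<sigma> permutes C" by simp
    \<comment> \<open>Otherwise \<sigma> would match the edges leaving \<open>v\<close> with those
      entering it, and their numbers would agree.\<close>
    have "\<exists>i\<in>C. source i \<noteq> target (\<sigma> i)"
    proof (rule ccontr)
      assume "\<not> (\<exists>i\<in>C. source i \<noteq> target (\<sigma> i))"
      then have src: "source i = target (\<sigma> i)" if "i \<in> C" for i using that by auto
      have count: "(\<Sum>e\<in>C. of_bool (e = x \<or> e = y)) = (of_bool (x \<in> C) + of_bool (y \<in> C) :: nat)"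
        if "x \<noteq> y" for x y
      proof -
        have "(\<Sum>e\<in>C. of_bool (e = x \<or> e = y)) = (\<Sum>e\<in>C. of_bool (e = x) + of_bool (e = y) :: nat)"
          using that by (intro sum.cong) auto
        then show ?thesis using assms(1) by (simp add: sum.distrib of_bool_def)
      qed
      have "(\<Sum>i\<in>C. of_bool (source i = v)) = (\<Sum>i\<in>C. of_bool (target (\<sigma> i) = v) :: nat)"
        using src by (intro sum.cong) auto
      also have "\<dots> = (\<Sum>i\<in>C. of_bool (target i = v))"
        using sum.permute[OF \<sigma>, of "\<lambda>i. of_bool (target i = v) :: nat"] by simp
      finally show False
        using v(2) unfolding source_eq_iff target_eq_iff count[OF in_edges_neq] count[OF out_edges_neq]
        by (simp add: balanced_at_def)
    qed
    then have "(\<Prod>i\<in>C. transfer W i (\<sigma> i)) = 0"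
      using assms(1) by (auto intro!: prod_zero simp: transfer_def)
    then show "of_int (sign \<sigma>) * (\<Prod>i\<in>C. transfer W i (\<sigma> i)) = 0" by simp
  qed
  ultimately show ?thesis by simp
qed

lemma det_on_kagome:
  assumes "finite E" and V: "finite V" "source ` E \<subseteq> V" "target ` E \<subseteq> V"
  shows "det_on E (\<lambda>i j. (if i = j then 1 else 0) - transfer W i j * w j) =
    (\<Sum>C\<in>Pow E. (-1) ^ card C * of_int (sign (prev_edge C)) * (\<Prod>v\<in>V. config_weight C W v) * (\<Prod>e\<in>C. w e))"
  unfolding det_on_id_minus[OF assms(1)]
proof (intro sum.cong refl)
  fix C assume "C \<in> Pow E"
  then have "finite C" "source ` C \<subseteq> V" "target ` C \<subseteq> V"
    using assms finite_subset by auto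
  then show "(-1) ^ card C * det_on C (\<lambda>i j. transfer W i j * w j) =
      (-1) ^ card C * of_int (sign (prev_edge C)) * (\<Prod>v\<in>V. config_weight C W v) * (\<Prod>e\<in>C. w e)"
    using V(1) by (simp add: det_on_scale_cols det_on_transfer)
qed

section \<open>Elimination of half of the edges\<close>

lemma UNIV_line: "(UNIV :: line set) = {Hor, Obl, Ver}"
  using line.exhaust by auto

lemma finite_UNIV_line [simp]: "finite (UNIV :: line set)"
  by (simp add: UNIV_line)

lemma UNIV_crossing: "(UNIV :: crossing set) = {HO, HV, OV}"
  using crossing.exhaust by auto

lemma finite_UNIV_crossing [simp]: "finite (UNIV :: crossing set)"
  by (simp add: UNIV_crossing)

lemma sum_line: "(\<Sum>m\<in>UNIV. F m) = F Hor + F Obl + (F Ver :: complex)"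
  by (simp add: UNIV_line add.assoc)

lemma shift_inject [simp]: "shift v p = shift v q \<longleftrightarrow> p = q"
  by (metis shift_eq_iff)

lemma shift_minus [simp]: "shift (- v) (shift v p) = p" "shift v (shift (- v) p) = p"
  by (simp_all add: shift_shift shift_zero)

text \<open>Common part of both eliminations. \<open>h\<close> numbers the eliminated and
  \<open>g\<close> the kept edges by line and triangle: \<open>g (l, p)\<close> enters the triangle
  \<open>p\<close>, and \<open>g (l, shift (dir l) p)\<close> leaves it. The vanishing hypotheses
  confine all passages to one triangle; \<open>N p\<close> sums their weights.\<close>

lemma det_on_eliminate_kagome:
  fixes g h :: "line \<times> vertex \<Rightarrow> edge"
  assumes fin: "finite V"
    and shiftV: "\<And>v p. p \<in> V \<Longrightarrow> shift v p \<in> V"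
    and g: "inj_on g (UNIV \<times> V)" and h: "inj_on h (UNIV \<times> V)"
    and disj: "h ` (UNIV \<times> V) \<inter> g ` (UNIV \<times> V) = {}"
    and nil: "\<And>m m' m'' s s' s''. transfer W (h (m, s)) (h (m', s')) * transfer W (h (m', s')) (h (m'', s'')) = 0"
    and gh: "\<And>l m r s. s \<noteq> r \<Longrightarrow> transfer W (g (l, shift (dir l) r)) (h (m, s)) = 0"
    and hh: "\<And>m m' s s'. s \<noteq> s' \<Longrightarrow> transfer W (h (m, s)) (h (m', s')) = 0"
    and hg: "\<And>m l p s. s \<noteq> p \<Longrightarrow> transfer W (h (m, s)) (g (l, p)) = 0"
    and gg: "\<And>l l' r p. r \<noteq> p \<Longrightarrow> transfer W (g (l, shift (dir l) r)) (g (l', p)) = 0"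
    and entry: "\<And>l l' p. p \<in> V \<Longrightarrow>
      transfer W (g (l, shift (dir l) p)) (g (l', p)) +
      (\<Sum>m\<in>UNIV. transfer W (g (l, shift (dir l) p)) (h (m, p)) * (transfer W (h (m, p)) (g (l', p)) +
        (\<Sum>m'\<in>UNIV. transfer W (h (m, p)) (h (m', p)) * transfer W (h (m', p)) (g (l', p))))) = N p l l'"
    and w: "\<And>m s. w (h (m, s)) = 1" "\<And>l p. w (g (l, p)) = d l"
  shows "det_on (h ` (UNIV \<times> V) \<union> g ` (UNIV \<times> V)) (\<lambda>i j. (if i = j then 1 else 0) - transfer W i j * w j) =
    det_on (UNIV \<times> V) (\<lambda>i j. (if i = j then 1 else 0) -
      (if snd i = shift (dir (fst i)) (snd j) then N (snd j) (fst i) (fst j) else 0) * d (fst j))"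
proof -
  let ?U = "h ` (UNIV \<times> V)" and ?P = "g ` (UNIV \<times> V)"
  have sum_U: "(\<Sum>a\<in>?U. F a) = (\<Sum>m\<in>UNIV. F (h (m, r)))"
    if "r \<in> V" "\<And>m s. s \<noteq> r \<Longrightarrow> F (h (m, s)) = 0" for r and F :: "edge \<Rightarrow> complex"
  proof -
    have "(\<Sum>a\<in>?U. F a) = (\<Sum>m\<in>UNIV. \<Sum>s\<in>V. F (h (m, s)))"
      by (simp add: sum.reindex[OF h] sum.cartesian_product)
    also have "\<dots> = (\<Sum>m\<in>UNIV. \<Sum>s\<in>V. if s = r then F (h (m, r)) else 0)"
      using that(2) by (intro sum.cong refl) auto
    finally show ?thesis using fin that(1) by simp
  qed
  have "det_on (?U \<union> ?P) (\<lambda>i j. (if i = j then 1 else 0) - transfer W i j * w j) =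
      det_on ?P (\<lambda>i j. (if i = j then 1 else 0) - (transfer W i j * w j +
        (\<Sum>a\<in>?U. transfer W i a * w a * (transfer W a j * w j +
          (\<Sum>b\<in>?U. transfer W a b * w b * (transfer W b j * w j))))))"
  proof (rule det_on_eliminate)
    fix i j k assume "i \<in> ?U" "j \<in> ?U" "k \<in> ?U"
    then obtain x y z where "i = h x" "j = h y" "k = h z" by blast
    then show "transfer W i j * w j * (transfer W j k * w k) = 0"
      using nil[of "fst x" "snd x" "fst y" "snd y" "fst z" "snd z"] by auto
  qed (use fin disj in auto)
  also have "\<dots> = det_on (UNIV \<times> V) (\<lambda>i j. (if g i = g j then 1 else 0) - (transfer W (g i) (g j) * w (g j) +
        (\<Sum>a\<in>?U. transfer W (g i) a * w a * (transfer W a (g j) * w (g j) +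
          (\<Sum>b\<in>?U. transfer W a b * w b * (transfer W b (g j) * w (g j)))))))"
    using fin g by (intro det_on_reindex) (auto simp: bij_betw_def)
  also have "\<dots> = det_on (UNIV \<times> V) (\<lambda>i j. (if i = j then 1 else 0) -
      (if snd i = shift (dir (fst i)) (snd j) then N (snd j) (fst i) (fst j) else 0) * d (fst j))"
  proof (intro det_on_cong)
    fix i j :: "line \<times> vertex" assume ij: "i \<in> UNIV \<times> V" "j \<in> UNIV \<times> V"
    obtain l q where i: "i = (l, q)" by (cases i)
    obtain l' p where j: "j = (l', p)" by (cases j)
    \<comment> \<open>The kept edge with index (l, q) leaves the triangle \<open>r\<close>, so only
      eliminated edges of this triangle contribute.\<close>
    define r where "r = shift (- dir l) q"
    have q: "q = shift (dir l) r" and rV: "r \<in> V" and pV: "p \<in> V"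
      using ij i j shiftV by (auto simp: r_def)
    have inner: "(\<Sum>b\<in>?U. transfer W (h (m, r)) b * w b * (transfer W b (g j) * w (g j))) =
        (\<Sum>m'\<in>UNIV. transfer W (h (m, r)) (h (m', r)) * (transfer W (h (m', r)) (g j) * d l'))" for m
      using hh[of r] rV by (subst sum_U[of r]) (auto simp: w j)
    define F where "F a = transfer W (g i) a * w a * (transfer W a (g j) * w (g j) +
          (\<Sum>b\<in>?U. transfer W a b * w b * (transfer W b (g j) * w (g j))))" for a
    have "(\<Sum>a\<in>?U. F a) = (\<Sum>m\<in>UNIV. F (h (m, r)))"
      using rV by (rule sum_U) (simp add: F_def gh i q)
    then have "transfer W (g i) (g j) * w (g j) + (\<Sum>a\<in>?U. transfer W (g i) a * w a * (transfer W a (g j) * w (g j) +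
          (\<Sum>b\<in>?U. transfer W a b * w b * (transfer W b (g j) * w (g j))))) =
        transfer W (g i) (g j) * w (g j) + (\<Sum>m\<in>UNIV. transfer W (g i) (h (m, r)) * (transfer W (h (m, r)) (g j) * d l' +
          (\<Sum>m'\<in>UNIV. transfer W (h (m, r)) (h (m', r)) * (transfer W (h (m', r)) (g j) * d l'))))"
      unfolding F_def by (simp only: inner) (simp add: w j)
    also have "\<dots> = (transfer W (g i) (g j) + (\<Sum>m\<in>UNIV. transfer W (g i) (h (m, r)) * (transfer W (h (m, r)) (g j) +
          (\<Sum>m'\<in>UNIV. transfer W (h (m, r)) (h (m', r)) * transfer W (h (m', r)) (g j))))) * d l'"
      by (simp add: w j sum_distrib_left sum_distrib_right algebra_simps)
    also have "\<dots> = (if r = p then N p l l' else 0) * d l'"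
      using entry[OF pV, of l l'] gg hg by (cases "r = p") (auto simp: i j q)
    finally show "(if g i = g j then 1 else 0) - (transfer W (g i) (g j) * w (g j) +
        (\<Sum>a\<in>?U. transfer W (g i) a * w a * (transfer W a (g j) * w (g j) +
          (\<Sum>b\<in>?U. transfer W a b * w b * (transfer W b (g j) * w (g j)))))) = (if i = j then 1 else 0) -
      (if snd i = shift (dir (fst i)) (snd j) then N (snd j) (fst i) (fst j) else 0) * d (fst j)"
      using inj_on_eq_iff[OF g ij] by (simp add: i j q)
  qed
  finally show ?thesis .
qed

fun line_weight :: "complex \<Rightarrow> complex \<Rightarrow> line \<Rightarrow> complex" where
  "line_weight u w Hor = inverse u"
| "line_weight u w Obl = inverse u * inverse w"
| "line_weight u w Ver = inverse w"

text \<open>The weight of a full lattice step sits on one half of the edges, the half that an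
  elimination keeps.\<close>

definition half_weight :: "half \<Rightarrow> complex \<Rightarrow> complex \<Rightarrow> edge \<Rightarrow> complex" where
  "half_weight t u w e = (if fst (snd e) = t then line_weight u w (fst e) else 1)"

lemma diag_entry_eq: "diag_entry u w j = line_weight u w (fst j)"
  by (cases "(u, w, j)" rule: diag_entry.cases) auto

lemmas transfer_entry_simps = transfer_def slot_def sum_line matrix_matrix_mult_def sum_3

lemma edges_split: "edges \<Lambda> = (\<lambda>(l, p). (l, Inner, p)) ` (UNIV \<times> vertices \<Lambda>) \<union>
    (\<lambda>(l, p). (l, Outer, p)) ` (UNIV \<times> vertices \<Lambda>)"
proof -
  have "(UNIV :: half set) = {Inner, Outer}" using half.exhaust by auto
  then show ?thesis by (auto simp: edges_def image_iff)
qed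

context sublattice
begin

lemma finite_edges: "finite (edges \<Lambda>)"
  unfolding edges_split using finite_vertices by simp

lemma I_det_eq_kagome:
  "I_det \<Lambda> W u w = det_on (edges \<Lambda>) (\<lambda>i j. (if i = j then 1 else 0) - transfer W i j * half_weight Outer u w j)"
proof -
  let ?V = "vertices \<Lambda>"
  \<comment> \<open>The coordinate (l, p) belongs to the edge arriving at \<open>p\<close>, the
    outer edge of the preceding point. Inside the triangle arrows meet \<open>OV\<close>,
    \<open>HV\<close>, \<open>HO\<close> in this order, whence the product with \<open>HO\<close> on
    the left.\<close>
  define g :: "line \<times> vertex \<Rightarrow> edge" where "g = (\<lambda>(l, p). (l, Outer, shift (- dir l) p))"
  define h :: "line \<times> vertex \<Rightarrow> edge" where "h = (\<lambda>(l, p). (l, Inner, p))"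
  have gV: "g ` (UNIV \<times> ?V) = (\<lambda>(l, p). (l, Outer, p)) ` (UNIV \<times> ?V)"
  proof -
    have "(l, Outer, p) \<in> g ` (UNIV \<times> ?V)" if "p \<in> ?V" for l p
      by (rule image_eqI[of _ _ "(l, shift (dir l) p)"]) (use that in \<open>auto simp: g_def\<close>)
    then show ?thesis by (auto simp: g_def)
  qed
  have "det_on (h ` (UNIV \<times> ?V) \<union> g ` (UNIV \<times> ?V))
      (\<lambda>i j. (if i = j then 1 else 0) - transfer W i j * half_weight Outer u w j) =
    det_on (UNIV \<times> ?V) (\<lambda>i j. (if i = j then 1 else 0) -
      (if snd i = shift (dir (fst i)) (snd j) then
        vec_nth (vec_nth (embed HO (W HO (snd j)) ** embed HV (W HV (snd j)) ** embed OV (W OV (snd j)))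
          (component (fst i))) (component (fst j)) else 0) * line_weight u w (fst j))"
  proof (rule det_on_eliminate_kagome[OF finite_vertices])
    fix l l' p assume "p \<in> ?V"
    show "transfer W (g (l, shift (dir l) p)) (g (l', p)) +
      (\<Sum>m\<in>UNIV. transfer W (g (l, shift (dir l) p)) (h (m, p)) * (transfer W (h (m, p)) (g (l', p)) +
        (\<Sum>m'\<in>UNIV. transfer W (h (m, p)) (h (m', p)) * transfer W (h (m', p)) (g (l', p))))) =
      vec_nth (vec_nth (embed HO (W HO p) ** embed HV (W HV p) ** embed OV (W OV p)) (component l)) (component l')"
      by (cases l; cases l') (simp_all add: g_def h_def shift_shift shift_zero transfer_entry_simps algebra_simps)
  next
    fix m m' m'' s s' s''
    show "transfer W (h (m, s)) (h (m', s')) * transfer W (h (m', s')) (h (m'', s'')) = 0"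
      by (cases m; cases m'; cases m'') (simp_all add: h_def transfer_def)
  next
    fix l m and r s :: vertex assume "s \<noteq> r"
    then show "transfer W (g (l, shift (dir l) r)) (h (m, s)) = 0"
      by (cases l; cases m) (simp_all add: g_def h_def transfer_def shift_shift shift_zero)
  next
    fix m m' and s s' :: vertex assume "s \<noteq> s'"
    then show "transfer W (h (m, s)) (h (m', s')) = 0"
      by (cases m; cases m') (simp_all add: h_def transfer_def)
  next
    fix m l and s p :: vertex assume "s \<noteq> p"
    then show "transfer W (h (m, s)) (g (l, p)) = 0"
      by (cases m; cases l) (simp_all add: g_def h_def transfer_def shift_shift shift_zero)
  next
    fix l l' and r p :: vertex assume "r \<noteq> p"
    then show "transfer W (g (l, shift (dir l) r)) (g (l', p)) = 0"
      by (cases l; cases l') (simp_all add: g_def h_def transfer_def shift_shift shift_zero)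
  qed (auto simp: g_def h_def inj_on_def half_weight_def)
  moreover have "h ` (UNIV \<times> ?V) \<union> g ` (UNIV \<times> ?V) = edges \<Lambda>"
    unfolding gV edges_split by (simp add: h_def)
  ultimately show ?thesis
    by (simp add: I_det_def op_A_def case_prod_unfold diag_entry_eq)
qed

text \<open>The outer edges form the opposite triangles, with corners \<open>HO\<close> at p,
  \<open>HV\<close> at p + (1, 0) and \<open>OV\<close> at p + (1, 1), met in this order. Their path
  sums are the reversed product in the evolution equation, which \<open>W'\<close> factorizes
  again.\<close>

lemma I_det_evolution_eq_kagome:
  assumes "evolution_step \<Lambda> W W'"
  shows "I_det \<Lambda> W' u w =
    det_on (edges \<Lambda>) (\<lambda>i j. (if i = j then 1 else 0) - transfer W i j * half_weight Inner u w j)"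
proof -
  let ?V = "vertices \<Lambda>"
  \<comment> \<open>In the opposite triangle belonging to p the vertical edge starts at p + (1, 0),
    while the other two start at p.\<close>
  define off where "off l = (if l = Ver then (1, 0) else (0, 0) :: int \<times> int)" for l
  define g :: "line \<times> vertex \<Rightarrow> edge" where "g = (\<lambda>(l, p). (l, Inner, shift (off l) p))"
  define h :: "line \<times> vertex \<Rightarrow> edge" where "h = (\<lambda>(l, p). (l, Outer, shift (off l) p))"
  have range: "(\<lambda>(l, p). (l, t, shift (off l) p)) ` (UNIV \<times> ?V) = (\<lambda>(l, p). (l, t, p)) ` (UNIV \<times> ?V)" for t :: half
  proof -
    have "(l, t, p) \<in> (\<lambda>(l, p). (l, t, shift (off l) p)) ` (UNIV \<times> ?V)" if "p \<in> ?V" for l p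
      by (rule image_eqI[of _ _ "(l, shift (- off l) p)"]) (use that in auto)
    then show ?thesis by auto
  qed
  have "det_on (h ` (UNIV \<times> ?V) \<union> g ` (UNIV \<times> ?V))
      (\<lambda>i j. (if i = j then 1 else 0) - transfer W i j * half_weight Inner u w j) =
    det_on (UNIV \<times> ?V) (\<lambda>i j. (if i = j then 1 else 0) -
      (if snd i = shift (dir (fst i)) (snd j) then
        vec_nth (vec_nth (embed HO (W' HO (snd j)) ** embed HV (W' HV (snd j)) ** embed OV (W' OV (snd j)))
          (component (fst i))) (component (fst j)) else 0) * line_weight u w (fst j))"
  proof (rule det_on_eliminate_kagome[OF finite_vertices])
    fix l l' p assume p: "p \<in> ?V"
    have "transfer W (g (l, shift (dir l) p)) (g (l', p)) +
      (\<Sum>m\<in>UNIV. transfer W (g (l, shift (dir l) p)) (h (m, p)) * (transfer W (h (m, p)) (g (l', p)) +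
        (\<Sum>m'\<in>UNIV. transfer W (h (m, p)) (h (m', p)) * transfer W (h (m', p)) (g (l', p))))) =
      vec_nth (vec_nth (embed OV (W OV (shift (1, 1) p)) ** embed HV (W HV (shift (1, 0) p)) ** embed HO (W HO p))
        (component l)) (component l')"
      by (cases l; cases l')
        (simp_all add: g_def h_def off_def shift_shift shift_zero transfer_entry_simps algebra_simps)
    then show "transfer W (g (l, shift (dir l) p)) (g (l', p)) +
      (\<Sum>m\<in>UNIV. transfer W (g (l, shift (dir l) p)) (h (m, p)) * (transfer W (h (m, p)) (g (l', p)) +
        (\<Sum>m'\<in>UNIV. transfer W (h (m, p)) (h (m', p)) * transfer W (h (m', p)) (g (l', p))))) =
      vec_nth (vec_nth (embed HO (W' HO p) ** embed HV (W' HV p) ** embed OV (W' OV p)) (component l)) (component l')"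
      using assms p by (simp add: evolution_step_def)
  next
    fix m m' m'' s s' s''
    show "transfer W (h (m, s)) (h (m', s')) * transfer W (h (m', s')) (h (m'', s'')) = 0"
      by (cases m; cases m'; cases m'') (simp_all add: h_def transfer_def)
  next
    fix l m and r s :: vertex assume "s \<noteq> r"
    then show "transfer W (g (l, shift (dir l) r)) (h (m, s)) = 0"
      by (cases l; cases m) (simp_all add: g_def h_def off_def transfer_def shift_shift shift_zero)
  next
    fix m m' and s s' :: vertex assume "s \<noteq> s'"
    then show "transfer W (h (m, s)) (h (m', s')) = 0"
      by (cases m; cases m') (simp_all add: h_def off_def transfer_def shift_shift shift_zero)
  next
    fix m l and s p :: vertex assume "s \<noteq> p"
    then show "transfer W (h (m, s)) (g (l, p)) = 0"
      by (cases m; cases l) (simp_all add: g_def h_def off_def transfer_def shift_shift shift_zero)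
  next
    fix l l' and r p :: vertex assume "r \<noteq> p"
    then show "transfer W (g (l, shift (dir l) r)) (g (l', p)) = 0"
      by (cases l; cases l') (simp_all add: g_def h_def off_def transfer_def shift_shift shift_zero)
  qed (auto simp: g_def h_def inj_on_def half_weight_def)
  moreover have "h ` (UNIV \<times> ?V) \<union> g ` (UNIV \<times> ?V) = edges \<Lambda>"
    unfolding edges_split g_def h_def range by auto
  ultimately show ?thesis
    by (simp add: I_det_def op_A_def case_prod_unfold diag_entry_eq)
qed

end

section \<open>Coordinates on the kagome lattice\<close>

context hermite
begin

text \<open>A vertical line meets two kagome vertices per lattice point, hence circumference
  \<open>2 * Y\<close>. In these units the lattice shift across the last column is
  \<open>2 * \<rho>\<close>, added to the ordinary rise by 1 of an \<open>Out\<close> edge.\<close>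

abbreviation "L \<equiv> 2 * Y"
abbreviation "tgt \<equiv> strand_target X L (Suc (2 * \<rho>))"

lemma coset_shift_column: "coset (int X, b) = coset (0, b + int \<rho>)"
proof -
  have "(int X, b) - (0, b + int \<rho>) \<in> \<Lambda>"
    unfolding diff_Pair mem_iff by (rule exI[of _ 1], rule exI[of _ 0]) simp
  then show ?thesis by (simp add: coset_eq_iff)
qed

lemma coset_inject:
  assumes "i < X" "j < Y" "i' < X" "j' < Y"
  shows "coset (int i, int j) = coset (int i', int j') \<longleftrightarrow> i = i' \<and> j = j'"
proof
  assume "coset (int i, int j) = coset (int i', int j')"
  then obtain m n where mn: "int i - int i' = int X * m" "int j - int j' = int Y * n - int \<rho> * m"
    by (auto simp: coset_eq_iff mem_iff)
  have "int X dvd int i - int i'" using mn(1) by simp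
  then have "i = i'"
    using assms dvd_imp_le_int[of "int i - int i'" "int X"] by (cases "i = i'") linarith+
  then have "m = 0" using mn(1) XY by simp
  then have "int Y dvd int j - int j'" using mn(2) by simp
  then have "j = j'"
    using assms dvd_imp_le_int[of "int j - int j'" "int Y"] by (cases "j = j'") linarith+
  then show "i = i' \<and> j = j'" using \<open>i = i'\<close> by simp
qed simp

text \<open>In an even column, even heights are \<open>OV\<close> and odd heights \<open>HV\<close>;
  thus \<open>Inn\<close> is oblique at even and horizontal at odd heights. From \<open>HO\<close>
  the horizontal edge rises to the \<open>HV\<close> of the next column and the oblique one to the
  \<open>OV\<close> above it.\<close>

fun strand_edge :: "strand \<Rightarrow> edge" where
  "strand_edge (Vert i y) = (Ver, if even y then Inner else Outer, coset (int i, int (y div 2)))"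
| "strand_edge (Inn i y) = (if even y then Obl else Hor, Inner, coset (int i, int (y div 2)))"
| "strand_edge (Out i y) = (if even y then Hor else Obl, Outer, coset (int i, int (y div 2)))"

lemma strands_iff [simp]:
  "Vert i y \<in> strands X L \<longleftrightarrow> i < X \<and> y < L" "Inn i y \<in> strands X L \<longleftrightarrow> i < X \<and> y < L"
  "Out i y \<in> strands X L \<longleftrightarrow> i < X \<and> y < L"
  by (auto simp: strands_def)

lemma parity_div_eq: "even x = even y \<Longrightarrow> x div 2 = y div 2 \<Longrightarrow> x = y" for x y :: nat
  by presburger

lemma strand_edge_bij: "bij_betw strand_edge (strands X L) (edges \<Lambda>)"
  unfolding bij_betw_def
proof (intro conjI inj_onI equalityI subsetI)
  fix s t assume st: "s \<in> strands X L" "t \<in> strands X L" "strand_edge s = strand_edge t"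
  have half: "y div 2 < Y" if "y < L" for y using that by auto
  show "s = t"
    using st by (cases s; cases t) (auto simp: coset_inject half intro: parity_div_eq split: if_splits)
next
  fix e assume "e \<in> strand_edge ` strands X L"
  then obtain s where "s \<in> strands X L" "e = strand_edge s" by auto
  then show "e \<in> edges \<Lambda>" by (cases s) (auto simp: edges_def vertices_eq)
next
  fix e assume "e \<in> edges \<Lambda>"
  then obtain l t p where e: "e = (l, t, p)" "p \<in> vertices \<Lambda>" by (auto simp: edges_def)
  then obtain i j where ij: "i < X" "j < Y" "p = coset (int i, int j)" using coset_surj by metis
  have "e = strand_edge (case (l, t) of
      (Ver, Inner) \<Rightarrow> Vert i (2 * j) | (Ver, Outer) \<Rightarrow> Vert i (2 * j + 1)
    | (Obl, Inner) \<Rightarrow> Inn i (2 * j) | (Hor, Inner) \<Rightarrow> Inn i (2 * j + 1)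
    | (Hor, Outer) \<Rightarrow> Out i (2 * j) | (Obl, Outer) \<Rightarrow> Out i (2 * j + 1))" (is "_ = strand_edge ?s")
    by (cases l; cases t) (simp_all add: e ij)
  moreover have "?s \<in> strands X L" using ij by (cases l; cases t) auto
  ultimately show "e \<in> strand_edge ` strands X L" by blast
qed

definition position :: "nat \<times> nat \<Rightarrow> crossing \<times> vertex" where
  "position = (\<lambda>(a, b). if odd a then (HO, coset (int (a div 2), int b))
     else (if even b then OV else HV, coset (int (a div 2), int (b div 2))))"

text \<open>Halving the second component forgets the refinement that orders the edges at a
  vertex.\<close>

definition cell :: "nat \<times> nat \<Rightarrow> nat \<times> nat" where
  "cell = (\<lambda>(a, b). (a, b div 2))"

definition cells :: "(nat \<times> nat) set" where
  "cells = {(a, b). a < 2 * X \<and> (if odd a then b < Y else b < L)}"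

lemma position_inj: "inj_on position cells"
proof (rule inj_onI)
  fix x y assume xy: "x \<in> cells" "y \<in> cells" "position x = position y"
  obtain a b a' b' where ab: "x = (a, b)" "y = (a', b')" by (cases x, cases y)
  have half: "z div 2 < n" if "z < 2 * n" for z n :: nat using that by auto
  show "x = y"
    using xy unfolding ab
    by (auto simp: cells_def position_def coset_inject half intro: parity_div_eq split: if_splits)
qed

lemma source_strand:
  assumes "s \<in> strands X L"
  shows "source (strand_edge s) = position (cell (strand_source s))" "cell (strand_source s) \<in> cells"
  using assms by (cases s; auto simp: position_def cell_def cells_def)+

lemma target_strand:
  assumes "s \<in> strands X L"
  shows "target (strand_edge s) = position (cell (tgt s))" "cell (tgt s) \<in> cells"
proof -
  have "target (strand_edge s) = position (cell (tgt s)) \<and> cell (tgt s) \<in> cells"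
  proof (cases s)
    case (Vert i y)
    show ?thesis
    proof (cases "even y")
      case True
      then have "Suc y < L" using assms Vert by auto
      then show ?thesis using True assms Vert by (auto simp: position_def cell_def cells_def)
    next
      case False
      then obtain j where y: "y = 2 * j + 1" by (auto elim: oddE)
      have "Suc y mod L = 2 * (Suc j mod Y)" unfolding y using mult_mod_right[of 2 "Suc j" Y] by simp
      moreover have "coset (int i, 1 + int j) = coset (int i, int (Suc j mod Y))"
        by (subst coset_shift_row) (simp add: zmod_int)
      ultimately show ?thesis
        using assms Vert XY by (simp add: y position_def cell_def cells_def shift_coset)
    qed
  next
    case (Inn i y)
    then show ?thesis using assms by (auto simp: position_def cell_def cells_def)
  next
    case (Out i y)
    have mod2: "(2 * z + 1) mod L = 2 * (z mod Y) + 1" "(2 * z) mod L = 2 * (z mod Y)" for z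
      by (simp_all add: mod_mult2_eq)
    have odd_less: "Suc (2 * (z mod Y)) < L" for z
      using mod_less_divisor[OF XY(2), of z] by linarith
    obtain j where y: "y = 2 * j \<or> y = 2 * j + 1" using evenE oddE by metis
    show ?thesis
    proof (cases "Suc i < X")
      case True
      have row: "coset (1 + int i, 1 + int j) = coset (1 + int i, int (Suc j mod Y))"
        by (subst coset_shift_row) (simp add: zmod_int)
      show ?thesis
        using y
      proof
        assume "y = 2 * j"
        moreover from this have "j < Y" using assms Out by simp
        ultimately show ?thesis using assms Out True mod2(1)[of j]
          by (simp add: position_def cell_def cells_def shift_coset out_pos_def)
      next
        assume "y = 2 * j + 1"
        then show ?thesis using assms Out True mod2(2)[of "Suc j"] XY row
          by (simp add: position_def cell_def cells_def shift_coset out_pos_def)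
      qed
    next
      case False
      then have i: "1 + int i = int X" using assms Out by simp
      have row: "coset (1 + int i, int z) = coset (0, int ((z + \<rho>) mod Y))" for z
        unfolding i coset_shift_column by (subst coset_shift_row) (simp add: zmod_int)
      show ?thesis
        using y
      proof
        assume "y = 2 * j"
        then show ?thesis using assms Out False mod2(1)[of "j + \<rho>"] XY row[of j]
          by (simp add: odd_less position_def cell_def cells_def shift_coset out_pos_def)
      next
        assume "y = 2 * j + 1"
        then show ?thesis using assms Out False mod2(2)[of "Suc j + \<rho>"] XY row[of "Suc j"]
          by (simp add: position_def cell_def cells_def shift_coset out_pos_def)
      qed
    qed
  qed
  then show "target (strand_edge s) = position (cell (tgt s))" "cell (tgt s) \<in> cells" by auto
qed

lemma strand_edge_out:
  assumes "s \<in> strands X L"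
  shows "strand_edge s = (if even (snd (strand_source s)) then out1 else out2) (source (strand_edge s))"
  using assms by (cases s) auto

text \<open>Even values belong to \<open>in2\<close> here but to \<open>out1\<close> on the source
  side: turning paths lead from \<open>in2\<close> to \<open>out1\<close>, so the order at a double
  vertex is preserved.\<close>

lemma strand_edge_in:
  assumes "s \<in> strands X L"
  shows "strand_edge s = (if even (snd (tgt s)) then in2 else in1) (target (strand_edge s))"
proof (cases s)
  case (Vert i y)
  then show ?thesis by (auto simp: shift_shift shift_zero)
next
  case (Inn i y)
  then show ?thesis by auto
next
  case (Out i y)
  then show ?thesis by (auto simp: shift_shift shift_zero)
qed

end

section \<open>Homology class and sign of a configuration\<close>

text \<open>Displacements in half lattice steps, matching the half-integer exponents in
  \<open>arrow_weight\<close>.\<close>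

fun half_steps_x :: "strand \<Rightarrow> nat" where
  "half_steps_x (Vert i y) = 0"
| "half_steps_x (Inn i y) = 1"
| "half_steps_x (Out i y) = 1"

fun half_steps_y :: "strand \<Rightarrow> nat" where
  "half_steps_y (Vert i y) = 1"
| "half_steps_y (Inn i y) = of_bool (even y)"
| "half_steps_y (Out i y) = of_bool (odd y)"

lemma powr_half_square:
  fixes u :: complex
  assumes "u \<noteq> 0"
  shows "(u powr (-1/2)) ^ (2 * n) = inverse u ^ n"
proof -
  have "(u powr (-1/2)) ^ 2 = u powr (-1/2 + -1/2)"
    unfolding power2_eq_square powr_add ..
  also have "\<dots> = inverse u" using assms by (simp add: powr_minus)
  finally show ?thesis by (simp add: power_mult)
qed

context hermite
begin

lemma arrow_weight_strand:
  "arrow_weight u w (strand_edge s) = (u powr (-1/2)) ^ half_steps_x s * (w powr (-1/2)) ^ half_steps_y s"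
  by (cases s) auto

text \<open>For a balanced configuration \<open>winding_x\<close> and \<open>winding_y\<close> are
  the coordinates of the homology class in the basis (X, -\<rho>), (0, Y), obtained as intersection
  numbers with the two seams.\<close>

definition winding_x :: "strand set \<Rightarrow> nat" where
  "winding_x D = card {y. Out (X - 1) y \<in> D}"

definition winding_y :: "strand set \<Rightarrow> nat" where
  "winding_y D = (\<Sum>i<X. of_bool (Vert i (L - 1) \<in> D) + (\<Sum>y | Out i y \<in> D. out_pos X L (Suc (2 * \<rho>)) i y div L))"

context
  fixes C :: "edge set" and D :: "strand set"
  assumes C: "C \<subseteq> edges \<Lambda>" and bal: "balanced C"
  defines "D \<equiv> {s \<in> strands X L. strand_edge s \<in> C}"
begin

lemma D_strands: "D \<subseteq> strands X L"
  by (auto simp: D_def)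

lemma finite_C: "finite C"
  by (rule finite_subset[OF C finite_edges])

lemma D_bij: "bij_betw strand_edge D C"
proof -
  have "strand_edge ` D = C"
  proof (intro equalityI subsetI)
    fix e assume "e \<in> C"
    then have "e \<in> strand_edge ` strands X L"
      using C strand_edge_bij by (auto simp: bij_betw_def)
    then show "e \<in> strand_edge ` D" using \<open>e \<in> C\<close> by (auto simp: D_def)
  qed (auto simp: D_def)
  moreover have "inj_on strand_edge D"
    by (rule inj_on_subset[OF bij_betw_imp_inj_on[OF strand_edge_bij] D_strands])
  ultimately show ?thesis by (simp add: bij_betw_def)
qed

lemma finite_D: "finite D"
  using bij_betw_finite[OF D_bij] finite_C by simp

lemma balanced_strands:
  fixes F :: "nat \<times> nat \<Rightarrow> 'b :: comm_monoid_add"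
  shows "(\<Sum>s\<in>D. F (cell (tgt s))) = (\<Sum>s\<in>D. F (cell (strand_source s)))"
proof -
  let ?G = "\<lambda>v. F (inv_into cells position v)"
  have "(\<Sum>s\<in>D. ?G (target (strand_edge s))) = (\<Sum>s\<in>D. ?G (source (strand_edge s)))"
    using balanced_sum[OF finite_C bal, of ?G]
      sum.reindex_bij_betw[OF D_bij, of "\<lambda>e. ?G (target e)"]
      sum.reindex_bij_betw[OF D_bij, of "\<lambda>e. ?G (source e)"] by simp
  moreover have "?G (target (strand_edge s)) = F (cell (tgt s))"
    "?G (source (strand_edge s)) = F (cell (strand_source s))" if "s \<in> D" for s
    using that D_strands by (auto simp: target_strand source_strand inv_into_f_f[OF position_inj])
  ultimately show ?thesis by simp
qed

lemma even_column_flow: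
  assumes i: "i < X" and y: "y < L"
  shows "of_bool (Inn i y \<in> D) + of_bool (Vert i y \<in> D) =
      (of_bool (Vert i ((y + L - 1) mod L) \<in> D) +
       of_bool (\<exists>z. Out (if i = 0 then X - 1 else i - 1) z \<in> D \<and>
         out_pos X L (Suc (2 * \<rho>)) (if i = 0 then X - 1 else i - 1) z mod L = y) :: nat)"
proof -
  define pr where "pr = (if i = 0 then X - 1 else i - 1)"
  define Z where "Z = {z. Out pr z \<in> D \<and> out_pos X L (Suc (2 * \<rho>)) pr z mod L = y}"
  have "card {s \<in> D. cell (strand_source s) = (2 * i, y)} = card {s \<in> D. cell (tgt s) = (2 * i, y)}"
    using balanced_strands[of "\<lambda>k. of_bool (k = (2 * i, y)) :: nat"]
    by (simp only: card_eq_sum_of_bool[OF finite_D])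
  moreover have "{s \<in> D. cell (strand_source s) = (2 * i, y)} =
      (if Inn i y \<in> D then {Inn i y} else {}) \<union> (if Vert i y \<in> D then {Vert i y} else {})"
  proof -
    have "cell (strand_source s) = (2 * i, y) \<longleftrightarrow> s = Inn i y \<or> s = Vert i y" for s
      by (cases s) (auto simp: cell_def double_simps)
    then show ?thesis by auto
  qed
  moreover have "{s \<in> D. cell (tgt s) = (2 * i, y)} =
      (if Vert i ((y + L - 1) mod L) \<in> D then {Vert i ((y + L - 1) mod L)} else {}) \<union> Out pr ` Z"
  proof -
    have iff: "cell (tgt s) = (2 * i, y) \<longleftrightarrow> s = Vert i ((y + L - 1) mod L) \<or>
        (\<exists>z. s = Out pr z \<and> out_pos X L (Suc (2 * \<rho>)) pr z mod L = y)" if s: "s \<in> strands X L" for s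
    proof (cases s)
      case (Vert i' y')
      then have "y' < L" using s by simp
      then have "Suc y' mod L = y \<longleftrightarrow> y' = (y + L - 1) mod L"
        using y by (cases y) (auto simp: mod_Suc)
      then show ?thesis using Vert by (auto simp: cell_def)
    next
      case (Inn i' y')
      then show ?thesis by (simp add: cell_def double_simps)
    next
      case (Out i' y')
      then have "i' = X - 1" if "\<not> Suc i' < X" using that s by simp arith
      moreover have "i - 1 = i'" if "i = Suc i'" using that by simp
      ultimately show ?thesis using Out s i
        by (cases "Suc i' < X") (auto simp: cell_def double_simps pr_def)
    qed
    have "{s \<in> D. cell (tgt s) = (2 * i, y)} = {s \<in> D. s = Vert i ((y + L - 1) mod L) \<or>
        (\<exists>z. s = Out pr z \<and> out_pos X L (Suc (2 * \<rho>)) pr z mod L = y)}"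
    proof (rule Collect_cong)
      fix s
      show "s \<in> D \<and> cell (tgt s) = (2 * i, y) \<longleftrightarrow> s \<in> D \<and> (s = Vert i ((y + L - 1) mod L) \<or>
          (\<exists>z. s = Out pr z \<and> out_pos X L (Suc (2 * \<rho>)) pr z mod L = y))"
        using iff[of s] subsetD[OF D_strands, of s] by argo
    qed
    also have "\<dots> = (if Vert i ((y + L - 1) mod L) \<in> D then {Vert i ((y + L - 1) mod L)} else {}) \<union> Out pr ` Z"
      by (auto simp: Z_def)
    finally show ?thesis .
  qed
  \<comment> \<open>At most one \<open>Out\<close> edge of a layer ends at a given height, because
    shifting is injective modulo \<open>L\<close>; so the existence statement counts these
    edges.\<close>
  moreover have "card (Out pr ` Z) = of_bool (Z \<noteq> {})"
  proof (cases "Z = {}")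
    case False
    then obtain z where z: "z \<in> Z" by blast
    have "z' = z" if z': "z' \<in> Z" for z'
    proof (rule add_mod_inj)
      show "(z' + (if Suc pr < X then 1 else Suc (2 * \<rho>))) mod L = (z + (if Suc pr < X then 1 else Suc (2 * \<rho>))) mod L"
        using z z' by (simp add: Z_def out_pos_def)
      show "z' < L" "z < L" using z z' D_strands by (auto simp: Z_def)
    qed
    then have "Z = {z}" using z by blast
    then show ?thesis by simp
  qed simp
  moreover have "finite Z"
    by (rule finite_subset[of _ "{..<L}"]) (use D_strands in \<open>auto simp: Z_def\<close>)
  then have "card ((if Vert i ((y + L - 1) mod L) \<in> D then {Vert i ((y + L - 1) mod L)} else {}) \<union> Out pr ` Z) = of_bool (Vert i ((y + L - 1) mod L) \<in> D) + card (Out pr ` Z)"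
    by (subst card_Un_disjoint) auto
  moreover have "card ((if Inn i y \<in> D then {Inn i y} else {}) \<union> (if Vert i y \<in> D then {Vert i y} else {})) =
      of_bool (Inn i y \<in> D) + of_bool (Vert i y \<in> D)"
    by simp
  moreover have "(\<exists>z. Out pr z \<in> D \<and> out_pos X L (Suc (2 * \<rho>)) pr z mod L = y) \<longleftrightarrow> Z \<noteq> {}"
    by (auto simp: Z_def)
  ultimately show ?thesis
    unfolding pr_def[symmetric] by (simp only:)
qed

lemma odd_column_flow: "card {y. Inn i y \<in> D} = card {y. Out i y \<in> D}"
proof -
  have "card {s \<in> D. fst (cell (tgt s)) = 2 * i + 1} = card {s \<in> D. fst (cell (strand_source s)) = 2 * i + 1}"
    using balanced_strands[of "\<lambda>k. of_bool (fst k = 2 * i + 1) :: nat"]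
    by (simp only: card_eq_sum_of_bool[OF finite_D])
  moreover have "{s \<in> D. fst (cell (tgt s)) = 2 * i + 1} = Inn i ` {y. Inn i y \<in> D}"
  proof -
    have "fst (cell (tgt s)) = 2 * i + 1 \<longleftrightarrow> (\<exists>y. s = Inn i y)" for s
      by (cases s) (auto simp: cell_def double_simps)
    then show ?thesis by auto
  qed
  moreover have "{s \<in> D. fst (cell (strand_source s)) = 2 * i + 1} = Out i ` {y. Out i y \<in> D}"
  proof -
    have "fst (cell (strand_source s)) = 2 * i + 1 \<longleftrightarrow> (\<exists>y. s = Out i y)" for s
      by (cases s) (auto simp: cell_def double_simps)
    then show ?thesis by auto
  qed
  ultimately show ?thesis by (simp add: card_image inj_on_def)
qed

text \<open>\<open>prev_edge\<close> carries the source order to the target order: a predecessor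
  ends at the vertex where its edge starts, so distinct vertices keep their order, and two edges
  with a common source form a double vertex, where the refined heights follow the turns.\<close>

lemma sign_prev_edge:
  "sign (prev_edge C) = (-1) ^ card (discordant (\<lambda>e e'. lex_less (tgt e) (tgt e'))
      (\<lambda>e e'. lex_less (strand_source e) (strand_source e')) D)"
proof -
  let ?f = "inv_into D strand_edge"
  let ?a = "\<lambda>e e'. lex_less (strand_source (?f e)) (strand_source (?f e'))"
  let ?b = "\<lambda>e e'. lex_less (tgt (?f e)) (tgt (?f e'))"
  have f: "?f e \<in> D" "strand_edge (?f e) = e" if "e \<in> C" for e
    using that D_bij by (auto simp: bij_betw_def inv_into_into f_inv_into_f)
  have f': "?f (strand_edge s) = s" if "s \<in> D" for s
    using that D_bij by (auto simp: bij_betw_def inv_into_f_f)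
  have tour: "tournament C (\<lambda>e e'. lex_less (K (?f e)) (K (?f e')))" if "inj_on K D" for K
  proof (rule tournamentI)
    fix x y assume xy: "x \<in> C" "y \<in> C" "x \<noteq> y"
    then have "K (?f x) \<noteq> K (?f y)"
      using inj_on_eq_iff[OF that f(1)[OF xy(1)] f(1)[OF xy(2)]] f(2) by metis
    then show "lex_less (K (?f x)) (K (?f y)) \<longleftrightarrow> \<not> lex_less (K (?f y)) (K (?f x))"
      unfolding lex_less_def prod_eq_iff by linarith
  qed (simp add: lex_less_def)
  have src_inj: "inj_on strand_source D"
  proof (rule inj_onI)
    fix s t assume st: "s \<in> D" "t \<in> D" "strand_source s = strand_source t"
    then have mem: "s \<in> strands X L" "t \<in> strands X L" using D_strands by auto
    then have "source (strand_edge s) = source (strand_edge t)"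
      using source_strand(1)[OF mem(1)] source_strand(1)[OF mem(2)] st(3) by simp
    then have "strand_edge s = strand_edge t"
      using st(3) strand_edge_out[OF mem(1)] strand_edge_out[OF mem(2)] by simp
    then show "s = t" using st f' by metis
  qed
  have tgt_inj: "inj_on tgt D"
  proof (rule inj_onI)
    fix s t assume st: "s \<in> D" "t \<in> D" "tgt s = tgt t"
    then have mem: "s \<in> strands X L" "t \<in> strands X L" using D_strands by auto
    then have "target (strand_edge s) = target (strand_edge t)"
      using target_strand(1)[OF mem(1)] target_strand(1)[OF mem(2)] st(3) by simp
    then have "strand_edge s = strand_edge t"
      using st(3) strand_edge_in[OF mem(1)] strand_edge_in[OF mem(2)] by simp
    then show "s = t" using st f' by metis
  qed
  have "sign (prev_edge C) = (-1) ^ card (discordant ?a ?b C)"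
  proof (rule sign_eq_discordant[OF finite_C prev_edge_permutes[OF finite_C bal]])
    show "tournament C ?a" "tournament C ?b"
      using tour[OF src_inj] tour[OF tgt_inj] by simp_all
    fix x y assume xy: "x \<in> C" "y \<in> C" "?a x y"
    define s s' t t' where "s = ?f x" and "s' = ?f y" and "t = ?f (prev_edge C x)" and "t' = ?f (prev_edge C y)"
    have mem: "prev_edge C x \<in> C" "prev_edge C y \<in> C" using xy prev_edge_mem[OF bal] by auto
    have st: "s \<in> strands X L" "s' \<in> strands X L" "t \<in> strands X L" "t' \<in> strands X L"
      using f(1)[OF xy(1)] f(1)[OF xy(2)] f(1)[OF mem(1)] f(1)[OF mem(2)] D_strands
      by (auto simp: s_def s'_def t_def t'_def)
    have edge: "strand_edge s = x" "strand_edge s' = y" "strand_edge t = prev_edge C x" "strand_edge t' = prev_edge C y"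
      using f(2) xy mem by (simp_all add: s_def s'_def t_def t'_def)
    have cell_eq: "cell (tgt t) = cell (strand_source s)" "cell (tgt t') = cell (strand_source s')"
      using inj_onD[OF position_inj] target_strand[OF st(3)] source_strand[OF st(1)]
        target_strand[OF st(4)] source_strand[OF st(2)] target_prev_edge[OF xy(1)] target_prev_edge[OF xy(2)]
      by (simp_all add: edge)
    have less: "lex_less (strand_source s) (strand_source s')" using xy(3) by (simp add: s_def s'_def)
    obtain a b a' b' where ab: "strand_source s = (a, b)" "strand_source s' = (a', b')" by fastforce
    obtain c d c' d' where cd: "tgt t = (c, d)" "tgt t' = (c', d')" by fastforce
    have eqs: "c = a" "c' = a'" "d div 2 = b div 2" "d' div 2 = b' div 2"
      using cell_eq by (auto simp: ab cd cell_def)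
    show "?b (prev_edge C x) (prev_edge C y)"
    proof (cases "a = a' \<and> b div 2 = b' div 2")
      case False
      have "b div 2 < b' div 2" if "a = a'"
      proof -
        have "b < b'" using less that by (simp add: ab lex_less_def)
        then have "b div 2 \<le> b' div 2" by (simp add: div_le_mono)
        then show ?thesis using False that by simp
      qed
      then have "d < d'" if "a = a'" using that eqs by (metis div_le_mono not_le)
      then have "lex_less (tgt t) (tgt t')"
        using less eqs by (auto simp: ab cd lex_less_def)
      then show ?thesis by (simp add: t_def t'_def)
    next
      case True
      then have src_eq: "source x = source y"
        using source_strand(1)[OF st(1)] source_strand(1)[OF st(2)] by (simp add: edge ab cell_def)
      have "b < b'" using less True by (simp add: ab lex_less_def)
      then have par: "even b" "odd b'" using True by presburger+
      define v where "v = source x"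
      have x: "x = out1 v" and y: "y = out2 v"
        using strand_edge_out[OF st(1)] strand_edge_out[OF st(2)] par src_eq
        by (simp_all only: edge ab snd_conv if_True if_False v_def)
      then have mem: "out1 v \<in> C" "out2 v \<in> C" using xy by simp_all
      then have prev: "prev_edge C x = in2 v" "prev_edge C y = in1 v"
        unfolding x y using out_edges_neq[of v] by (simp_all add: prev_edge_def)
      have "even d"
        using strand_edge_in[OF st(3)] in_edges_neq[of v]
        by (auto simp: edge(3) prev cd split: if_splits)
      moreover have "odd d'"
        using strand_edge_in[OF st(4)] in_edges_neq[of v]
        by (auto simp: edge(4) prev cd split: if_splits)
      ultimately have "d = 2 * (d div 2)" "d' = 2 * (d' div 2) + 1" by simp_all
      then have "d < d'" using eqs(3,4) True by linarith
      then have "lex_less (tgt t) (tgt t')" using eqs True by (simp add: cd lex_less_def)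
      then show ?thesis by (simp add: t_def t'_def)
    qed
  qed
  also have "card (discordant ?a ?b C) = card (discordant ?b ?a C)"
    by (rule card_discordant_swap)
  also have "\<dots> = card (discordant (\<lambda>e e'. lex_less (tgt e) (tgt e'))
      (\<lambda>e e'. lex_less (strand_source e) (strand_source e')) D)"
    by (rule card_discordant_reindex[OF bij_betw_inv_into[OF D_bij]])
  finally show ?thesis .
qed

lemma half_steps_x_sum: "(\<Sum>s\<in>D. half_steps_x s) = 2 * (X * winding_x D)"
proof -
  \<comment> \<open>The column number rises by the half steps, except that a closing edge falls from
    column \<open>2 * X - 1\<close> to 0; the rises and falls telescope.\<close>
  let ?n = "\<lambda>s. if \<exists>y. s = Out (X - 1) y then 2 * int X else 0"
  have "int (half_steps_x s) = int (fst (cell (tgt s))) - int (fst (cell (strand_source s))) + ?n s"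
    if "s \<in> D" for s
  proof (cases s)
    case (Out i y)
    then have "i < X" using that D_strands by auto
    then show ?thesis using Out XY by (cases "i = X - 1") (auto simp: cell_def)
  qed (auto simp: cell_def)
  then have "(\<Sum>s\<in>D. int (half_steps_x s)) =
      (\<Sum>s\<in>D. int (fst (cell (tgt s)))) - (\<Sum>s\<in>D. int (fst (cell (strand_source s)))) + (\<Sum>s\<in>D. ?n s)"
    by (simp add: sum.distrib sum_subtractf)
  also have "\<dots> = (\<Sum>s\<in>D. ?n s)"
    using balanced_strands[of "\<lambda>k. int (fst k)"] by simp
  also have "\<dots> = (\<Sum>s | s \<in> D \<and> (\<exists>y. s = Out (X - 1) y). 2 * int X)"
    by (rule sum.inter_filter[OF finite_D, symmetric])
  also have "{s. s \<in> D \<and> (\<exists>y. s = Out (X - 1) y)} = Out (X - 1) ` {y. Out (X - 1) y \<in> D}"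
    by auto
  finally have "int (\<Sum>s\<in>D. half_steps_x s) = int (2 * (X * winding_x D))"
    by (simp add: winding_x_def card_image inj_on_def)
  then show ?thesis by (simp only: of_nat_eq_iff)
qed

lemma half_steps_y_sum: "int (\<Sum>s\<in>D. half_steps_y s) = 2 * (int Y * winding_y D - int \<rho> * winding_x D)"
proof -
  \<comment> \<open>\<open>?F\<close> is the height in half steps, with \<open>HO\<close> level with
    \<open>HV\<close>. \<open>wrap\<close> restores the multiples of \<open>L\<close> lost at the
    height seam, and \<open>?n\<close> removes the lattice shift added when an edge closes up
    horizontally.\<close>
  let ?F = "\<lambda>(a, b). if even a then int b else 2 * int b + 1"
  define wrap where "wrap s = (case s of Vert i y \<Rightarrow> of_bool (y = L - 1) | Inn i y \<Rightarrow> 0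
    | Out i y \<Rightarrow> out_pos X L (Suc (2 * \<rho>)) i y div L)" for s
  let ?n = "\<lambda>s. if \<exists>y. s = Out (X - 1) y then 2 * int \<rho> else 0"
  have step: "int (half_steps_y s) = ?F (cell (tgt s)) - ?F (cell (strand_source s)) + int L * int (wrap s) - ?n s"
    if "s \<in> D" for s
  proof (cases s)
    case (Vert i y)
    then have "y < L" using that D_strands by auto
    then show ?thesis using Vert by (auto simp: cell_def wrap_def mod_Suc)
  next
    case (Inn i y)
    then show ?thesis by (auto simp: cell_def wrap_def elim!: evenE oddE)
  next
    case (Out i y)
    have "int (out_pos X L (Suc (2 * \<rho>)) i y mod L) + int L * int (out_pos X L (Suc (2 * \<rho>)) i y div L) =
        int (out_pos X L (Suc (2 * \<rho>)) i y)"
      by (metis mod_mult_div_eq of_nat_add of_nat_mult)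
    moreover have "int y = 2 * int (y div 2) + int (of_bool (odd y))"
      by (cases "even y") (auto elim!: evenE oddE)
    moreover have "i < X" using Out that D_strands by auto
    ultimately show ?thesis
      using Out by (auto simp: cell_def wrap_def out_pos_def)
  qed
  have "(\<Sum>s\<in>D. int (half_steps_y s)) =
      (\<Sum>s\<in>D. ?F (cell (tgt s))) - (\<Sum>s\<in>D. ?F (cell (strand_source s))) +
      int L * (\<Sum>s\<in>D. int (wrap s)) - (\<Sum>s\<in>D. ?n s)"
    using step by (simp add: sum.distrib sum_subtractf sum_distrib_left)
  also have "(\<Sum>s\<in>D. ?F (cell (tgt s))) = (\<Sum>s\<in>D. ?F (cell (strand_source s)))"
    by (rule balanced_strands)
  also have "(\<Sum>s\<in>D. ?n s) = (\<Sum>s | s \<in> D \<and> (\<exists>y. s = Out (X - 1) y). 2 * int \<rho>)"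
    by (rule sum.inter_filter[OF finite_D, symmetric])
  also have "{s. s \<in> D \<and> (\<exists>y. s = Out (X - 1) y)} = Out (X - 1) ` {y. Out (X - 1) y \<in> D}"
    by auto
  also have "(\<Sum>s\<in>D. int (wrap s)) = int (\<Sum>s\<in>D. wrap s)" by simp
  also have "(\<Sum>s\<in>D. wrap s) = winding_y D"
    unfolding sum_strands[OF D_strands] winding_y_def
  proof (intro sum.cong refl)
    fix i
    have "finite {y. Vert i y \<in> D}"
      by (rule finite_subset[of _ "{..<L}"]) (use D_strands in auto)
    then have "(\<Sum>y | Vert i y \<in> D. wrap (Vert i y)) = of_bool (Vert i (L - 1) \<in> D)"
      by (simp add: wrap_def of_bool_def)
    then show "(\<Sum>y | Vert i y \<in> D. wrap (Vert i y)) + (\<Sum>y | Inn i y \<in> D. wrap (Inn i y)) +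
        (\<Sum>y | Out i y \<in> D. wrap (Out i y)) =
      of_bool (Vert i (L - 1) \<in> D) + (\<Sum>y | Out i y \<in> D. out_pos X L (Suc (2 * \<rho>)) i y div L)"
      by (simp add: wrap_def)
  qed
  finally show ?thesis
    by (simp add: winding_x_def card_image inj_on_def algebra_simps)
qed

text \<open>For windings k and m the exponent is congruent to k + (k + 1) m, hence to (k + 1) (m +
  1) + 1, which is even exactly if k and m are.\<close>

lemma balanced_parity:
  "(-1) ^ card C * sign (prev_edge C) = (if even (winding_x D) \<and> even (winding_y D) then 1 else -1)"
proof -
  let ?K = "card (discordant (\<lambda>e e'. lex_less (tgt e) (tgt e'))
      (\<lambda>e e'. lex_less (strand_source e) (strand_source e')) D)"
  have "even (?K + card D + winding_x D + (winding_x D + 1) * winding_y D)"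
    unfolding winding_x_def winding_y_def
    by (rule strands_discordant_even[OF D_strands XY(1) _ _ even_column_flow odd_column_flow]) (use XY in auto)
  then have "even (card C + ?K) \<longleftrightarrow> even (winding_x D) \<and> even (winding_y D)"
    unfolding bij_betw_same_card[OF D_bij] by auto
  then show ?thesis
    unfolding sign_prev_edge power_add[symmetric] by (simp add: minus_one_power_iff)
qed

lemma balanced_monomial:
  assumes "u \<noteq> 0" "w \<noteq> 0"
  shows "(\<Prod>e\<in>C. arrow_weight u w e) =
    cycle_monomial (int (X * winding_x D), int Y * winding_y D - int \<rho> * winding_x D) u w"
proof -
  let ?h = "int Y * winding_y D - int \<rho> * winding_x D"
  \<comment> \<open>Twice \<open>?h\<close> is a number of half steps, so \<open>?h\<close> can
    serve as a natural exponent.\<close>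
  have "0 \<le> 2 * ?h"
    unfolding half_steps_y_sum[symmetric] by (rule of_nat_0_le_iff)
  then have h: "?h \<ge> 0" by simp
  have "int (\<Sum>s\<in>D. half_steps_y s) = int (2 * nat ?h)"
    unfolding half_steps_y_sum using h by simp
  then have y: "(\<Sum>s\<in>D. half_steps_y s) = 2 * nat ?h"
    by (simp only: of_nat_eq_iff)
  have "(\<Prod>e\<in>C. arrow_weight u w e) = (\<Prod>s\<in>D. (u powr (-1/2)) ^ half_steps_x s * (w powr (-1/2)) ^ half_steps_y s)"
    unfolding arrow_weight_strand[symmetric] by (rule prod.reindex_bij_betw[OF D_bij, symmetric])
  also have "\<dots> = (u powr (-1/2)) ^ (\<Sum>s\<in>D. half_steps_x s) * (w powr (-1/2)) ^ (\<Sum>s\<in>D. half_steps_y s)"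
    by (simp add: prod.distrib power_sum)
  also have "\<dots> = inverse u ^ (X * winding_x D) * inverse w ^ nat ?h"
    unfolding half_steps_x_sum y powr_half_square[OF assms(1)] powr_half_square[OF assms(2)] ..
  also have "\<dots> = u powi (- int (X * winding_x D)) * w powi (- ?h)"
  proof -
    have powi: "z powi (- int n) = inverse z ^ n" for z :: complex and n
      by (simp add: power_int_minus power_inverse)
    show ?thesis
      unfolding powi powi[of w "nat ?h", unfolded nat_0_le[OF h]] ..
  qed
  finally show ?thesis
    by (simp add: cycle_monomial_def)
qed

end

end

context sublattice
begin

text \<open>Membership in 2 \<Lambda> expresses the parity of both windings independently of the
  Hermite basis, so that it can be reread in any other basis.\<close>

lemma balanced_homology:
  assumes "C \<subseteq> edges \<Lambda>" "balanced C"
  obtains h where "h \<in> \<Lambda>"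
    "\<And>u w. u \<noteq> 0 \<Longrightarrow> w \<noteq> 0 \<Longrightarrow> (\<Prod>e\<in>C. arrow_weight u w e) = cycle_monomial h u w"
    "(-1) ^ card C * sign (prev_edge C) = (if \<exists>g\<in>\<Lambda>. h = g + g then 1 else -1)"
proof -
  obtain X Y \<rho> where "hermite \<Lambda> X Y \<rho>" by (rule obtain_hermite)
  then interpret hermite \<Lambda> X Y \<rho> .
  define D where "D = {s \<in> strands X (2 * Y). strand_edge s \<in> C}"
  define h where "h = (int (X * winding_x D), int Y * winding_y D - int \<rho> * winding_x D)"
  have "h \<in> \<Lambda>" unfolding h_def mem_iff by auto
  moreover have "(\<exists>g\<in>\<Lambda>. h = g + g) \<longleftrightarrow> even (winding_x D) \<and> even (winding_y D)"
  proof
    assume "\<exists>g\<in>\<Lambda>. h = g + g"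
    then obtain m n where mn: "h = (int X * m, int Y * n - int \<rho> * m) + (int X * m, int Y * n - int \<rho> * m)"
      by (metis mem_iff surj_pair)
    have "int X * int (winding_x D) = int X * (2 * m)" using mn by (simp add: h_def)
    then have k: "int (winding_x D) = 2 * m" using XY by simp
    have "int Y * int (winding_y D) = int Y * (2 * n)" using mn k by (simp add: h_def algebra_simps)
    then have "int (winding_y D) = 2 * n" using XY by simp
    with k show "even (winding_x D) \<and> even (winding_y D)" by presburger
  next
    assume "even (winding_x D) \<and> even (winding_y D)"
    then obtain k m where km: "winding_x D = 2 * k" "winding_y D = 2 * m" by (auto elim!: evenE)
    show "\<exists>g\<in>\<Lambda>. h = g + g"
    proof (rule bexI)
      show "h = (int X * int k, int Y * int m - int \<rho> * int k) + (int X * int k, int Y * int m - int \<rho> * int k)"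
        by (simp add: h_def km algebra_simps)
      show "(int X * int k, int Y * int m - int \<rho> * int k) \<in> \<Lambda>" unfolding mem_iff by blast
    qed
  qed
  ultimately show thesis
    using that[of h] balanced_monomial[OF assms, folded D_def h_def] balanced_parity[OF assms, folded D_def]
    by simp
qed

end

section \<open>The two generating functions\<close>

lemma powr_half_mult:
  fixes u :: complex
  assumes "u \<noteq> 0"
  shows "u powr (-1/2) * u powr (-1/2) = inverse u"
  using powr_half_square[OF assms, of 1] by (simp add: power2_eq_square)

text \<open>A potential on the vertices of a triangle moves the weight of an arrow from one half of an
  edge to the other; it cancels over balanced configurations.\<close>

fun potential :: "half \<Rightarrow> complex \<Rightarrow> complex \<Rightarrow> crossing \<Rightarrow> complex" where
  "potential Outer a b HO = 1"
| "potential Outer a b HV = a"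
| "potential Outer a b OV = a * b"
| "potential Inner a b HO = a * b"
| "potential Inner a b HV = b"
| "potential Inner a b OV = 1"

lemma prod_half_weight:
  assumes uw: "u \<noteq> 0" "w \<noteq> 0" and C: "finite C" "balanced C"
  shows "(\<Prod>e\<in>C. half_weight t u w e) = (\<Prod>e\<in>C. arrow_weight u w e)"
proof -
  let ?a = "u powr (-1/2)" and ?b = "w powr (-1/2)"
  let ?p = "\<lambda>v. potential t ?a ?b (fst v)"
  have inv: "inverse u = ?a * ?a" "inverse w = ?b * ?b"
    using powr_half_mult uw by simp_all
  have "half_weight t u w e * ?p (source e) = arrow_weight u w e * ?p (target e)" for e
    by (cases e rule: source.cases; cases t) (simp_all add: half_weight_def inv)
  then have "(\<Prod>e\<in>C. half_weight t u w e) * (\<Prod>e\<in>C. ?p (source e)) =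
      (\<Prod>e\<in>C. arrow_weight u w e) * (\<Prod>e\<in>C. ?p (target e))"
    unfolding prod.distrib[symmetric] by simp
  moreover have "(\<Prod>e\<in>C. ?p (target e)) = (\<Prod>e\<in>C. ?p (source e))"
    by (rule balanced_prod[OF C])
  moreover have "potential t ?a ?b c \<noteq> 0" for c
    using uw by (cases t; cases c) simp_all
  then have "(\<Prod>e\<in>C. ?p (source e)) \<noteq> 0" using C(1) by simp
  ultimately show ?thesis by simp
qed

section \<open>Monomials attached to basis cycles\<close>

lemma cycle_monomial_int_comb:
  assumes "u \<noteq> 0" "w \<noteq> 0"
  shows "cycle_monomial (int_comb \<alpha> \<beta> (m, n)) u w =
    cycle_monomial \<alpha> u w powi m * cycle_monomial \<beta> u w powi n"
proof -
  have "u powi (- (m * a + n * b)) = (u powi (- a)) powi m * (u powi (- b)) powi n"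
    if "u \<noteq> 0" for u :: complex and a b
    using that by (simp add: power_int_add[symmetric] power_int_mult[symmetric] algebra_simps)
  then show ?thesis
    using assms by (simp add: cycle_monomial_def int_comb_def power_int_mult_distrib)
qed

lemma cycle_monomial_surj:
  assumes "lattice_basis \<Lambda> \<alpha> \<beta>" "x \<noteq> 0" "y \<noteq> 0"
  obtains u w where "u \<noteq> 0" "w \<noteq> 0" "cycle_monomial \<alpha> u w = x" "cycle_monomial \<beta> u w = y"
proof -
  define d :: complex where "d = of_int (fst \<alpha> * snd \<beta> - snd \<alpha> * fst \<beta>)"
  have d: "d \<noteq> 0"
    using lattice_basis_det_nonzero[OF assms(1)] unfolding d_def of_int_eq_0_iff .
  \<comment> \<open>Cramer's rule for the logarithms U of u and V of w, the monomials being
    prescribed as x and y.\<close>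
  define U where "U = - (of_int (snd \<beta>) * Ln x - of_int (snd \<alpha>) * Ln y) / d"
  define V where "V = - (of_int (fst \<alpha>) * Ln y - of_int (fst \<beta>) * Ln x) / d"
  have mono: "cycle_monomial \<gamma> (exp U) (exp V) = exp (- (of_int (fst \<gamma>) * U + of_int (snd \<gamma>) * V))" for \<gamma>
    by (simp add: cycle_monomial_def exp_power_int exp_add[symmetric] algebra_simps)
  have UV: "- (a * U + b * V) = (a * (of_int (snd \<beta>) * Ln x - of_int (snd \<alpha>) * Ln y) +
      b * (of_int (fst \<alpha>) * Ln y - of_int (fst \<beta>) * Ln x)) / d" for a b
    by (simp add: U_def V_def add_divide_distrib diff_divide_distrib algebra_simps)
  have "- (of_int (fst \<alpha>) * U + of_int (snd \<alpha>) * V) = d * Ln x / d"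
    "- (of_int (fst \<beta>) * U + of_int (snd \<beta>) * V) = d * Ln y / d"
    unfolding UV by (simp_all add: d_def algebra_simps)
  then show thesis
    using that[of "exp U" "exp V"] d assms(2,3) by (simp add: mono)
qed

lemma in_cycle_variables_unique:
  assumes "lattice_basis \<Lambda> \<alpha> \<beta>" "in_cycle_variables \<alpha> \<beta> F g" "in_cycle_variables \<alpha> \<beta> G h"
    and "\<And>u w. u \<noteq> 0 \<Longrightarrow> w \<noteq> 0 \<Longrightarrow> F u w = G u w" and "x \<noteq> 0" "y \<noteq> 0"
  shows "g x y = h x y"
proof -
  obtain u w where uw: "u \<noteq> 0" "w \<noteq> 0" "cycle_monomial \<alpha> u w = x" "cycle_monomial \<beta> u w = y"
    using cycle_monomial_surj[OF assms(1,5,6)] .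
  have "F u w = g x y" "G u w = h x y"
    using assms(2,3) uw unfolding in_cycle_variables_def by metis+
  then show ?thesis using assms(4)[OF uw(1,2)] by simp
qed

lemma laurent_polynomial_sum:
  fixes a :: "'c \<Rightarrow> complex" and m n :: "'c \<Rightarrow> int"
  assumes "finite B"
  shows "laurent_polynomial (\<lambda>x y. \<Sum>C\<in>B. a C * x powi m C * y powi n C)"
  unfolding laurent_polynomial_def
proof (intro exI conjI allI impI)
  let ?k = "\<lambda>C. (m C, n C)"
  show "finite (?k ` B)" using assms by simp
  fix x y :: complex
  have "(\<Sum>C\<in>B. a C * x powi m C * y powi n C) =
      (\<Sum>k\<in>?k ` B. \<Sum>C | C \<in> B \<and> ?k C = k. a C * x powi m C * y powi n C)"
    by (rule sum.image_gen[OF assms])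
  also have "\<dots> = (\<Sum>k\<in>?k ` B. (\<Sum>C | C \<in> B \<and> ?k C = k. a C) * x powi fst k * y powi snd k)"
    by (intro sum.cong refl) (auto simp: sum_distrib_right)
  finally show "(\<Sum>C\<in>B. a C * x powi m C * y powi n C) =
      (\<Sum>(i, j)\<in>?k ` B. (\<lambda>k. \<Sum>C | C \<in> B \<and> ?k C = k. a C) (i, j) * x powi i * y powi j)"
    by (simp only: case_prod_unfold prod.collapse)
qed

context sublattice
begin

definition balanced_configs :: "edge set set" where
  "balanced_configs = {C. C \<subseteq> edges \<Lambda> \<and> balanced C}"

definition weight :: "matrix_family \<Rightarrow> edge set \<Rightarrow> complex" where
  "weight W C = (\<Prod>v\<in>UNIV \<times> vertices \<Lambda>. config_weight C W v)"

definition parity_sign :: "int \<times> int \<Rightarrow> complex" where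
  "parity_sign h = (if \<exists>g\<in>\<Lambda>. h = g + g then 1 else -1)"

lemma finite_balanced_configs: "finite balanced_configs"
  by (rule finite_subset[of _ "Pow (edges \<Lambda>)"]) (use finite_edges in \<open>auto simp: balanced_configs_def\<close>)

lemma source_target_mem:
  "source ` edges \<Lambda> \<subseteq> UNIV \<times> vertices \<Lambda>" "target ` edges \<Lambda> \<subseteq> UNIV \<times> vertices \<Lambda>"
proof -
  have "source e \<in> UNIV \<times> vertices \<Lambda> \<and> target e \<in> UNIV \<times> vertices \<Lambda>" if "e \<in> edges \<Lambda>" for e
    using that by (cases e rule: source.cases) (auto simp: edges_def)
  then show "source ` edges \<Lambda> \<subseteq> UNIV \<times> vertices \<Lambda>" "target ` edges \<Lambda> \<subseteq> UNIV \<times> vertices \<Lambda>"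
    by blast+
qed

lemma weight_unbalanced:
  assumes "C \<subseteq> edges \<Lambda>" "\<not> balanced C"
  shows "weight W C = 0"
proof -
  obtain v where v: "v \<in> source ` C \<union> target ` C" "\<not> balanced_at C v"
    using assms(2) unfolding balanced_def by blast
  then have "v \<in> UNIV \<times> vertices \<Lambda>" using assms(1) source_target_mem by blast
  then show ?thesis
    unfolding weight_def
    using finite_vertices config_weight_unbalanced[OF v(2)] by (intro prod_zero bexI[of _ v]) auto
qed

lemma homology_function:
  obtains h where "\<And>C. C \<in> balanced_configs \<Longrightarrow> h C \<in> \<Lambda>"
    "\<And>C u w. C \<in> balanced_configs \<Longrightarrow> u \<noteq> 0 \<Longrightarrow> w \<noteq> 0 \<Longrightarrow>
      (\<Prod>e\<in>C. arrow_weight u w e) = cycle_monomial (h C) u w"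
    "\<And>C. C \<in> balanced_configs \<Longrightarrow> (-1) ^ card C * of_int (sign (prev_edge C)) = parity_sign (h C)"
proof -
  have "\<forall>C\<in>balanced_configs. \<exists>h. h \<in> \<Lambda> \<and>
      (\<forall>u w. u \<noteq> 0 \<longrightarrow> w \<noteq> 0 \<longrightarrow> (\<Prod>e\<in>C. arrow_weight u w e) = cycle_monomial h u w) \<and>
      (-1) ^ card C * of_int (sign (prev_edge C)) = parity_sign h"
  proof
    fix C assume "C \<in> balanced_configs"
    then have C: "C \<subseteq> edges \<Lambda>" "balanced C" by (simp_all add: balanced_configs_def)
    obtain h where h: "h \<in> \<Lambda>"
      "\<And>u w. u \<noteq> 0 \<Longrightarrow> w \<noteq> 0 \<Longrightarrow> (\<Prod>e\<in>C. arrow_weight u w e) = cycle_monomial h u w"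
      "(-1) ^ card C * sign (prev_edge C) = (if \<exists>g\<in>\<Lambda>. h = g + g then 1 else -1)"
      by (rule balanced_homology[OF C]) (rule that)
    have "complex_of_int ((-1) ^ card C * sign (prev_edge C)) = parity_sign h"
      unfolding h(3) by (simp add: parity_sign_def)
    then show "\<exists>h. h \<in> \<Lambda> \<and>
      (\<forall>u w. u \<noteq> 0 \<longrightarrow> w \<noteq> 0 \<longrightarrow> (\<Prod>e\<in>C. arrow_weight u w e) = cycle_monomial h u w) \<and>
      (-1) ^ card C * of_int (sign (prev_edge C)) = parity_sign h"
      using h(1,2) by (intro exI[of _ h]) simp
  qed
  from bchoice[OF this] show thesis using that by blast
qed

lemma S_sum_eq: "S_sum \<Lambda> W u w = (\<Sum>C\<in>balanced_configs. weight W C * (\<Prod>e\<in>C. arrow_weight u w e))"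
proof -
  have "S_sum \<Lambda> W u w = (\<Sum>C\<in>Pow (edges \<Lambda>). weight W C * (\<Prod>e\<in>C. arrow_weight u w e))"
    unfolding S_sum_def
  proof (intro sum.cong refl arg_cong2[where f="(*)"])
    fix C assume "C \<in> Pow (edges \<Lambda>)"
    then show "(\<Prod>e\<in>edges \<Lambda>. if e \<in> C then arrow_weight u w e else 1) = (\<Prod>e\<in>C. arrow_weight u w e)"
      using finite_edges by (intro prod.mono_neutral_cong_right) auto
    show "(\<Prod>(c, p)\<in>UNIV \<times> vertices \<Lambda>. vertex_weight (W c p)
        (map_prod (arrow_in C (c, p)) (arrow_in C (c, p)) (crossing_lines c))
        (map_prod (arrow_out C (c, p)) (arrow_out C (c, p)) (crossing_lines c))) = weight W C"
      unfolding weight_def config_weight_eq[symmetric] by (simp add: case_prod_unfold)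
  qed
  also have "\<dots> = (\<Sum>C\<in>balanced_configs. weight W C * (\<Prod>e\<in>C. arrow_weight u w e))"
    using finite_edges
    by (intro sum.mono_neutral_right) (auto simp: balanced_configs_def weight_unbalanced)
  finally show ?thesis .
qed

text \<open>The right-hand side is free of \<open>t\<close>: weights on the outer edges, as for
  \<open>W\<close>, and on the inner edges, as after one evolution step, give the same
  determinant.\<close>

lemma det_on_kagome_eq:
  assumes "u \<noteq> 0" "w \<noteq> 0"
  shows "det_on (edges \<Lambda>) (\<lambda>i j. (if i = j then 1 else 0) - transfer W i j * half_weight t u w j) =
    (\<Sum>C\<in>balanced_configs. (-1) ^ card C * of_int (sign (prev_edge C)) * weight W C * (\<Prod>e\<in>C. arrow_weight u w e))"
proof -
  have "det_on (edges \<Lambda>) (\<lambda>i j. (if i = j then 1 else 0) - transfer W i j * half_weight t u w j) =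
    (\<Sum>C\<in>Pow (edges \<Lambda>). (-1) ^ card C * of_int (sign (prev_edge C)) * weight W C * (\<Prod>e\<in>C. half_weight t u w e))"
    unfolding weight_def
    by (rule det_on_kagome) (use finite_edges finite_vertices source_target_mem in auto)
  also have "\<dots> = (\<Sum>C\<in>balanced_configs. (-1) ^ card C * of_int (sign (prev_edge C)) * weight W C * (\<Prod>e\<in>C. half_weight t u w e))"
    using finite_edges
    by (intro sum.mono_neutral_right) (auto simp: balanced_configs_def weight_unbalanced)
  also have "\<dots> = (\<Sum>C\<in>balanced_configs. (-1) ^ card C * of_int (sign (prev_edge C)) * weight W C * (\<Prod>e\<in>C. arrow_weight u w e))"
    using finite_edges assms
    by (intro sum.cong refl) (auto simp: balanced_configs_def prod_half_weight finite_subset)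
  finally show ?thesis .
qed

lemma I_det_invariant:
  assumes "evolution_step \<Lambda> W W'" "u \<noteq> 0" "w \<noteq> 0"
  shows "I_det \<Lambda> W' u w = I_det \<Lambda> W u w"
  unfolding I_det_evolution_eq_kagome[OF assms(1)] I_det_eq_kagome[of W] det_on_kagome_eq[OF assms(2,3)] ..

text \<open>On a term with exponents m and n both formulas act as multiplication by half of -1 +
  (-1)^m + (-1)^n + (-1)^(m + n), which is 1 if m and n are even and -1 otherwise. This is the sign
  by which the terms of s and f differ, and it is its own inverse.\<close>

lemma cycle_variables_parity:
  assumes basis: "lattice_basis \<Lambda> \<alpha> \<beta>"
  obtains s f where "in_cycle_variables \<alpha> \<beta> (S_sum \<Lambda> W) s" "in_cycle_variables \<alpha> \<beta> (I_det \<Lambda> W) f"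
    "\<And>x y. s x y = 1/2 * (- f x y + f (- x) y + f x (- y) + f (- x) (- y))"
    "\<And>x y. f x y = 1/2 * (- s x y + s (- x) y + s x (- y) + s (- x) (- y))"
proof -
  obtain h where h: "\<And>C. C \<in> balanced_configs \<Longrightarrow> h C \<in> \<Lambda>"
    "\<And>C u w. C \<in> balanced_configs \<Longrightarrow> u \<noteq> 0 \<Longrightarrow> w \<noteq> 0 \<Longrightarrow>
      (\<Prod>e\<in>C. arrow_weight u w e) = cycle_monomial (h C) u w"
    "\<And>C. C \<in> balanced_configs \<Longrightarrow> (-1) ^ card C * of_int (sign (prev_edge C)) = parity_sign (h C)"
    by (rule homology_function) (rule that)
  have bij: "bij_betw (int_comb \<alpha> \<beta>) UNIV \<Lambda>" using basis by (simp add: lattice_basis_def)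
  define k where "k C = inv_into UNIV (int_comb \<alpha> \<beta>) (h C)" for C
  define m n where "m C = fst (k C)" and "n C = snd (k C)" for C
  have mn: "h C = int_comb \<alpha> \<beta> (m C, n C)" if "C \<in> balanced_configs" for C
    using bij h(1)[OF that] by (simp add: m_def n_def k_def bij_betw_def f_inv_into_f)
  have sgn: "parity_sign (h C) = (if even (m C) \<and> even (n C) then 1 else -1)" if "C \<in> balanced_configs" for C
  proof -
    have "(\<exists>g\<in>\<Lambda>. h C = g + g) \<longleftrightarrow> (\<exists>i j. int_comb \<alpha> \<beta> (m C, n C) = int_comb \<alpha> \<beta> (2 * i, 2 * j))"
    proof -
      have "int_comb \<alpha> \<beta> (2 * i, 2 * j) = int_comb \<alpha> \<beta> (i, j) + int_comb \<alpha> \<beta> (i, j)" for i j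
        by (simp add: int_comb_def algebra_simps)
      moreover have "\<Lambda> = range (int_comb \<alpha> \<beta>)" using bij by (simp add: bij_betw_def)
      ultimately show ?thesis unfolding mn[OF that] by auto
    qed
    also have "\<dots> \<longleftrightarrow> (\<exists>i j. m C = 2 * i \<and> n C = 2 * j)"
      using bij by (simp add: bij_betw_def inj_eq)
    also have "\<dots> \<longleftrightarrow> even (m C) \<and> even (n C)" by (auto simp: dvd_def)
    finally show ?thesis by (simp add: parity_sign_def)
  qed
  define q where "q C = (if even (m C) \<and> even (n C) then 1 else -1 :: complex)" for C
  define s where "s x y = (\<Sum>C\<in>balanced_configs. weight W C * x powi m C * y powi n C)" for x y
  define f where "f x y = (\<Sum>C\<in>balanced_configs. q C * weight W C * x powi m C * y powi n C)" for x y
  show thesis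
  proof (rule that)
    show "in_cycle_variables \<alpha> \<beta> (S_sum \<Lambda> W) s"
      unfolding in_cycle_variables_def
    proof (intro conjI allI impI)
      show "laurent_polynomial s"
        unfolding s_def using finite_balanced_configs by (rule laurent_polynomial_sum)
      fix u w :: complex assume "u \<noteq> 0" "w \<noteq> 0"
      then show "S_sum \<Lambda> W u w = s (cycle_monomial \<alpha> u w) (cycle_monomial \<beta> u w)"
        unfolding S_sum_eq s_def
        by (intro sum.cong refl) (simp add: h(2) mn cycle_monomial_int_comb mult.assoc)
    qed
    show "in_cycle_variables \<alpha> \<beta> (I_det \<Lambda> W) f"
      unfolding in_cycle_variables_def
    proof (intro conjI allI impI)
      show "laurent_polynomial f"
        unfolding f_def using finite_balanced_configs by (rule laurent_polynomial_sum)
      fix u w :: complex assume "u \<noteq> 0" "w \<noteq> 0"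
      then show "I_det \<Lambda> W u w = f (cycle_monomial \<alpha> u w) (cycle_monomial \<beta> u w)"
        unfolding I_det_eq_kagome det_on_kagome_eq[OF \<open>u \<noteq> 0\<close> \<open>w \<noteq> 0\<close>] f_def
        by (intro sum.cong refl) (simp only: h(2,3) sgn q_def simp_thms, simp only: mn cycle_monomial_int_comb mult.assoc simp_thms)
    qed
    fix x y :: complex
    have minus: "(- z) powi i = (if even i then z powi i else - (z powi i))" for z :: complex and i
      by (simp add: power_int_minus_left)
    show "s x y = 1/2 * (- f x y + f (- x) y + f x (- y) + f (- x) (- y))"
      unfolding s_def f_def sum_negf[symmetric] sum.distrib[symmetric] sum_distrib_left
      by (intro sum.cong refl) (simp add: q_def minus)
    show "f x y = 1/2 * (- s x y + s (- x) y + s x (- y) + s (- x) (- y))"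
      unfolding s_def f_def sum_negf[symmetric] sum.distrib[symmetric] sum_distrib_left
      by (intro sum.cong refl) (simp add: q_def minus)
  qed
qed

text \<open>S at one point involves I at four points that differ by signs of x and y, so the
  invariance of I is first transferred to all nonzero x and y.\<close>

lemma S_sum_invariant:
  assumes "evolution_step \<Lambda> W W'" "u \<noteq> 0" "w \<noteq> 0"
  shows "S_sum \<Lambda> W' u w = S_sum \<Lambda> W u w"
proof -
  obtain \<alpha> \<beta> where basis: "lattice_basis \<Lambda> \<alpha> \<beta>"
    using rank2 by (auto simp: rank2_sublattice_def)
  obtain s f where s: "in_cycle_variables \<alpha> \<beta> (S_sum \<Lambda> W) s" and f: "in_cycle_variables \<alpha> \<beta> (I_det \<Lambda> W) f"
    and sf: "\<And>x y. s x y = 1/2 * (- f x y + f (- x) y + f x (- y) + f (- x) (- y))"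
    by (rule cycle_variables_parity[OF basis]) (rule that)
  obtain s' f' where s': "in_cycle_variables \<alpha> \<beta> (S_sum \<Lambda> W') s'" and f': "in_cycle_variables \<alpha> \<beta> (I_det \<Lambda> W') f'"
    and sf': "\<And>x y. s' x y = 1/2 * (- f' x y + f' (- x) y + f' x (- y) + f' (- x) (- y))"
    by (rule cycle_variables_parity[OF basis]) (rule that)
  have eq: "f' x y = f x y" if "x \<noteq> 0" "y \<noteq> 0" for x y
    using in_cycle_variables_unique[OF basis f' f _ that] I_det_invariant[OF assms(1)] by blast
  let ?x = "cycle_monomial \<alpha> u w" and ?y = "cycle_monomial \<beta> u w"
  have "?x \<noteq> 0" "?y \<noteq> 0" using assms by (simp_all add: cycle_monomial_def)
  then have "s' ?x ?y = s ?x ?y" unfolding sf sf' by (simp add: eq)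
  then show ?thesis
    using s s' assms(2,3) by (simp add: in_cycle_variables_def)
qed

end

theorem theorem13p1:
  fixes \<Lambda> :: "(int \<times> int) set" and W :: matrix_family
  assumes "rank2_sublattice \<Lambda>"
  shows "(\<forall>W'. evolution_step \<Lambda> W W' \<longrightarrow>
            (\<forall>u w. u \<noteq> 0 \<longrightarrow> w \<noteq> 0 \<longrightarrow> S_sum \<Lambda> W' u w = S_sum \<Lambda> W u w)) \<and>
         (\<forall>\<alpha> \<beta>. lattice_basis \<Lambda> \<alpha> \<beta> \<longrightarrow>
            (\<exists>s. in_cycle_variables \<alpha> \<beta> (S_sum \<Lambda> W) s) \<and>
            (\<exists>f. in_cycle_variables \<alpha> \<beta> (I_det \<Lambda> W) f) \<and>
            (\<forall>s f. in_cycle_variables \<alpha> \<beta> (S_sum \<Lambda> W) s \<longrightarrow>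
                   in_cycle_variables \<alpha> \<beta> (I_det \<Lambda> W) f \<longrightarrow>
               (\<forall>x y. x \<noteq> 0 \<longrightarrow> y \<noteq> 0 \<longrightarrow>
                  s x y = 1/2 * (- f x y + f (- x) y + f x (- y) + f (- x) (- y)) \<and>
                  f x y = 1/2 * (- s x y + s (- x) y + s x (- y) + s (- x) (- y)))))"
proof -
  interpret sublattice \<Lambda> by (rule sublattice.intro) (rule assms)
  show ?thesis
  proof (intro conjI allI impI)
    show "S_sum \<Lambda> W' u w = S_sum \<Lambda> W u w" if "evolution_step \<Lambda> W W'" "u \<noteq> 0" "w \<noteq> 0" for W' u w
      using that by (rule S_sum_invariant)
  next
    fix \<alpha> \<beta> assume basis: "lattice_basis \<Lambda> \<alpha> \<beta>"
    obtain s\<^sub>0 f\<^sub>0 where s\<^sub>0: "in_cycle_variables \<alpha> \<beta> (S_sum \<Lambda> W) s\<^sub>0"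
      and f\<^sub>0: "in_cycle_variables \<alpha> \<beta> (I_det \<Lambda> W) f\<^sub>0"
      and sf: "\<And>x y. s\<^sub>0 x y = 1/2 * (- f\<^sub>0 x y + f\<^sub>0 (- x) y + f\<^sub>0 x (- y) + f\<^sub>0 (- x) (- y))"
      and fs: "\<And>x y. f\<^sub>0 x y = 1/2 * (- s\<^sub>0 x y + s\<^sub>0 (- x) y + s\<^sub>0 x (- y) + s\<^sub>0 (- x) (- y))"
      by (rule cycle_variables_parity[OF basis]) (rule that)
    show "\<exists>s. in_cycle_variables \<alpha> \<beta> (S_sum \<Lambda> W) s" "\<exists>f. in_cycle_variables \<alpha> \<beta> (I_det \<Lambda> W) f"
      using s\<^sub>0 f\<^sub>0 by blast+
    fix s f and x y :: complex
    assume s: "in_cycle_variables \<alpha> \<beta> (S_sum \<Lambda> W) s" and f: "in_cycle_variables \<alpha> \<beta> (I_det \<Lambda> W) f"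
      and xy: "x \<noteq> 0" "y \<noteq> 0"
    \<comment> \<open>At nonzero arguments a function of the cycle variables is unique, so the
      formulas carry over from \<open>s\<^sub>0\<close> and \<open>f\<^sub>0\<close>.\<close>
    have s_eq: "s x y = s\<^sub>0 x y" if "x \<noteq> 0" "y \<noteq> 0" for x y
      by (rule in_cycle_variables_unique[OF basis s s\<^sub>0 refl that])
    have f_eq: "f x y = f\<^sub>0 x y" if "x \<noteq> 0" "y \<noteq> 0" for x y
      by (rule in_cycle_variables_unique[OF basis f f\<^sub>0 refl that])
    show "s x y = 1/2 * (- f x y + f (- x) y + f x (- y) + f (- x) (- y))"
      using xy sf[of x y] by (simp add: s_eq f_eq)
    show "f x y = 1/2 * (- s x y + s (- x) y + s x (- y) + s (- x) (- y))"
      using xy fs[of x y] by (simp add: s_eq f_eq)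
  qed
qed

end
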